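(* The theory $S_{\overline\alpha}$ has an atomic model if and only if $\overline\alpha$ is coherent.
   Context: Fix a finite relational language $L$ in which every relation symbol has arity at least $2$. $K_L$ is the class of all finite $L$-structures (including the empty one) in which every relation symbol is interpreted symmetrically and irreflexively. Fix $\overline\alpha:L\to(0,1]$, writing $\overline\alpha_E=\overline\alpha(E)$, such that it is not the case that all symbols of $L$ are binary and $\overline\alpha_E=1$ for all $E$. For $\mathfrak A\in K_L$ let $N_E(\mathfrak A)$ be the number of subsets of $A$ on which $E$ holds and $\delta(\mathfrak A)=|A|-\sum_{E}\overline\alpha_E N_E(\mathfrak A)$. $K_{\overline\alpha}=\{\mathfrak A\in K_L:\delta(\mathfrak A')\ge0\text{ for all substructures }\mathfrak A'\subseteq\mathfrak A\}$. For $\mathfrak A\subseteq\mathfrak B$ in $K_L$, $\mathfrak A\le\mathfrak B$ means $\delta(\mathfrak A)\le\delta(\mathfrak A')$ for all $\mathfrak A\subseteq\mathfrak A'\subseteq\mathfrak B$. $S_{\overline\alpha}$ is the theory whose models $\mathfrak M$ are those in which every finite substructure lies in $K_{\overline\alpha}$ and, for all $\mathfrak A\le\mathfrak B$ in $K_{\overline\alpha}$, every embedding $\mathfrak A\to\mathfrak M$ extends to an embedding $\mathfrak B\to\mathfrak M$. $\overline\alpha$ is coherent if there are positive integers $m_E$ ($E\in L$) with $\sum_{E\in L}m_E\overline\alpha_E\in\mathbb Q$. *)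

theory Defs
  imports Complex_Main
begin

datatype 'r fm =
    FRel 'r "nat list"
  | FEq nat nat
  | FNeg "'r fm"
  | FConj "'r fm" "'r fm"
  | FEx nat "'r fm"

fun fv :: "'r fm \<Rightarrow> nat set" where
  "fv (FRel E xs) = set xs"
| "fv (FEq x y) = {x, y}"
| "fv (FNeg \<phi>) = fv \<phi>"
| "fv (FConj \<phi> \<psi>) = fv \<phi> \<union> fv \<psi>"
| "fv (FEx x \<phi>) = fv \<phi> - {x}"

fun symbs :: "'r fm \<Rightarrow> 'r set" where
  "symbs (FRel E xs) = {E}"
| "symbs (FEq x y) = {}"
| "symbs (FNeg \<phi>) = symbs \<phi>"
| "symbs (FConj \<phi> \<psi>) = symbs \<phi> \<union> symbs \<psi>"
| "symbs (FEx x \<phi>) = symbs \<phi>"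

text \<open>A symmetric irreflexive L-structure is given by its universe M and, for each
  relation symbol E, the set R E of (ar E)-element subsets of M on which E holds.
  E(x1,...,xn) holds iff n = ar E, the xi are pairwise distinct and {x1,...,xn} is in R E.\<close>

fun sat :: "('r \<Rightarrow> nat) \<Rightarrow> 'a set \<Rightarrow> ('r \<Rightarrow> 'a set set) \<Rightarrow> (nat \<Rightarrow> 'a) \<Rightarrow> 'r fm \<Rightarrow> bool" where
  "sat ar M R v (FRel E xs) = (length xs = ar E \<and> distinct (map v xs) \<and> v ` set xs \<in> R E)"
| "sat ar M R v (FEq x y) = (v x = v y)"
| "sat ar M R v (FNeg \<phi>) = (\<not> sat ar M R v \<phi>)"
| "sat ar M R v (FConj \<phi> \<psi>) = (sat ar M R v \<phi> \<and> sat ar M R v \<psi>)"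
| "sat ar M R v (FEx x \<phi>) = (\<exists>a\<in>M. sat ar M R (v(x := a)) \<phi>)"

definition sym_structure :: "'r set \<Rightarrow> ('r \<Rightarrow> nat) \<Rightarrow> 'a set \<Rightarrow> ('r \<Rightarrow> 'a set set) \<Rightarrow> bool" where
  "sym_structure L ar A R \<longleftrightarrow> (\<forall>E\<in>L. \<forall>S\<in>R E. S \<subseteq> A \<and> card S = ar E)"

definition NE :: "('r \<Rightarrow> 'a set set) \<Rightarrow> 'r \<Rightarrow> 'a set \<Rightarrow> nat" where
  "NE R E X = card {S \<in> R E. S \<subseteq> X}"

definition delta :: "'r set \<Rightarrow> ('r \<Rightarrow> real) \<Rightarrow> ('r \<Rightarrow> 'a set set) \<Rightarrow> 'a set \<Rightarrow> real" where
  "delta L \<alpha> R X = real (card X) - (\<Sum>E\<in>L. \<alpha> E * real (NE R E X))"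

text \<open>Substructures of (A,R) correspond to subsets X of A with the induced relations;
  delta of the induced substructure on X is delta L alpha R X.\<close>

definition in_K_alpha :: "'r set \<Rightarrow> ('r \<Rightarrow> nat) \<Rightarrow> ('r \<Rightarrow> real) \<Rightarrow> 'a set \<Rightarrow> ('r \<Rightarrow> 'a set set) \<Rightarrow> bool" where
  "in_K_alpha L ar \<alpha> A R \<longleftrightarrow> finite A \<and> sym_structure L ar A R \<and> (\<forall>X. X \<subseteq> A \<longrightarrow> 0 \<le> delta L \<alpha> R X)"

definition strong :: "'r set \<Rightarrow> ('r \<Rightarrow> real) \<Rightarrow> 'a set \<Rightarrow> 'a set \<Rightarrow> ('r \<Rightarrow> 'a set set) \<Rightarrow> bool" where
  "strong L \<alpha> A B R \<longleftrightarrow> A \<subseteq> B \<and> (\<forall>X. A \<subseteq> X \<and> X \<subseteq> B \<longrightarrow> delta L \<alpha> R A \<le> delta L \<alpha> R X)"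

definition embedding :: "'r set \<Rightarrow> 'a set \<Rightarrow> ('r \<Rightarrow> 'a set set) \<Rightarrow> 'b set \<Rightarrow> ('r \<Rightarrow> 'b set set) \<Rightarrow> ('a \<Rightarrow> 'b) \<Rightarrow> bool" where
  "embedding L A RA M RM f \<longleftrightarrow> inj_on f A \<and> f ` A \<subseteq> M \<and>
     (\<forall>E\<in>L. \<forall>S. S \<subseteq> A \<longrightarrow> (S \<in> RA E \<longleftrightarrow> f ` S \<in> RM E))"

text \<open>Finite structures are (up to isomorphism) taken with universe a finite set of naturals.\<close>
definition model_S :: "'r set \<Rightarrow> ('r \<Rightarrow> nat) \<Rightarrow> ('r \<Rightarrow> real) \<Rightarrow> 'a set \<Rightarrow> ('r \<Rightarrow> 'a set set) \<Rightarrow> bool" where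
  "model_S L ar \<alpha> M R \<longleftrightarrow> M \<noteq> {} \<and> sym_structure L ar M R \<and>
     (\<forall>X. finite X \<and> X \<subseteq> M \<longrightarrow> 0 \<le> delta L \<alpha> R X) \<and>
     (\<forall>(B::nat set) RB A f. in_K_alpha L ar \<alpha> B RB \<and> strong L \<alpha> A B RB \<and> embedding L A RB M R f
        \<longrightarrow> (\<exists>g. embedding L B RB M R g \<and> (\<forall>x\<in>A. g x = f x)))"

text \<open>The type of the n-tuple v(0),...,v(n-1) is isolated (relative to Th(M)).\<close>
definition isolated_type :: "'r set \<Rightarrow> ('r \<Rightarrow> nat) \<Rightarrow> 'a set \<Rightarrow> ('r \<Rightarrow> 'a set set) \<Rightarrow> nat \<Rightarrow> (nat \<Rightarrow> 'a) \<Rightarrow> bool" where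
  "isolated_type L ar M R n v \<longleftrightarrow>
     (\<exists>\<phi>. symbs \<phi> \<subseteq> L \<and> fv \<phi> \<subseteq> {..<n} \<and> sat ar M R v \<phi> \<and>
        (\<forall>\<psi>. symbs \<psi> \<subseteq> L \<and> fv \<psi> \<subseteq> {..<n} \<longrightarrow>
           (\<forall>w. w ` {..<n} \<subseteq> M \<and> sat ar M R w \<phi> \<longrightarrow> sat ar M R w \<psi>) \<or>
           (\<forall>w. w ` {..<n} \<subseteq> M \<and> sat ar M R w \<phi> \<longrightarrow> \<not> sat ar M R w \<psi>)))"

definition atomic_structure :: "'r set \<Rightarrow> ('r \<Rightarrow> nat) \<Rightarrow> 'a set \<Rightarrow> ('r \<Rightarrow> 'a set set) \<Rightarrow> bool" where
  "atomic_structure L ar M R \<longleftrightarrow> (\<forall>n v. v ` {..<n} \<subseteq> M \<longrightarrow> isolated_type L ar M R n v)"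

definition atomic_model_S :: "'r set \<Rightarrow> ('r \<Rightarrow> nat) \<Rightarrow> ('r \<Rightarrow> real) \<Rightarrow> 'a set \<Rightarrow> ('r \<Rightarrow> 'a set set) \<Rightarrow> bool" where
  "atomic_model_S L ar \<alpha> M R \<longleftrightarrow> model_S L ar \<alpha> M R \<and> atomic_structure L ar M R"

definition coherent :: "'r set \<Rightarrow> ('r \<Rightarrow> real) \<Rightarrow> bool" where
  "coherent L \<alpha> \<longleftrightarrow> (\<exists>m :: 'r \<Rightarrow> nat. (\<forall>E\<in>L. 0 < m E) \<and> (\<Sum>E\<in>L. real (m E) * \<alpha> E) \<in> \<rat>)"

end

theory Submission
  imports Defs "HOL-Analysis.Kronecker_Approximation_Theorem"
begin

text \<open>
  Call (G, x) rooted if every subset of G containing x has rank at least that of G. Adding an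
  E-edge at the root, or a new root joined to the old one by an E-edge when the rank is below
  \<alpha> E, subtracts \<alpha> E from the rank modulo 1. Hence there are rooted structures with prescribed
  large numbers of edges of every kind, and their ranks lie in [0, 1).

  If \<alpha> is coherent, the edge numbers can be chosen so that gluing (G, x) to a point y of a finite
  structure makes y lie in a set of rank 0. So every structure of the class lies in one of rank 0,
  and a Fraisse chain of such structures gives a model covered by finite sets of rank 0.
  Isomorphisms between these have the back-and-forth property, so the diagram of such a set isolates
  the types of its tuples.

  If \<alpha> is incoherent, some \<alpha> E is irrational and, by Kronecker, ranks of rooted structures come
  arbitrarily close to 1 from below. Gluing these in decreases ranks by arbitrarily small amounts, invisible to
  small sets. First, this shows that isomorphisms between sufficiently closed finite sets preserve
  any given formula. Second, it gives two realisations, with different types, of any formula true of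
  a tuple that meets all relation symbols: the closed hull of such a tuple cannot have rank 0.
\<close>

subsection \<open>Structures, embeddings and ranks\<close>

text \<open>Rank 0 links the two sides of the theorem. If a finite set \<open>C\<close> of rank 0
  contains edges of every symbol, then the weighted edge count of \<open>C\<close> equals
  \<open>card C\<close>, a rational relation with positive coefficients. Conversely, since no rank
  is negative, a set of rank 0 is strong in every finite superset, so the extension axioms apply to
  it unconditionally. For other finite sets, being strong in an infinite model refers to supersets
  of unbounded size, which no single formula controls. Hence the graded notion
  \<open>closed_in k\<close>, which looks at \<open>k\<close> new points only. It is usable because
  a drop of the rank caused by at most \<open>k\<close> points is at least \<open>gap k\<close>,
  uniformly over all structures; a gadget with deficit below \<open>gap k\<close> escapes detection
  at level \<open>k\<close>. Both directions attach gadgets at a single point. Singletons carry no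
  edges, so gluing is always possible, and ranks add up, minus 1 for the shared point: a gadget of
  rank r lowers the rank by 1 - r. Edge counts determine a rank only modulo 1; confining it to [0,
  1) turns this into control of the rank itself.\<close>

lemma finite_crossing:
  assumes "finite P" "\<not> Q {}" "Q P"
  shows "\<exists>F S. insert S F \<subseteq> P \<and> S \<notin> F \<and> \<not> Q F \<and> Q (insert S F)"
  using assms
proof (induction P rule: finite_induct)
  case (insert x P)
  show ?case
  proof (cases "Q P")
    case True
    then obtain F S where "insert S F \<subseteq> P" "S \<notin> F" "\<not> Q F" "Q (insert S F)"
      using insert.IH insert.prems(1) by blast
    then show ?thesis by blast
  next
    case False
    with insert show ?thesis by blast
  qed
qed simp

lemma finite_min_ex:
  fixes f :: "'a \<Rightarrow> real"
  assumes "finite A" "A \<noteq> {}"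
  shows "\<exists>x\<in>A. \<forall>y\<in>A. f x \<le> f y"
proof -
  have "Min (f ` A) \<in> f ` A" using assms by (intro Min_in) auto
  moreover have "\<forall>y\<in>A. Min (f ` A) \<le> f y" using assms by simp
  ultimately show ?thesis by (metis imageE)
qed

lemma inj_on_image_subset_iff:
  "inj_on f C \<Longrightarrow> A \<subseteq> C \<Longrightarrow> B \<subseteq> C \<Longrightarrow> f ` A \<subseteq> f ` B \<longleftrightarrow> A \<subseteq> B"
  by (metis image_mono inj_on_image_mem_iff image_eqI subset_iff)

text \<open>Interpretations are functions on arbitrary sets, and extending a structure changes them
  off the old universe. Equality would be too strong, so only subsets of \<open>A\<close> and
  symbols in \<open>L\<close> are compared.\<close>

definition agree :: "'r set \<Rightarrow> 'a set \<Rightarrow> ('r \<Rightarrow> 'a set set) \<Rightarrow> ('r \<Rightarrow> 'a set set) \<Rightarrow> bool" where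
  "agree L A R R' \<longleftrightarrow> (\<forall>E\<in>L. \<forall>S. S \<subseteq> A \<longrightarrow> (S \<in> R E \<longleftrightarrow> S \<in> R' E))"

lemma agree_subset: "agree L A R R' \<Longrightarrow> B \<subseteq> A \<Longrightarrow> agree L B R R'"
  unfolding agree_def by blast

lemma agree_sym: "agree L A R R' \<Longrightarrow> agree L A R' R"
  unfolding agree_def by blast

lemma agree_trans: "agree L A R R' \<Longrightarrow> agree L A R' R'' \<Longrightarrow> agree L A R R''"
  unfolding agree_def by blast

lemma agree_refl [simp]: "agree L A R R"
  unfolding agree_def by blast

lemma NE_agree: "agree L X R R' \<Longrightarrow> E \<in> L \<Longrightarrow> NE R E X = NE R' E X"
  unfolding NE_def agree_def by (rule arg_cong[where f=card]) blast

lemma delta_agree: "agree L X R R' \<Longrightarrow> delta L \<alpha> R X = delta L \<alpha> R' X"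
  unfolding delta_def using NE_agree by (metis (mono_tags, lifting) sum.cong)

lemma finite_edges_subset: "finite X \<Longrightarrow> finite {S \<in> R. S \<subseteq> X}"
  by (rule finite_subset[of _ "Pow X"]) auto

lemma NE_mono: "finite Y \<Longrightarrow> X \<subseteq> Y \<Longrightarrow> NE R E X \<le> NE R E Y"
  unfolding NE_def by (rule card_mono) (auto simp: finite_edges_subset)

text \<open>Edges inside both sets are exactly those inside the intersection; the union may contain
  further edges that cross.\<close>

lemma NE_supermodular:
  assumes "finite X" "finite Y"
  shows "NE R E X + NE R E Y \<le> NE R E (X \<union> Y) + NE R E (X \<inter> Y)"
proof -
  let ?e = "\<lambda>X. {S \<in> R E. S \<subseteq> X}"
  have "card (?e X) + card (?e Y) = card (?e X \<union> ?e Y) + card (?e X \<inter> ?e Y)"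
    using assms by (intro card_Un_Int finite_edges_subset)
  moreover have "card (?e X \<union> ?e Y) \<le> card (?e (X \<union> Y))"
    using assms by (intro card_mono finite_edges_subset) auto
  moreover have "?e X \<inter> ?e Y = ?e (X \<inter> Y)" by auto
  ultimately show ?thesis unfolding NE_def by simp
qed

lemma embedding_comp:
  assumes "embedding L A RA B RB f" "embedding L B RB C RC g"
  shows "embedding L A RA C RC (g \<circ> f)"
proof -
  have f: "inj_on f A" "f ` A \<subseteq> B" "\<And>E S. E \<in> L \<Longrightarrow> S \<subseteq> A \<Longrightarrow> S \<in> RA E \<longleftrightarrow> f ` S \<in> RB E"
    and g: "inj_on g B" "g ` B \<subseteq> C" "\<And>E S. E \<in> L \<Longrightarrow> S \<subseteq> B \<Longrightarrow> S \<in> RB E \<longleftrightarrow> g ` S \<in> RC E"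
    using assms unfolding embedding_def by auto
  have "inj_on (g \<circ> f) A" using f g by (meson comp_inj_on inj_on_subset)
  moreover have "(S \<in> RA E) = ((g \<circ> f) ` S \<in> RC E)" if "E \<in> L" "S \<subseteq> A" for E S
  proof -
    have "f ` S \<subseteq> B" using f(2) that by blast
    then show ?thesis using f(3)[OF that] g(3)[OF that(1)] by (simp add: image_comp)
  qed
  ultimately show ?thesis using f g unfolding embedding_def by (auto simp: image_subset_iff)
qed

lemma embedding_subset: "embedding L A RA M RM f \<Longrightarrow> B \<subseteq> A \<Longrightarrow> embedding L B RA M RM f"
  unfolding embedding_def by (auto intro: inj_on_subset)

lemma embedding_mono: "embedding L A RA M RM f \<Longrightarrow> M \<subseteq> N \<Longrightarrow> embedding L A RA N RM f"
  unfolding embedding_def by auto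

lemma embedding_restrict: "embedding L A RA M RM f \<Longrightarrow> embedding L A RA (f ` A) RM f"
  unfolding embedding_def by auto

lemma embedding_agree:
  assumes "embedding L A RA M RM f" "agree L A RA RA'" "agree L M RM RM'"
  shows "embedding L A RA' M RM' f"
proof -
  have "(S \<in> RA' E) = (f ` S \<in> RM' E)" if "E \<in> L" "S \<subseteq> A" for E S
  proof -
    have "f ` S \<subseteq> M" using assms(1) that unfolding embedding_def by blast
    then have "f ` S \<in> RM E \<longleftrightarrow> f ` S \<in> RM' E" using assms(3) that(1) unfolding agree_def by simp
    moreover have "S \<in> RA E \<longleftrightarrow> S \<in> RA' E" using assms(2) that unfolding agree_def by simp
    moreover have "S \<in> RA E \<longleftrightarrow> f ` S \<in> RM E" using assms(1) that unfolding embedding_def by simp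
    ultimately show ?thesis by simp
  qed
  then show ?thesis using assms(1) unfolding embedding_def by blast
qed

lemma embedding_cong:
  assumes "embedding L A RA M RM f" "\<And>x. x \<in> A \<Longrightarrow> g x = f x"
  shows "embedding L A RA M RM g"
proof -
  have "g ` S = f ` S" if "S \<subseteq> A" for S using assms(2) that by (intro image_cong) auto
  moreover have "inj_on g A = inj_on f A" using assms(2) by (intro inj_on_cong) auto
  ultimately show ?thesis using assms(1) unfolding embedding_def by simp
qed

lemma embedding_inv:
  assumes "embedding L A RA M RM f"
  shows "embedding L (f ` A) RM A RA (inv_into A f)"
proof -
  have f: "inj_on f A" "\<And>E S. E \<in> L \<Longrightarrow> S \<subseteq> A \<Longrightarrow> S \<in> RA E \<longleftrightarrow> f ` S \<in> RM E"
    using assms unfolding embedding_def by auto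
  have "(S \<in> RM E) = (inv_into A f ` S \<in> RA E)" if "E \<in> L" "S \<subseteq> f ` A" for E S
  proof -
    have "inv_into A f ` S \<subseteq> A" using that by (meson image_subset_iff inv_into_into subsetD)
    moreover have "f ` inv_into A f ` S = S" using that by (simp add: image_inv_into_cancel)
    ultimately show ?thesis using f(2)[OF that(1)] by metis
  qed
  then show ?thesis unfolding embedding_def
    by (auto simp: inj_on_inv_into inv_into_into)
qed

lemma embedding_id: "agree L A R R' \<Longrightarrow> A \<subseteq> M \<Longrightarrow> embedding L A R M R' id"
  unfolding embedding_def agree_def by auto

lemma NE_embedding:
  assumes "embedding L A RA M RM f" "X \<subseteq> A" "E \<in> L"
  shows "NE RA E X = NE RM E (f ` X)"
proof -
  have f: "inj_on f A" "\<And>S. S \<subseteq> A \<Longrightarrow> S \<in> RA E \<longleftrightarrow> f ` S \<in> RM E"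
    using assms unfolding embedding_def by auto
  have "bij_betw ((`) f) {S \<in> RA E. S \<subseteq> X} {S \<in> RM E. S \<subseteq> f ` X}"
    unfolding bij_betw_def
  proof
    show "inj_on ((`) f) {S \<in> RA E. S \<subseteq> X}"
      by (rule inj_on_subset[OF inj_on_image_Pow[OF inj_on_subset[OF f(1) assms(2)]]]) auto
    show "(`) f ` {S \<in> RA E. S \<subseteq> X} = {S \<in> RM E. S \<subseteq> f ` X}"
    proof (intro equalityI subsetI)
      fix S assume "S \<in> (`) f ` {S \<in> RA E. S \<subseteq> X}"
      then show "S \<in> {S \<in> RM E. S \<subseteq> f ` X}" using f(2) assms(2) by auto
    next
      fix S assume S: "S \<in> {S \<in> RM E. S \<subseteq> f ` X}"
      then obtain T where "T \<subseteq> X" "S = f ` T" by (auto elim: subset_imageE)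
      then show "S \<in> (`) f ` {S \<in> RA E. S \<subseteq> X}" using f(2) assms(2) S by auto
    qed
  qed
  then show ?thesis unfolding NE_def by (rule bij_betw_same_card)
qed

lemma delta_embedding:
  assumes "embedding L A RA M RM f" "X \<subseteq> A"
  shows "delta L \<alpha> RM (f ` X) = delta L \<alpha> RA X"
proof -
  have "card (f ` X) = card X"
    using assms unfolding embedding_def by (meson card_image inj_on_subset)
  then show ?thesis unfolding delta_def using NE_embedding[OF assms] by simp
qed

lemma sym_structure_subset:
  "sym_structure L ar A R \<Longrightarrow> A \<subseteq> B \<Longrightarrow> sym_structure L ar B R"
  unfolding sym_structure_def by blast

text \<open>With \<open>h = id\<close> this is the restriction to \<open>D\<close>, needed because
  membership in the class forbids edges that leave the universe. With an injection into the naturals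
  it gives the copies to which the extension axioms apply.\<close>

definition push :: "('a \<Rightarrow> 'b) \<Rightarrow> 'a set \<Rightarrow> ('r \<Rightarrow> 'a set set) \<Rightarrow> 'r \<Rightarrow> 'b set set" where
  "push h D R E = (`) h ` {S \<in> R E. S \<subseteq> D}"

lemma embedding_push:
  assumes "inj_on h D"
  shows "embedding L D R (h ` D) (push h D R) h"
proof -
  have "S \<in> R E" if "S \<subseteq> D" "T \<in> R E" "T \<subseteq> D" "h ` S = h ` T" for S T E
    using inj_on_image_eq_iff[OF assms that(1,3)] that by auto
  then show ?thesis using assms unfolding embedding_def push_def by auto
qed

lemma sym_structure_push:
  assumes "inj_on h D" "sym_structure L ar M R"
  shows "sym_structure L ar (h ` D) (push h D R)"
  unfolding sym_structure_def push_def
  using assms by (auto simp: sym_structure_def card_image[OF inj_on_subset[OF assms(1)]])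

lemma agree_push_id: "agree L D R (push id D R)"
  unfolding agree_def push_def by auto

section \<open>Submodularity of the rank and the gap below zero\<close>

locale rank =
  fixes L :: "'r set" and ar :: "'r \<Rightarrow> nat" and \<alpha> :: "'r \<Rightarrow> real"
  assumes finite_L: "finite L" and L_ne: "L \<noteq> {}"
    and ar2: "E \<in> L \<Longrightarrow> 2 \<le> ar E"
    and \<alpha>_pos: "E \<in> L \<Longrightarrow> 0 < \<alpha> E"
    and \<alpha>_le: "E \<in> L \<Longrightarrow> \<alpha> E \<le> 1"
begin

abbreviation d :: "('r \<Rightarrow> 'a set set) \<Rightarrow> 'a set \<Rightarrow> real" where
  "d \<equiv> delta L \<alpha>"

abbreviation K :: "'a set \<Rightarrow> ('r \<Rightarrow> 'a set set) \<Rightarrow> bool" where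
  "K \<equiv> in_K_alpha L ar \<alpha>"

abbreviation str :: "'a set \<Rightarrow> ('r \<Rightarrow> 'a set set) \<Rightarrow> bool" where
  "str \<equiv> sym_structure L ar"

abbreviation emb where
  "emb \<equiv> embedding L"

text \<open>Points are counted modularly and edges supermodularly, with positive weights. Nearly
  every closure argument below rests on this inequality: it moves a rank deficit from a set to its
  intersection or union with another.\<close>

lemma submodular:
  assumes "finite X" "finite Y"
  shows "d R (X \<union> Y) + d R (X \<inter> Y) \<le> d R X + d R Y"
proof -
  have "(\<Sum>E\<in>L. \<alpha> E * real (NE R E X)) + (\<Sum>E\<in>L. \<alpha> E * real (NE R E Y))
     \<le> (\<Sum>E\<in>L. \<alpha> E * real (NE R E (X \<union> Y))) + (\<Sum>E\<in>L. \<alpha> E * real (NE R E (X \<inter> Y)))"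
    unfolding sum.distrib[symmetric] distrib_left[symmetric] of_nat_add[symmetric]
    using \<alpha>_pos
    by (intro sum_mono mult_left_mono of_nat_mono NE_supermodular[OF assms]) (auto simp: less_imp_le)
  moreover have "real (card (X \<union> Y)) + real (card (X \<inter> Y)) = real (card X) + real (card Y)"
    using card_Un_Int[OF assms] by linarith
  ultimately show ?thesis unfolding delta_def by linarith
qed

lemma delta_empty:
  assumes "str M R" shows "d R {} = 0"
proof -
  have "NE R E {} = 0" if "E \<in> L" for E
  proof -
    have "{S \<in> R E. S \<subseteq> {}} = {}" using assms ar2[OF that] that unfolding sym_structure_def by fastforce
    then show ?thesis unfolding NE_def by simp
  qed
  then show ?thesis unfolding delta_def by simp
qed

lemma delta_singleton:
  assumes "str M R" shows "d R {y} = 1"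
proof -
  have "NE R E {y} = 0" if E: "E \<in> L" for E
  proof -
    have "\<not> S \<subseteq> {y}" if "S \<in> R E" for S
    proof
      assume "S \<subseteq> {y}"
      then have "card S \<le> 1" using card_mono[of "{y}" S] by simp
      then show False using assms ar2[OF E] E that unfolding sym_structure_def by fastforce
    qed
    then have "{S \<in> R E. S \<subseteq> {y}} = {}" by blast
    then show ?thesis unfolding NE_def by simp
  qed
  then show ?thesis unfolding delta_def by simp
qed

text \<open>Relative ranks of extensions by at most k points take only finitely many values in [-1, 0).\<close>
lemma rank_gap:
  "\<exists>\<epsilon>>0. \<forall>j\<le>k. \<forall>e :: 'r \<Rightarrow> nat. real j - (\<Sum>E\<in>L. \<alpha> E * real (e E)) < 0 \<longrightarrow>
      real j - (\<Sum>E\<in>L. \<alpha> E * real (e E)) \<le> - \<epsilon>"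
proof -
  \<comment> \<open>More than \<open>b E\<close> edges of one kind already weigh at least
    \<open>k + 1\<close>, which puts the value at -1 or lower. Only finitely many count vectors
    remain.\<close>
  define b where "b E = nat \<lceil>(real k + 1) / \<alpha> E\<rceil>" for E
  let ?v = "\<lambda>j (e :: 'r \<Rightarrow> nat). (\<Sum>E\<in>L. \<alpha> E * real (e E)) - real j"
  define V where "V = {x. x > 0 \<and> (\<exists>j\<le>k. \<exists>e\<in>(\<Pi>\<^sub>E E\<in>L. {..b E}). x = ?v j e)}"
  have "V \<subseteq> (\<lambda>(j, e). ?v j e) ` ({..k} \<times> (\<Pi>\<^sub>E E\<in>L. {..b E}))"
    unfolding V_def by (auto simp: image_iff)
  moreover have "finite (\<Pi>\<^sub>E E\<in>L. {..b E})" using finite_L by (intro finite_PiE) auto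
  ultimately have finV: "finite V" by (meson finite_SigmaI finite_atMost finite_imageI finite_subset)
  \<comment> \<open>The inserted 1 covers an empty \<open>V\<close> and the count vectors beyond the
    bounds \<open>b\<close>.\<close>
  define \<epsilon> where "\<epsilon> = Min (insert 1 V)"
  have eps: "\<epsilon> > 0" "\<epsilon> \<le> 1" "\<And>x. x \<in> V \<Longrightarrow> \<epsilon> \<le> x"
    using finV unfolding \<epsilon>_def V_def by auto
  have gv: "\<epsilon> \<le> ?v j e" if j: "j \<le> k" and pos: "?v j e > 0" for j e
  proof (cases "\<forall>E\<in>L. e E \<le> b E")
    case True
    let ?e = "restrict e L"
    have e: "?e \<in> (\<Pi>\<^sub>E E\<in>L. {..b E})" using True by auto
    have "?v j e \<in> V" unfolding V_def mem_Collect_eq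
    proof (intro conjI exI bexI)
      show "?v j e = ?v j ?e" by simp
    qed (rule pos j e)+
    then show ?thesis using eps by blast
  next
    case False
    then obtain E where E: "E \<in> L" "e E > b E" by auto
    have "(real k + 1) / \<alpha> E \<le> real (b E)" unfolding b_def by linarith
    then have "(real k + 1) / \<alpha> E \<le> real (e E)" using E by linarith
    then have "real k + 1 \<le> \<alpha> E * real (e E)" using \<alpha>_pos[OF E(1)] by (simp add: field_simps)
    also have "\<dots> \<le> (\<Sum>E\<in>L. \<alpha> E * real (e E))"
      using \<alpha>_pos finite_L E(1) by (intro member_le_sum) (auto simp: less_imp_le)
    finally show ?thesis using eps j by linarith
  qed
  then have "real j - (\<Sum>E\<in>L. \<alpha> E * real (e E)) \<le> - \<epsilon>"
    if "j \<le> k" "real j - (\<Sum>E\<in>L. \<alpha> E * real (e E)) < 0" for j e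
    using that gv[of j e] by linarith
  then show ?thesis using eps(1) by blast
qed

definition gap :: "nat \<Rightarrow> real" where
  "gap k = (SOME \<epsilon>. \<epsilon> > 0 \<and> (\<forall>j\<le>k. \<forall>e :: 'r \<Rightarrow> nat. real j - (\<Sum>E\<in>L. \<alpha> E * real (e E)) < 0 \<longrightarrow>
      real j - (\<Sum>E\<in>L. \<alpha> E * real (e E)) \<le> - \<epsilon>))"

lemma gap_pos: "gap k > 0"
  and gap_nat: "\<And>e. j \<le> k \<Longrightarrow> real j - (\<Sum>E\<in>L. \<alpha> E * real (e E)) < 0 \<Longrightarrow>
      real j - (\<Sum>E\<in>L. \<alpha> E * real (e E)) \<le> - gap k"
  using someI_ex[OF rank_gap[of k]] unfolding gap_def[symmetric] by blast+

text \<open>A relative rank depends only on the numbers of new points and new edges, so one bound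
  serves structures of every size.\<close>

lemma gap:
  assumes "finite Y" "X \<subseteq> Y" "card (Y - X) \<le> k" "d R Y < d R X"
  shows "d R Y \<le> d R X - gap k"
proof -
  have "card Y = card X + card (Y - X)"
    using assms(1,2) by (metis card_Diff_subset card_mono finite_subset le_add_diff_inverse)
  moreover have "(\<Sum>E\<in>L. \<alpha> E * real (NE R E Y)) - (\<Sum>E\<in>L. \<alpha> E * real (NE R E X))
     = (\<Sum>E\<in>L. \<alpha> E * real (NE R E Y - NE R E X))"
    unfolding sum_subtractf[symmetric]
    by (rule sum.cong[OF refl]) (simp only: of_nat_diff[OF NE_mono[OF assms(1,2)]] right_diff_distrib)
  ultimately have *: "d R Y - d R X = real (card (Y - X)) - (\<Sum>E\<in>L. \<alpha> E * real (NE R E Y - NE R E X))"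
    unfolding delta_def by simp
  show ?thesis using gap_nat[OF assms(3), of "\<lambda>E. NE R E Y - NE R E X"] assms(4) unfolding *[symmetric]
    by linarith
qed

subsection \<open>Free amalgamation\<close>

text \<open>No edge joins the two sides, so each edge lies in \<open>N\<close> or in the image of
  \<open>B\<close>. Inclusion-exclusion for points and for edges then gives the rank formula, with
  the image of \<open>A\<close> as the common part.\<close>

lemma free_amalgam:
  fixes N :: "nat set"
  assumes "finite N" "finite B" "str N RN" "str B RB" "A \<subseteq> B" "emb A RB N RN f"
  obtains N' R g where "finite N'" "str N' R" "N' = N \<union> g ` B" "N \<inter> g ` B = f ` A" "agree L N RN R"
    "emb B RB N' R g" "\<And>x. x \<in> A \<Longrightarrow> g x = f x"
    "\<And>X. X \<subseteq> N' \<Longrightarrow> d R X = d R (X \<inter> N) + d R (X \<inter> g ` B) - d R (X \<inter> f ` A)"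
proof -
  have f: "inj_on f A" "f ` A \<subseteq> N" "\<And>E S. E \<in> L \<Longrightarrow> S \<subseteq> A \<Longrightarrow> S \<in> RB E \<longleftrightarrow> f ` S \<in> RN E"
    using assms(6) unfolding embedding_def by auto
  have fr: "n \<le> Max (insert 0 N)" if "n \<in> N" for n using assms(1) that by auto
  \<comment> \<open>Points of \<open>B - A\<close> are sent above the maximum of \<open>N\<close>,
    hence off \<open>N\<close>; the inserted 0 covers an empty \<open>N\<close>.\<close>
  define g where "g x = (if x \<in> A then f x else Max (insert 0 N) + 1 + to_nat_on B x)" for x
  have out: "g x \<notin> N" if "x \<notin> A" for x using fr[of "g x"] that unfolding g_def by auto
  have cB: "countable B" using assms(2) by (rule countable_finite)
  have inj: "inj_on g B"
  proof (rule inj_onI)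
    fix x y assume xy: "x \<in> B" "y \<in> B" "g x = g y"
    have "x \<in> A \<longleftrightarrow> y \<in> A" using xy out f(2) unfolding g_def by (metis imageI subsetD)
    then show "x = y" using xy f(1) inj_on_to_nat_on[OF cB] assms(5) unfolding g_def inj_on_def
      by (cases "x \<in> A") auto
  qed
  have int: "N \<inter> g ` B = f ` A"
  proof (intro equalityI subsetI)
    fix n assume "n \<in> N \<inter> g ` B" then show "n \<in> f ` A" using out unfolding g_def by auto
  next
    fix n assume "n \<in> f ` A"
    then obtain x where "x \<in> A" "n = f x" by blast
    then show "n \<in> N \<inter> g ` B" using assms(5) f(2) by (auto simp: g_def image_iff)
  qed
  define RG where "RG = push g B RB"
  have gB: "emb B RB (g ` B) RG g" unfolding RG_def by (rule embedding_push[OF inj])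
  have strG: "str (g ` B) RG" unfolding RG_def by (rule sym_structure_push[OF inj assms(4)])
  have agr: "S \<in> RN E \<longleftrightarrow> S \<in> RG E" if E: "E \<in> L" and S: "S \<subseteq> f ` A" for E S
  proof -
    obtain T where T: "T \<subseteq> A" "S = f ` T" by (rule subset_imageE[OF S])
    have "g ` T = f ` T" using T unfolding g_def by (intro image_cong) auto
    moreover have "T \<in> RB E \<longleftrightarrow> g ` T \<in> RG E" using gB E T assms(5) unfolding embedding_def by blast
    ultimately show ?thesis using T f(3)[OF E, of T] by simp
  qed
  define R where "R E = RN E \<union> RG E" for E
  define N' where "N' = N \<union> g ` B"
  have sN: "S \<subseteq> N" if "E \<in> L" "S \<in> RN E" for E S using assms(3) that unfolding sym_structure_def by blast
  have sG: "S \<subseteq> g ` B" if "E \<in> L" "S \<in> RG E" for E S using strG that unfolding sym_structure_def by blast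
  have "S \<in> RN E" if "E \<in> L" "S \<subseteq> N" "S \<in> RG E" for E S
    using agr[OF that(1), of S] sG[OF that(1,3)] that(2,3) int by (metis le_inf_iff)
  then have aN: "agree L N RN R" unfolding agree_def R_def by auto
  have "S \<in> RG E" if "E \<in> L" "S \<subseteq> g ` B" "S \<in> RN E" for E S
    using agr[OF that(1), of S] sN[OF that(1,3)] that(2,3) int by (metis le_inf_iff)
  then have aG: "agree L (g ` B) RG R" unfolding agree_def R_def by auto
  have embg: "emb B RB N' R g"
    using embedding_mono[OF embedding_agree[OF gB agree_refl aG]] unfolding N'_def by blast
  have finN': "finite N'" using assms unfolding N'_def by blast
  have dl: "d R X = d R (X \<inter> N) + d R (X \<inter> g ` B) - d R (X \<inter> f ` A)" if X: "X \<subseteq> N'" for X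
  proof -
    have fX: "finite X" using X finN' by (rule finite_subset)
    have "NE R E X + NE R E (X \<inter> f ` A) = NE R E (X \<inter> N) + NE R E (X \<inter> g ` B)" if E: "E \<in> L" for E
    proof -
      let ?e = "\<lambda>X. {S \<in> R E. S \<subseteq> X}"
      have "?e X = ?e (X \<inter> N) \<union> ?e (X \<inter> g ` B)"
        using sN[OF E] sG[OF E] unfolding R_def by blast
      moreover have "?e (X \<inter> f ` A) = ?e (X \<inter> N) \<inter> ?e (X \<inter> g ` B)" using int by blast
      ultimately show ?thesis unfolding NE_def
        using card_Un_Int[of "?e (X \<inter> N)" "?e (X \<inter> g ` B)"] fX by (simp add: finite_edges_subset)
    qed
    then have "\<alpha> E * real (NE R E X) + \<alpha> E * real (NE R E (X \<inter> f ` A))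
        = \<alpha> E * real (NE R E (X \<inter> N)) + \<alpha> E * real (NE R E (X \<inter> g ` B))" if "E \<in> L" for E
      unfolding distrib_left[symmetric] of_nat_add[symmetric] using that by metis
    then have "(\<Sum>E\<in>L. \<alpha> E * real (NE R E X)) + (\<Sum>E\<in>L. \<alpha> E * real (NE R E (X \<inter> f ` A)))
        = (\<Sum>E\<in>L. \<alpha> E * real (NE R E (X \<inter> N))) + (\<Sum>E\<in>L. \<alpha> E * real (NE R E (X \<inter> g ` B)))"
      unfolding sum.distrib[symmetric] by (intro sum.cong) auto
    moreover have "card X + card (X \<inter> f ` A) = card (X \<inter> N) + card (X \<inter> g ` B)"
    proof -
      have "X = (X \<inter> N) \<union> (X \<inter> g ` B)" using X unfolding N'_def by blast
      moreover have "X \<inter> f ` A = (X \<inter> N) \<inter> (X \<inter> g ` B)" using int by blast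
      ultimately show ?thesis using card_Un_Int[of "X \<inter> N" "X \<inter> g ` B"] fX by simp
    qed
    ultimately show ?thesis unfolding delta_def by linarith
  qed
  have "str N' R" using assms(3) strG unfolding sym_structure_def N'_def R_def by blast
  with finN' show thesis using that[of N' R g] dl embg aN int unfolding N'_def by (auto simp: g_def)
qed

lemma in_K_delta_nonneg: "K A R \<Longrightarrow> X \<subseteq> A \<Longrightarrow> 0 \<le> d R X"
  and in_K_finite: "K A R \<Longrightarrow> finite A"
  and in_K_str: "K A R \<Longrightarrow> str A R"
  unfolding in_K_alpha_def by blast+

lemma in_K_subset:
  assumes "K A R" "B \<subseteq> A" shows "K B (push id B R)"
proof -
  have "d (push id B R) X = d R X" if "X \<subseteq> B" for X
    using delta_agree[OF agree_subset[OF agree_push_id that]] by metis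
  then show ?thesis using assms sym_structure_push[of id B L ar A R] unfolding in_K_alpha_def
    by (auto intro: finite_subset)
qed

lemma in_K_push:
  assumes "str M R" "finite D" "inj_on h D" "\<And>X. X \<subseteq> D \<Longrightarrow> 0 \<le> d R X"
  shows "K (h ` D) (push h D R)"
proof -
  have "0 \<le> d (push h D R) X" if X: "X \<subseteq> h ` D" for X
  proof -
    obtain Y where "Y \<subseteq> D" "X = h ` Y" using X by (auto elim: subset_imageE)
    then show ?thesis using delta_embedding[OF embedding_push[OF assms(3)]] assms(4) by metis
  qed
  then show ?thesis using assms sym_structure_push[OF assms(3,1)] unfolding in_K_alpha_def by simp
qed

text \<open>Submodularity inside \<open>B\<close> passes strongness down from \<open>A\<close> to
  traces: \<open>Y \<inter> A\<close> has at most the rank of \<open>Y\<close>. So the part of a set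
  outside \<open>N\<close> contributes a nonnegative amount to its rank.\<close>

lemma strong_amalgam:
  fixes N :: "nat set"
  assumes "K N RN" "K B RB" "strong L \<alpha> A B RB" "emb A RB N RN f"
  obtains N' R g where "K N' R" "N \<subseteq> N'" "agree L N RN R" "emb B RB N' R g" "\<And>x. x \<in> A \<Longrightarrow> g x = f x"
proof -
  have AB: "A \<subseteq> B" using assms(3) unfolding strong_def by blast
  obtain N' R g where g: "finite N'" "str N' R" "N' = N \<union> g ` B" "N \<inter> g ` B = f ` A" "agree L N RN R"
    "emb B RB N' R g" "\<And>x. x \<in> A \<Longrightarrow> g x = f x"
    "\<And>X. X \<subseteq> N' \<Longrightarrow> d R X = d R (X \<inter> N) + d R (X \<inter> g ` B) - d R (X \<inter> f ` A)"
    using free_amalgam[OF in_K_finite[OF assms(1)] in_K_finite[OF assms(2)] in_K_str[OF assms(1)]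
        in_K_str[OF assms(2)] AB assms(4)] by blast
  have "0 \<le> d R X" if X: "X \<subseteq> N'" for X
  proof -
    have inj: "inj_on g B" using g(6) unfolding embedding_def by blast
    obtain Y where Y: "Y \<subseteq> B" "X \<inter> g ` B = g ` Y" by (metis inf_le2 subset_imageE)
    have fA: "f ` A = g ` A" using g(7) by auto
    have "X \<inter> f ` A = (X \<inter> g ` B) \<inter> g ` A" using fA AB by blast
    also have "\<dots> = g ` (Y \<inter> A)" unfolding Y(2) using inj_on_image_Int[OF inj Y(1) AB] by simp
    finally have XA: "X \<inter> f ` A = g ` (Y \<inter> A)" .
    have fB: "finite B" using in_K_finite[OF assms(2)] .
    have "d RB (Y \<union> A) + d RB (Y \<inter> A) \<le> d RB Y + d RB A"
      using submodular[of Y A RB] Y(1) AB fB by (meson finite_subset)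
    moreover have "d RB A \<le> d RB (Y \<union> A)" using assms(3) Y(1) AB unfolding strong_def by blast
    moreover have "d R (X \<inter> g ` B) = d RB Y" unfolding Y(2) using delta_embedding[OF g(6) Y(1)] .
    moreover have "d R (X \<inter> f ` A) = d RB (Y \<inter> A)" unfolding XA using delta_embedding[OF g(6)] Y(1) by blast
    moreover have "d R (X \<inter> N) = d RN (X \<inter> N)" using delta_agree[OF agree_subset[OF g(5)]] by (metis inf_le2)
    ultimately show ?thesis using g(8)[OF X] in_K_delta_nonneg[OF assms(1), of "X \<inter> N"] by simp
  qed
  then have "K N' R" using g(1,2) unfolding in_K_alpha_def by blast
  then show thesis using that g(3,5,6,7) by blast
qed

section \<open>Rooted structures and gluing at a point\<close>

definition rooted :: "'a set \<Rightarrow> ('r \<Rightarrow> 'a set set) \<Rightarrow> 'a \<Rightarrow> bool" where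
  "rooted G R x \<longleftrightarrow> K G R \<and> x \<in> G \<and> (\<forall>X. x \<in> X \<and> X \<subseteq> G \<longrightarrow> d R G \<le> d R X)"

lemma rooted_le_1: "rooted G R x \<Longrightarrow> d R G \<le> 1"
  unfolding rooted_def using delta_singleton[OF in_K_str] by (metis empty_subsetI insert_subset singletonI)

text \<open>Free amalgamation over a one-point structure. All arities are at least 2, so points
  carry no edges and any point can be matched with any other; the subtracted 1 is the rank of the
  shared point.\<close>

lemma glue:
  fixes N :: "nat set"
  assumes "K N RN" "y \<in> N" "rooted G RG x"
  obtains H R where "finite (N \<union> H)" "str (N \<union> H) R" "N \<inter> H = {y}" "agree L N RN R" "card H = card G"
    "d R H = d RG G" "\<And>X. X \<subseteq> H \<Longrightarrow> 0 \<le> d R X" "\<And>X. X \<subseteq> H \<Longrightarrow> y \<in> X \<Longrightarrow> d RG G \<le> d R X"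
    "\<And>X. X \<subseteq> N \<union> H \<Longrightarrow> d R X = d R (X \<inter> N) + d R (X \<inter> H) - (if y \<in> X then 1 else 0)"
proof -
  have G: "K G RG" "x \<in> G" "\<And>X. x \<in> X \<Longrightarrow> X \<subseteq> G \<Longrightarrow> d RG G \<le> d RG X"
    using assms(3) unfolding rooted_def by auto
  have no: "\<not> S \<subseteq> {z}" if "str M R" "E \<in> L" "S \<in> R E" for M R E S and z :: "'z"
  proof
    assume "S \<subseteq> {z}"
    then have "card S \<le> 1" using card_mono[of "{z}" S] by simp
    moreover have "card S = ar E" using that unfolding sym_structure_def by blast
    ultimately show False using ar2[OF that(2)] by linarith
  qed
  have e: "emb {x} RG N RN (\<lambda>_. y)"
    unfolding embedding_def
  proof (intro conjI ballI allI impI)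
    fix E S assume *: "E \<in> L" "S \<subseteq> {x}"
    have "(\<lambda>_. y) ` S \<subseteq> {y}" by blast
    then show "(S \<in> RG E) = ((\<lambda>_. y) ` S \<in> RN E)"
      using no[OF in_K_str[OF G(1)] *(1)] no[OF in_K_str[OF assms(1)] *(1)] *(2) by metis
  qed (use assms(2) in auto)
  have xG: "{x} \<subseteq> G" using G by simp
  obtain N' R g where g: "finite N'" "str N' R" "N' = N \<union> g ` G" "N \<inter> g ` G = (\<lambda>_. y) ` {x}" "agree L N RN R"
    "emb G RG N' R g" "\<And>z. z \<in> {x} \<Longrightarrow> g z = y"
    "\<And>X. X \<subseteq> N' \<Longrightarrow> d R X = d R (X \<inter> N) + d R (X \<inter> g ` G) - d R (X \<inter> (\<lambda>_. y) ` {x})"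
    using free_amalgam[OF in_K_finite[OF assms(1)] in_K_finite[OF G(1)] in_K_str[OF assms(1)] in_K_str[OF G(1)] xG e]
    by blast
  have inj: "inj_on g G" using g(6) unfolding embedding_def by blast
  show thesis
  proof (rule that[of "g ` G" R])
    show "card (g ` G) = card G" using inj by (rule card_image)
    show "d R (g ` G) = d RG G" by (rule delta_embedding[OF g(6)]) simp
  next
    fix X assume "X \<subseteq> g ` G"
    then obtain Y where Y: "Y \<subseteq> G" "X = g ` Y" by (auto elim: subset_imageE)
    have dX: "d R X = d RG Y" unfolding Y by (rule delta_embedding[OF g(6) Y(1)])
    show "0 \<le> d R X" unfolding dX using in_K_delta_nonneg[OF G(1) Y(1)] .
    assume "y \<in> X"
    then have "x \<in> Y" using Y g(7) inj G(2) unfolding inj_on_def by auto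
    then show "d RG G \<le> d R X" unfolding dX using G(3) Y by blast
  next
    fix X assume X: "X \<subseteq> N \<union> g ` G"
    have "d R (X \<inter> {y}) = (if y \<in> X then 1 else 0)"
      using delta_singleton[OF g(2)] delta_empty[OF g(2)] by (auto simp: Int_insert_right)
    then show "d R X = d R (X \<inter> N) + d R (X \<inter> g ` G) - (if y \<in> X then 1 else 0)"
      using g(8)[of X] X g(3) by simp
  qed (use g in auto)
qed

subsection \<open>Rooted structures with prescribed numbers of edges\<close>

lemma NE_add_edge:
  assumes "S \<notin> R E" "finite X"
  shows "NE (R(E := insert S (R E))) F X = NE R F X + (if F = E \<and> S \<subseteq> X then 1 else 0)"
proof (cases "F = E \<and> S \<subseteq> X")
  case True
  then have "{T \<in> (R(E := insert S (R E))) F. T \<subseteq> X} = insert S {T \<in> R E. T \<subseteq> X}" by auto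
  then show ?thesis unfolding NE_def using True assms by (simp add: finite_edges_subset)
next
  case False
  then have "{T \<in> (R(E := insert S (R E))) F. T \<subseteq> X} = {T \<in> R F. T \<subseteq> X}" by auto
  then show ?thesis unfolding NE_def using False by simp
qed

lemma delta_add_edge:
  assumes "E \<in> L" "S \<notin> R E" "finite X"
  shows "d (R(E := insert S (R E))) X = d R X - (if S \<subseteq> X then \<alpha> E else 0)"
proof -
  have "(\<Sum>F\<in>L. \<alpha> F * real (NE (R(E := insert S (R E))) F X))
      = (\<Sum>F\<in>L. \<alpha> F * real (NE R F X) + (if F = E then (if S \<subseteq> X then \<alpha> E else 0) else 0))"
    unfolding NE_add_edge[where R=R, OF assms(2,3)] by (intro sum.cong) (auto simp: algebra_simps)
  also have "\<dots> = (\<Sum>F\<in>L. \<alpha> F * real (NE R F X)) + (if S \<subseteq> X then \<alpha> E else 0)"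
    unfolding sum.distrib using finite_L assms(1) by simp
  finally show ?thesis unfolding delta_def by linarith
qed

lemma str_add_edge:
  "str G R \<Longrightarrow> S \<subseteq> G \<Longrightarrow> card S = ar E \<Longrightarrow> str G (R(E := insert S (R E)))"
  unfolding sym_structure_def by auto

text \<open>Every set containing the new edge contains the root, so its rank was at least
  \<open>d R G\<close>, hence at least \<open>\<alpha> E\<close>, and stays nonnegative. The whole
  of \<open>G\<close> loses \<open>\<alpha> E\<close> and no subset loses more, so minimality at the
  root survives.\<close>

lemma rooted_add_edge:
  assumes "rooted G R x" "E \<in> L" "S \<subseteq> G" "x \<in> S" "card S = ar E" "S \<notin> R E" "\<alpha> E \<le> d R G"
  shows "rooted G (R(E := insert S (R E))) x"
    and "d (R(E := insert S (R E))) G = d R G - \<alpha> E"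
proof -
  let ?R = "R(E := insert S (R E))"
  have G: "K G R" "x \<in> G" "\<And>X. x \<in> X \<Longrightarrow> X \<subseteq> G \<Longrightarrow> d R G \<le> d R X"
    using assms(1) unfolding rooted_def by auto
  have fin: "finite X" if "X \<subseteq> G" for X using that in_K_finite[OF G(1)] by (rule finite_subset)
  have dX: "d ?R X = d R X - (if S \<subseteq> X then \<alpha> E else 0)" if "X \<subseteq> G" for X
    by (rule delta_add_edge[where R=R, OF assms(2,6) fin[OF that]])
  show dG: "d ?R G = d R G - \<alpha> E" using dX[of G] assms(3) by simp
  have "0 \<le> d ?R X" if X: "X \<subseteq> G" for X
  proof (cases "S \<subseteq> X")
    case True
    then show ?thesis using G(3)[of X] X assms(4,7) dX[OF X] by auto
  qed (use dX[OF X] in_K_delta_nonneg[OF G(1) X] in simp)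
  then have "K G ?R" unfolding in_K_alpha_def
    using in_K_finite[OF G(1)] str_add_edge[OF in_K_str[OF G(1)] assms(3,5)] by blast
  moreover have "d ?R G \<le> d ?R X" if "x \<in> X" "X \<subseteq> G" for X
    using dX[OF that(2)] G(3)[OF that] dG \<alpha>_pos[OF assms(2)] by auto
  ultimately show "rooted G ?R x" unfolding rooted_def using G(2) by blast
qed

definition deg :: "('r \<Rightarrow> 'a set set) \<Rightarrow> 'a \<Rightarrow> 'r \<Rightarrow> nat" where
  "deg R x E = card {S \<in> R E. x \<in> S}"

lemma finite_edges: "K G R \<Longrightarrow> E \<in> L \<Longrightarrow> finite (R E)"
  by (rule finite_subset[of _ "Pow G"]) (auto simp: in_K_alpha_def sym_structure_def)

text \<open>The move for a rank too small to pay for an edge at the old root. Sets with the new root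
  \<open>y\<close> but without the whole edge gain a full point and have rank at least 1, and
  \<open>d R G \<le> \<alpha> E\<close> says exactly that the new total is at most 1.\<close>

lemma rooted_new_root:
  fixes G :: "nat set"
  assumes "rooted G R x" "E \<in> L" "ar E \<le> card G + 1" "d R G \<le> \<alpha> E"
  obtains y R' where "y \<notin> G" "rooted (insert y G) R' y" "d R' (insert y G) = d R G + 1 - \<alpha> E"
    "\<And>F. F \<in> L \<Longrightarrow> NE R' F (insert y G) = NE R F G + (if F = E then 1 else 0)"
    "\<And>F. F \<in> L \<Longrightarrow> deg R' y F = (if F = E then 1 else 0)"
proof -
  have G: "K G R" "x \<in> G" "\<And>X. x \<in> X \<Longrightarrow> X \<subseteq> G \<Longrightarrow> d R G \<le> d R X"
    using assms(1) unfolding rooted_def by auto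
  have finG: "finite G" using in_K_finite[OF G(1)] .
  have sG: "T \<subseteq> G" if "F \<in> L" "T \<in> R F" for F T
    using in_K_str[OF G(1)] that unfolding sym_structure_def by blast
  obtain y where y: "y \<notin> G" using finG ex_new_if_finite infinite_UNIV_nat by blast
  have "ar E - 2 \<le> card (G - {x})" using assms(3) G(2) finG by simp
  then obtain Q where Q: "Q \<subseteq> G - {x}" "card Q = ar E - 2" by (meson obtain_subset_with_card_n)
  define S where "S = insert y (insert x Q)"
  have finQ: "finite Q" using Q(1) finG by (meson finite_Diff finite_subset)
  have cS: "card S = ar E"
    using Q finQ y G(2) ar2[OF assms(2)] unfolding S_def by (subst card_insert_disjoint; auto)+
  define R' where "R' = R(E := insert S (R E))"
  let ?G = "insert y G"
  have SR: "S \<notin> R E" using sG[OF assms(2)] y unfolding S_def by blast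
  have SG: "S \<subseteq> ?G" using Q G(2) unfolding S_def by blast
  have ne: "NE R F X = NE R F (X - {y})" if "F \<in> L" for F X
    unfolding NE_def using sG[OF that] y by (intro arg_cong[where f=card]) blast
  have dR: "d R X = d R (X - {y}) + (if y \<in> X then 1 else 0)" if X: "X \<subseteq> ?G" for X
  proof -
    have fX: "finite X" using X finG by (meson finite.insertI finite_subset)
    have "real (card X) = real (card (X - {y})) + (if y \<in> X then 1 else 0)"
    proof (cases "y \<in> X")
      case True
      show ?thesis unfolding card.remove[OF fX True] using True by simp
    qed simp
    moreover have "(\<Sum>F\<in>L. \<alpha> F * real (NE R F X)) = (\<Sum>F\<in>L. \<alpha> F * real (NE R F (X - {y})))"
      by (intro sum.cong refl) (simp add: ne[of _ X])
    ultimately show ?thesis unfolding delta_def by simp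
  qed
  have dX: "d R' X = d R (X - {y}) + (if y \<in> X then 1 else 0) - (if S \<subseteq> X then \<alpha> E else 0)" if X: "X \<subseteq> ?G" for X
  proof -
    have "finite X" using X finG by (meson finite.insertI finite_subset)
    then show ?thesis using delta_add_edge[where R=R, OF assms(2) SR] dR[OF X] unfolding R'_def by simp
  qed
  have nn: "0 \<le> d R (X - {y})" if "X \<subseteq> ?G" for X
    by (rule in_K_delta_nonneg[OF G(1)]) (use that in blast)
  have pos: "0 \<le> d R' X" if X: "X \<subseteq> ?G" for X
    using dX[OF X] nn[OF X] \<alpha>_le[OF assms(2)] unfolding S_def by (auto split: if_splits)
  have strR': "str ?G R'"
    unfolding R'_def using sym_structure_subset[OF in_K_str[OF G(1)]] SG cS by (intro str_add_edge) auto
  have KG: "K ?G R'" unfolding in_K_alpha_def using finG strR' pos by blast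
  have dG: "d R' ?G = d R G + 1 - \<alpha> E" using dX[of ?G] SG y by simp
  have "d R' ?G \<le> d R' X" if X: "y \<in> X" "X \<subseteq> ?G" for X
  proof (cases "S \<subseteq> X")
    case True
    have "x \<in> X - {y}" using True y G(2) unfolding S_def by blast
    moreover have "X - {y} \<subseteq> G" using X by blast
    ultimately have "d R G \<le> d R (X - {y})" by (rule G(3))
    then show ?thesis using dX[OF X(2)] X(1) True dG by simp
  next
    case False
    then show ?thesis using dX[OF X(2)] X(1) dG nn[OF X(2)] assms(4) by simp
  qed
  then have "rooted ?G R' y" unfolding rooted_def using KG by blast
  moreover have "NE R' F ?G = NE R F G + (if F = E then 1 else 0)" if "F \<in> L" for F
  proof -
    have "NE R F ?G = NE R F G" using ne[OF that, of ?G] y by simp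
    then show ?thesis unfolding R'_def using NE_add_edge[where R=R, OF SR, of ?G F] SG finG by simp
  qed
  moreover have "deg R' y F = (if F = E then 1 else 0)" if "F \<in> L" for F
  proof -
    have "{T \<in> R' F. y \<in> T} = (if F = E then {S} else {})"
      using sG[OF that] y unfolding R'_def S_def by auto
    then show ?thesis unfolding deg_def by simp
  qed
  ultimately show thesis using that[of y R'] y dG by blast
qed

text \<open>The roots are identified, which lowers the rank by the deficit of \<open>G\<close>.
  Iterating this brings a rank down in steps of fixed size.\<close>

lemma rooted_glue:
  fixes N :: "nat set"
  assumes "rooted N RN y" "rooted G RG x" "1 \<le> d RN N + d RG G"
  obtains N' R where "rooted N' R y" "card N \<le> card N'" "d R N' = d RN N + d RG G - 1"
proof -
  have N: "K N RN" "y \<in> N" "\<And>X. y \<in> X \<Longrightarrow> X \<subseteq> N \<Longrightarrow> d RN N \<le> d RN X"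
    using assms(1) unfolding rooted_def by auto
  obtain H R where H: "finite (N \<union> H)" "str (N \<union> H) R" "N \<inter> H = {y}" "agree L N RN R" "card H = card G"
    "d R H = d RG G" "\<And>X. X \<subseteq> H \<Longrightarrow> 0 \<le> d R X" "\<And>X. X \<subseteq> H \<Longrightarrow> y \<in> X \<Longrightarrow> d RG G \<le> d R X"
    "\<And>X. X \<subseteq> N \<union> H \<Longrightarrow> d R X = d R (X \<inter> N) + d R (X \<inter> H) - (if y \<in> X then 1 else 0)"
    using glue[OF N(1,2) assms(2)] by blast
  have dN: "d R X = d RN X" if "X \<subseteq> N" for X
    using delta_agree[OF agree_subset[OF H(4) that]] by simp
  have ge: "d RN N + d RG G - 1 \<le> d R X" if X: "X \<subseteq> N \<union> H" "y \<in> X" for X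
  proof -
    have "y \<in> X \<inter> N" "X \<inter> N \<subseteq> N" "y \<in> X \<inter> H" "X \<inter> H \<subseteq> H" using X(2) H(3) by blast+
    then show ?thesis using H(9)[OF X(1)] N(3)[of "X \<inter> N"] H(8)[of "X \<inter> H"] dN[of "X \<inter> N"] X(2) by simp
  qed
  have nn: "0 \<le> d R X" if X: "X \<subseteq> N \<union> H" for X
  proof (cases "y \<in> X")
    case True
    then show ?thesis using ge[OF X] assms(3) by simp
  next
    case False
    then show ?thesis using H(9)[OF X] H(7)[of "X \<inter> H"] dN[of "X \<inter> N"]
        in_K_delta_nonneg[OF N(1), of "X \<inter> N"] by simp
  qed
  have "K (N \<union> H) R" unfolding in_K_alpha_def using H(1,2) nn by blast
  moreover have dd: "d R (N \<union> H) = d RN N + d RG G - 1"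
  proof -
    have "(N \<union> H) \<inter> N = N" "(N \<union> H) \<inter> H = H" by blast+
    then show ?thesis using H(9)[of "N \<union> H"] N(2) H(6) dN[of N] by simp
  qed
  ultimately have "rooted (N \<union> H) R y" unfolding rooted_def using ge N(2) by simp
  moreover have "card N \<le> card (N \<union> H)" using H(1) by (intro card_mono) auto
  ultimately show thesis using that dd by blast
qed

text \<open>Adding the edges of a complete hypergraph one at a time, stop when the rank of some
  nonempty set first drops below 1.\<close>
lemma rooted_start:
  assumes "E \<in> L"
  obtains G :: "nat set" and R x where "rooted G R x" "d R G < 1" "1 - \<alpha> E \<le> d R G" "ar E \<le> card G"
proof -
  let ?r = "ar E"
  \<comment> \<open>Chosen so that the complete hypergraph has rank at most 0: there are at least
    (n/r)^r = t^r, hence at least t^2, edges, and \<open>\<alpha> E * t\<close> is at least r, so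
    the edges weigh at least r t = n.\<close>
  define t where "t = nat \<lceil>real ?r / \<alpha> E\<rceil>"
  define n where "n = ?r * t"
  have r: "2 \<le> ?r" and a: "0 < \<alpha> E" "\<alpha> E \<le> 1" using ar2 \<alpha>_pos \<alpha>_le assms by auto
  have tr: "real ?r / \<alpha> E \<le> real t" unfolding t_def by linarith
  have "0 < real ?r / \<alpha> E" using r a by simp
  then have t1: "1 \<le> t" using tr by linarith
  define P where "P = {S. S \<subseteq> {..<n} \<and> card S = ?r}"
  define RR where "RR F = (\<lambda>E'. if E' = E then F else {} :: nat set set)" for F
  define bad where "bad F \<longleftrightarrow> (\<exists>X. X \<noteq> {} \<and> X \<subseteq> {..<n} \<and> d (RR F) X < 1)" for F
  have finP: "finite P" unfolding P_def by simp
  have dRR: "d (RR F) X = real (card X) - \<alpha> E * real (card {S \<in> F. S \<subseteq> X})" for F X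
  proof -
    have "(\<Sum>E'\<in>L. \<alpha> E' * real (NE (RR F) E' X)) = (\<Sum>E'\<in>L. if E' = E then \<alpha> E * real (card {S \<in> F. S \<subseteq> X}) else 0)"
      by (rule sum.cong) (auto simp: RR_def NE_def)
    then show ?thesis unfolding delta_def using assms finite_L by simp
  qed
  have "\<not> bad {}"
  proof
    assume "bad {}"
    then obtain X where X: "X \<noteq> {}" "X \<subseteq> {..<n}" "real (card X) < 1" unfolding bad_def dRR by auto
    then have "finite X" by (meson finite_lessThan finite_subset)
    then show False using X by (simp add: card_eq_0_iff)
  qed
  moreover have "bad P"
  proof -
    have "?r \<le> n" unfolding n_def using t1 by simp
    then have "(real n / real ?r) ^ ?r \<le> real (n choose ?r)" by (rule binomial_ge_n_over_k_pow_k)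
    moreover have "real n / real ?r = real t" unfolding n_def using r by simp
    moreover have "real t ^ 2 \<le> real t ^ ?r" using t1 r by (intro power_increasing) auto
    ultimately have "real t ^ 2 \<le> real (n choose ?r)" by (metis order_trans)
    then have "\<alpha> E * real t ^ 2 \<le> \<alpha> E * real (n choose ?r)" using a by simp
    moreover have "real n \<le> \<alpha> E * real t ^ 2"
    proof -
      have "real ?r \<le> \<alpha> E * real t" using tr a by (simp add: field_simps)
      then have "real ?r * real t \<le> (\<alpha> E * real t) * real t" by (rule mult_right_mono) simp
      then show ?thesis unfolding n_def power2_eq_square by (simp add: mult.assoc)
    qed
    moreover have "{S \<in> P. S \<subseteq> {..<n}} = P" unfolding P_def by auto
    moreover have "card P = n choose ?r" unfolding P_def by (simp add: n_subsets)
    ultimately have "d (RR P) {..<n} < 1" unfolding dRR by simp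
    moreover have "{..<n} \<noteq> {}" using t1 r unfolding n_def by (auto simp: lessThan_empty_iff)
    ultimately show ?thesis unfolding bad_def by (intro exI[of _ "{..<n}"] conjI order_refl)
  qed
  ultimately obtain F S where FS: "insert S F \<subseteq> P" "S \<notin> F" "\<not> bad F" "bad (insert S F)"
    using finite_crossing[OF finP] by blast
  let ?A = "{X. X \<noteq> {} \<and> X \<subseteq> {..<n}}" and ?R = "RR (insert S F)"
  have "finite ?A" by (rule finite_subset[of _ "Pow {..<n}"]) auto
  moreover have "?A \<noteq> {}" using FS(4) unfolding bad_def by blast
  \<comment> \<open>\<open>X\<close> minimises the rank over all nonempty sets, so each of its
    points can serve as a root.\<close>
  ultimately obtain X where X: "X \<in> ?A" "\<And>Y. Y \<in> ?A \<Longrightarrow> d ?R X \<le> d ?R Y"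
    using finite_min_ex[of ?A "d ?R"] by blast
  have finX: "finite X" using X(1) by (auto intro: finite_subset)
  obtain Y where Y: "Y \<in> ?A" "d ?R Y < 1" using FS(4) unfolding bad_def by blast
  have X1: "d ?R X < 1" using X(2)[OF Y(1)] Y(2) by linarith
  have eq: "?R = (RR F)(E := insert S (RR F E))" unfolding RR_def by (rule ext) simp
  have SF: "S \<notin> RR F E" using FS(2) unfolding RR_def by simp
  have dX: "d ?R X = d (RR F) X - (if S \<subseteq> X then \<alpha> E else 0)"
    unfolding eq by (rule delta_add_edge[where R="RR F", OF assms SF finX])
  have FX: "1 \<le> d (RR F) X" using X(1) FS(3) unfolding bad_def by (metis (mono_tags, lifting) mem_Collect_eq not_le)
  then have SX: "S \<subseteq> X" using dX X1 by (auto split: if_splits)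
  have cS: "card S = ?r" using FS(1) unfolding P_def by simp
  then obtain x where x: "x \<in> S" using r by fastforce
  have strR: "str {..<n} ?R" using FS(1) unfolding sym_structure_def RR_def P_def by auto
  let ?R' = "push id X ?R"
  have dd: "d ?R' Y = d ?R Y" if "Y \<subseteq> X" for Y
    using delta_agree[OF agree_subset[OF agree_push_id that]] by metis
  have ge: "d ?R X \<le> d ?R Y" if "Y \<subseteq> X" "Y \<noteq> {}" for Y using X that by blast
  \<comment> \<open>Before the last edge \<open>X\<close> had rank at least 1, and one edge costs
    \<open>\<alpha> E\<close>.\<close>
  have low: "1 - \<alpha> E \<le> d ?R X" using dX FX SX by simp
  have "0 \<le> d ?R Y" if "Y \<subseteq> X" for Y
    using ge[OF that] low a delta_empty[OF strR] by (cases "Y = {}") simp_all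
  then have "K X ?R'" using in_K_push[OF strR finX inj_on_id] by simp
  moreover have "d ?R' X \<le> d ?R' Y" if "x \<in> Y" "Y \<subseteq> X" for Y
    using ge[OF that(2)] that(1) dd[OF that(2)] dd[of X] by auto
  ultimately have "rooted X ?R' x" unfolding rooted_def using x SX by blast
  moreover have "?r \<le> card X" using card_mono[OF finX SX] cS by simp
  ultimately show thesis using that[of X ?R' x] X1 low dd[of X] by simp
qed

text \<open>Each gluing of \<open>G0\<close> at the root subtracts the fixed deficit of
  \<open>G0\<close>. As long as the rank exceeds \<open>\<alpha> E\<close>, the bound
  \<open>1 - \<alpha> E \<le> d R0 G0\<close> guarantees that another gluing is affordable.\<close>

lemma rooted_reduce:
  assumes E: "E \<in> L" and G0: "rooted G0 R0 x0" "d R0 G0 < 1" "1 - \<alpha> E \<le> d R0 G0"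
  shows "rooted (G :: nat set) R x \<Longrightarrow> d R G \<le> \<alpha> E + real k * (1 - d R0 G0) \<Longrightarrow>
    \<exists>(G' :: nat set) R' x'. rooted G' R' x' \<and> card G \<le> card G' \<and> d R' G' \<le> \<alpha> E"
proof (induction k arbitrary: G R x)
  case 0
  then show ?case by auto
next
  case (Suc k)
  show ?case
  proof (cases "d R G \<le> \<alpha> E")
    case True
    with Suc.prems show ?thesis by blast
  next
    case False
    then have "1 \<le> d R G + d R0 G0" using G0(3) by linarith
    then obtain N R' where N: "rooted N R' x" "card G \<le> card N" "d R' N = d R G + d R0 G0 - 1"
      using rooted_glue[OF Suc.prems(1) G0(1)] by blast
    have "d R' N \<le> \<alpha> E + real k * (1 - d R0 G0)" using Suc.prems(2) N(3) by (simp add: algebra_simps)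
    then show ?thesis using Suc.IH[OF N(1)] N(2) by (meson order_trans)
  qed
qed

text \<open>The bound on the degrees leaves room for a further edge at the root once n is large.\<close>
definition good :: "nat \<Rightarrow> 'a set \<Rightarrow> ('r \<Rightarrow> 'a set set) \<Rightarrow> 'a \<Rightarrow> bool" where
  "good n G R x \<longleftrightarrow> rooted G R x \<and> n \<le> card G \<and> d R G + (\<Sum>E\<in>L. \<alpha> E * real (deg R x E)) \<le> 2"

text \<open>Origin of the 2 in \<open>good\<close>: at a fresh root the weighted degree is
  \<open>\<alpha> E\<close>, which cancels against the new rank and leaves \<open>d R G + 1\<close>.
  An edge added later at the root leaves the sum of rank and weighted degree unchanged.\<close>

lemma rooted_new_root_good:
  fixes G :: "nat set"
  assumes "rooted G R x" "E \<in> L" "ar E \<le> card G + 1" "d R G \<le> \<alpha> E" "n \<le> card G + 1"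
  obtains G' :: "nat set" and R' y where "good n G' R' y" "card G' = card G + 1" "d R' G' = d R G + 1 - \<alpha> E"
    "\<And>F. F \<in> L \<Longrightarrow> NE R' F G' = NE R F G + (if F = E then 1 else 0)"
proof -
  obtain y R' where y: "y \<notin> G" "rooted (insert y G) R' y" "d R' (insert y G) = d R G + 1 - \<alpha> E"
    "\<And>F. F \<in> L \<Longrightarrow> NE R' F (insert y G) = NE R F G + (if F = E then 1 else 0)"
    "\<And>F. F \<in> L \<Longrightarrow> deg R' y F = (if F = E then 1 else 0)"
    using rooted_new_root[OF assms(1-4)] by metis
  have "finite G" using assms(1) in_K_finite unfolding rooted_def by blast
  then have c: "card (insert y G) = card G + 1" using y(1) by simp
  have "(\<Sum>F\<in>L. \<alpha> F * real (deg R' y F)) = (\<Sum>F\<in>L. if F = E then \<alpha> E else 0)"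
    using y(5) by (intro sum.cong) auto
  also have "\<dots> = \<alpha> E" using finite_L assms(2) by simp
  finally have "good n (insert y G) R' y"
    unfolding good_def using y(2,3) c assms(5) rooted_le_1[OF assms(1)] by simp
  then show thesis using that c y(3,4) by blast
qed

text \<open>Gluings push the rank down to \<open>\<alpha> E\<close>, then a new root is attached.
  Each such round adds at least one point and restores the degree bound, so the size is
  unbounded.\<close>

lemma good_ex:
  obtains G :: "nat set" and R x where "good n G R x"
proof -
  obtain E where E: "E \<in> L" using L_ne by blast
  obtain G0 :: "nat set" and R0 x0 where G0: "rooted G0 R0 x0" "d R0 G0 < 1" "1 - \<alpha> E \<le> d R0 G0" "ar E \<le> card G0"
    using rooted_start[OF E] by metis
  have step: "\<exists>(G' :: nat set) R' x'. good (card G + 1) G' R' x'" if G: "rooted G R x" "ar E \<le> card G"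
    for G :: "nat set" and R x
  proof -
    obtain k :: nat where "(d R G - \<alpha> E) / (1 - d R0 G0) \<le> real k" using real_arch_simple by blast
    then have "d R G \<le> \<alpha> E + real k * (1 - d R0 G0)" using G0(2) by (simp add: field_simps)
    then obtain G' :: "nat set" and R' x' where G': "rooted G' R' x'" "card G \<le> card G'" "d R' G' \<le> \<alpha> E"
      using rooted_reduce[OF E G0(1-3) G(1)] by metis
    then show ?thesis using rooted_new_root_good[OF G'(1) E _ G'(3), of "card G + 1"] G(2)
      by (metis add_le_mono1 le_add1 order_trans)
  qed
  have "\<exists>(G :: nat set) R x. good n G R x \<and> ar E \<le> card G"
  proof (induction n)
    case 0
    then show ?case using step[OF G0(1,4)] G0(4) unfolding good_def by (meson le0 le_add1 order_trans)
  next
    case (Suc n)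
    then obtain G :: "nat set" and R x where G: "good n G R x" "ar E \<le> card G" by blast
    then obtain G' :: "nat set" and R' x' where "good (card G + 1) G' R' x'" using step unfolding good_def by blast
    then show ?case using G unfolding good_def by (intro exI[of _ G'] exI[of _ R'] exI[of _ x']) auto
  qed
  then show thesis using that by blast
qed

text \<open>Since the rank stays in [0, 1), one more E-edge amounts to subtracting \<alpha> E modulo 1.\<close>
lemma good_step:
  fixes G :: "nat set"
  assumes "good n G R x" "E \<in> L" "real (ar E) + 2 / \<alpha> E + 1 \<le> real n"
  obtains G' :: "nat set" and R' y where "good n G' R' y" "d R' G' < 1"
    "\<And>F. F \<in> L \<Longrightarrow> NE R' F G' = NE R F G + (if F = E then 1 else 0)"
proof -
  have G: "rooted G R x" "n \<le> card G" "d R G + (\<Sum>E\<in>L. \<alpha> E * real (deg R x E)) \<le> 2"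
    using assms(1) unfolding good_def by auto
  have KG: "K G R" "x \<in> G" using G(1) unfolding rooted_def by auto
  have finG: "finite G" using in_K_finite[OF KG(1)] .
  have a: "0 < \<alpha> E" using \<alpha>_pos assms(2) .
  have nar: "real (ar E) + 2 / \<alpha> E + 1 \<le> real (card G)" using assms(3) G(2) by linarith
  moreover have "0 < 2 / \<alpha> E" using a by simp
  ultimately have arG: "ar E \<le> card G" by linarith
  show thesis
  proof (cases "d R G < \<alpha> E")
    case True
    show thesis
      by (rule rooted_new_root_good[OF G(1) assms(2), of n]) (use True arG G(2) that in auto)
  next
    case False
    have nn: "0 \<le> \<alpha> F * real (deg R x F)" if "F \<in> L" for F using \<alpha>_pos[OF that] by simp
    have "\<alpha> E * real (deg R x E) \<le> (\<Sum>E\<in>L. \<alpha> E * real (deg R x E))"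
      using nn finite_L assms(2) by (intro member_le_sum) auto
    moreover have "0 \<le> d R G" using in_K_delta_nonneg[OF KG(1)] by simp
    ultimately have "\<alpha> E * real (deg R x E) \<le> 2" using G(3) by linarith
    then have dg: "real (deg R x E) \<le> 2 / \<alpha> E" using a by (simp add: field_simps)
    have "ar E - 2 \<le> card (G - {x})" using arG KG(2) finG by simp
    then obtain Q where Q: "Q \<subseteq> G - {x}" "card Q = ar E - 2" by (meson obtain_subset_with_card_n)
    have finQ: "finite Q" using Q(1) finG by (meson finite_Diff finite_subset)
    define W where "W = G - insert x Q"
    have cxQ: "card (insert x Q) = ar E - 1" using Q finQ ar2[OF assms(2)] by (subst card_insert_disjoint) auto
    have cW: "card W = card G - (ar E - 1)"
      unfolding W_def using Q(1) KG(2) finQ cxQ by (subst card_Diff_subset) auto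
    \<comment> \<open>Each of the \<open>card G - (ar E - 1)\<close> points of \<open>W\<close>
      completes \<open>insert x Q\<close> to a different possible edge. At most
      \<open>2 / \<alpha> E\<close> edges are present at the root, so the size of \<open>G\<close>
      leaves one of them free.\<close>
    have "\<exists>z\<in>W. insert z (insert x Q) \<notin> R E"
    proof (rule ccontr)
      assume "\<not> ?thesis"
      then have "(\<lambda>z. insert z (insert x Q)) ` W \<subseteq> {S \<in> R E. x \<in> S}" by auto
      moreover have "inj_on (\<lambda>z. insert z (insert x Q)) W" unfolding W_def inj_on_def by blast
      moreover have "finite {S \<in> R E. x \<in> S}"
        by (rule finite_subset[OF _ finite_edges[OF KG(1) assms(2)]]) blast
      ultimately have "card W \<le> deg R x E" unfolding deg_def by (metis card_inj_on_le)
      then show False using cW dg nar arG by linarith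
    qed
    then obtain z where z: "z \<in> W" "insert z (insert x Q) \<notin> R E" by blast
    define S where "S = insert z (insert x Q)"
    have S: "S \<subseteq> G" "x \<in> S" "S \<notin> R E" using z Q KG(2) unfolding S_def W_def by auto
    have "card S = ar E"
      using z(1) cxQ finQ ar2[OF assms(2)] unfolding S_def W_def by (subst card_insert_disjoint) auto
    note add = rooted_add_edge[OF G(1) assms(2) S(1,2) this S(3)]
    let ?R = "R(E := insert S (R E))"
    have dg': "deg ?R x F = deg R x F + (if F = E then 1 else 0)" if "F \<in> L" for F
    proof (cases "F = E")
      case True
      have "{T \<in> ?R E. x \<in> T} = insert S {T \<in> R E. x \<in> T}" using S(2) by auto
      then show ?thesis unfolding deg_def using True S(3) finite_edges[OF KG(1) assms(2)] by simp
    qed (simp add: deg_def)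
    have "(\<Sum>F\<in>L. \<alpha> F * real (deg ?R x F)) = (\<Sum>F\<in>L. \<alpha> F * real (deg R x F) + (if F = E then \<alpha> E else 0))"
      using dg' by (intro sum.cong) (auto simp: algebra_simps)
    also have "\<dots> = (\<Sum>F\<in>L. \<alpha> F * real (deg R x F)) + \<alpha> E"
      unfolding sum.distrib using finite_L assms(2) by simp
    finally have "good n G ?R x" unfolding good_def using add G False by simp
    moreover have "d ?R G < 1" using add(2) False a rooted_le_1[OF G(1)] by simp
    moreover have "NE ?R F G = NE R F G + (if F = E then 1 else 0)" for F
      using NE_add_edge[where R=R, OF S(3) finG, of F] S(1) by simp
    ultimately show thesis using that[of G ?R x] by blast
  qed
qed

text \<open>\<open>l\<close> is the edge count of one starting structure, large enough for
  \<open>good_step\<close> with every symbol; from there the numbers \<open>c\<close> are reached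
  one edge at a time. The rank need not be tracked: up to an integer the counts determine it, and
  the interval [0, 1) fixes the integer.\<close>

theorem rooted_counts:
  "\<exists>l :: 'r \<Rightarrow> nat. \<forall>c :: 'r \<Rightarrow> nat. \<exists>(G :: nat set) R x.
     rooted G R x \<and> d R G < 1 \<and> (\<forall>E\<in>L. NE R E G = l E + c E)"
proof -
  define n where "n = nat \<lceil>\<Sum>E\<in>L. real (ar E) + 2 / \<alpha> E + 1\<rceil>"
  have n: "real (ar E) + 2 / \<alpha> E + 1 \<le> real n" if "E \<in> L" for E
  proof -
    have "0 \<le> real (ar F) + 2 / \<alpha> F + 1" if "F \<in> L" for F using \<alpha>_pos[OF that] by simp
    then have "real (ar E) + 2 / \<alpha> E + 1 \<le> (\<Sum>E\<in>L. real (ar E) + 2 / \<alpha> E + 1)"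
      using finite_L that by (intro member_le_sum) auto
    then show ?thesis unfolding n_def by linarith
  qed
  obtain E0 where E0: "E0 \<in> L" using L_ne by blast
  obtain G0 :: "nat set" and R0 x0 where "good n G0 R0 x0" by (rule good_ex)
  \<comment> \<open>\<open>good\<close> still allows rank 1; one extra edge makes the rank strictly
    smaller, as needed when \<open>c\<close> vanishes.\<close>
  then obtain G1 :: "nat set" and R1 x1 where G1: "good n G1 R1 x1" "d R1 G1 < 1"
    using good_step[OF _ E0 n[OF E0]] by metis
  define l where "l E = NE R1 E G1" for E
  have "\<exists>(G :: nat set) R x. good n G R x \<and> d R G < 1 \<and> (\<forall>E\<in>L. NE R E G = l E + c E)"
    if "(\<Sum>E\<in>L. c E) = k" for k and c :: "'r \<Rightarrow> nat"
    using that
  proof (induction k arbitrary: c)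
    case 0
    then have "\<forall>E\<in>L. c E = 0" using finite_L by simp
    then show ?case using G1 unfolding l_def by auto
  next
    case (Suc k)
    then obtain E where E: "E \<in> L" "0 < c E" by (metis not_gr_zero sum.neutral nat.simps(3))
    define c' where "c' = c(E := c E - 1)"
    have cc: "c F = c' F + (if F = E then 1 else 0)" for F using E unfolding c'_def by simp
    have "(\<Sum>E\<in>L. c E) = (\<Sum>E\<in>L. c' E) + 1"
      unfolding cc[abs_def] sum.distrib using finite_L E(1) by simp
    then have "(\<Sum>E\<in>L. c' E) = k" using Suc.prems by simp
    then obtain G :: "nat set" and R x where G: "good n G R x" "\<forall>E\<in>L. NE R E G = l E + c' E"
      using Suc.IH by blast
    obtain G' :: "nat set" and R' y where "good n G' R' y" "d R' G' < 1"
      "\<And>F. F \<in> L \<Longrightarrow> NE R' F G' = NE R F G + (if F = E then 1 else 0)"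
      using good_step[OF G(1) E(1) n[OF E(1)]] by metis
    then show ?case using G(2) cc by (intro exI[of _ G'] exI[of _ R'] exI[of _ y]) auto
  qed
  then have "\<exists>(G :: nat set) R x. rooted G R x \<and> d R G < 1 \<and> (\<forall>E\<in>L. NE R E G = l E + c E)" for c
    unfolding good_def by blast
  then show ?thesis by blast
qed

subsection \<open>Completions of rank zero and the generic model\<close>

lemma delta_Un_zero:
  assumes "K B R" "X \<subseteq> B" "Y \<subseteq> B" "d R X = 0" "d R Y = 0"
  shows "d R (X \<union> Y) = 0"
proof -
  have "finite X" "finite Y" using assms(2,3) in_K_finite[OF assms(1)] by (auto intro: finite_subset)
  then have "d R (X \<union> Y) + d R (X \<inter> Y) \<le> d R X + d R Y" by (rule submodular)
  moreover have "0 \<le> d R (X \<inter> Y)" "0 \<le> d R (X \<union> Y)"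
    by (rule in_K_delta_nonneg[OF assms(1)]; use assms(2,3) in blast)+
  ultimately show ?thesis using assms(4,5) by simp
qed

lemma delta_UN_zero:
  assumes "K B R" "finite A" "\<And>y. y \<in> A \<Longrightarrow> Z y \<subseteq> B \<and> d R (Z y) = 0"
  shows "d R (\<Union>y\<in>A. Z y) = 0"
  using assms(2,3)
proof (induction A rule: finite_induct)
  case empty
  then show ?case using delta_empty[OF in_K_str[OF assms(1)]] by simp
next
  case (insert a A)
  have "d R (Z a \<union> (\<Union>y\<in>A. Z y)) = 0"
  proof (rule delta_Un_zero[OF assms(1)])
    show "(\<Union>y\<in>A. Z y) \<subseteq> B" using insert.prems by (simp add: UN_subset_iff)
  qed (use insert in auto)
  then show ?case by simp
qed

lemma int_in_unit_interval: "z \<in> \<int> \<Longrightarrow> 0 < z \<Longrightarrow> z < 2 \<Longrightarrow> z = (1 :: real)"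
  by (elim Ints_cases) simp

text \<open>The edge counts of \<open>G\<close> are chosen to complement those of \<open>Z\<close>
  to a common multiple of \<open>q * m E\<close>. As the \<open>m\<close>-combination of the weights
  is \<open>p / q\<close>, the ranks of \<open>G\<close> and \<open>Z\<close> add up to an integer;
  lying strictly between 0 and 2, it is 1.\<close>

lemma gadget_exact:
  assumes "coherent L \<alpha>" "0 < d R Z" "d R Z \<le> 1"
  obtains G :: "nat set" and RG x where "rooted G RG x" "d RG G = 1 - d R Z"
proof -
  obtain m :: "'r \<Rightarrow> nat" where m: "\<And>E. E \<in> L \<Longrightarrow> 0 < m E" "(\<Sum>E\<in>L. real (m E) * \<alpha> E) \<in> \<rat>"
    using assms(1) unfolding coherent_def by blast
  then obtain p :: int and q :: nat where pq: "q \<noteq> 0" "(\<Sum>E\<in>L. real (m E) * \<alpha> E) = real_of_int p / real q"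
    unfolding Rats_eq_int_div_nat by auto
  obtain l :: "'r \<Rightarrow> nat" where
    l: "\<And>c :: 'r \<Rightarrow> nat. \<exists>(G :: nat set) R x. rooted G R x \<and> d R G < 1 \<and> (\<forall>E\<in>L. NE R E G = l E + c E)"
    using rooted_counts by blast
  let ?k = "\<lambda>E. NE R E Z"
  \<comment> \<open>Makes \<open>t * q * m E\<close> at least \<open>l E\<close> plus the edges of
    \<open>Z\<close> for every symbol, so that the natural subtraction in the request is
    exact.\<close>
  define t where "t = (\<Sum>E\<in>L. l E + ?k E)"
  have t: "l E + ?k E \<le> t * q * m E" if "E \<in> L" for E
  proof -
    have "l E + ?k E \<le> t" unfolding t_def by (rule member_le_sum[OF that _ finite_L]) simp
    also have "t \<le> t * (q * m E)" using pq(1) m(1)[OF that] by simp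
    finally show ?thesis by (simp add: mult.assoc)
  qed
  obtain G :: "nat set" and RG x where G: "rooted G RG x" "d RG G < 1"
    "\<forall>E\<in>L. NE RG E G = l E + (t * q * m E - (l E + ?k E))"
    using l[of "\<lambda>E. t * q * m E - (l E + ?k E)"] by blast
  have "0 \<le> d RG G" using G(1) in_K_delta_nonneg unfolding rooted_def by blast
  have "(\<Sum>E\<in>L. \<alpha> E * real (NE RG E G)) = (\<Sum>E\<in>L. real (t * q) * (real (m E) * \<alpha> E) - \<alpha> E * real (?k E))"
  proof (rule sum.cong[OF refl])
    fix E assume E: "E \<in> L"
    then have "NE RG E G + ?k E = t * q * m E" using G(3) t[OF E] by simp
    then have *: "real (NE RG E G) = real (t * q * m E) - real (?k E)"
      by (metis add_diff_cancel_right' of_nat_add)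
    show "\<alpha> E * real (NE RG E G) = real (t * q) * (real (m E) * \<alpha> E) - \<alpha> E * real (?k E)"
      unfolding * by (simp add: algebra_simps)
  qed
  also have "\<dots> = real (t * q) * (real_of_int p / real q) - (\<Sum>E\<in>L. \<alpha> E * real (?k E))"
    unfolding sum_subtractf sum_distrib_left[symmetric] pq(2) by simp
  also have "real (t * q) * (real_of_int p / real q) = of_int (int t * p)" using pq(1) by simp
  finally have "d RG G + d R Z = of_int (int (card G) + int (card Z) - int t * p)"
    unfolding delta_def by simp
  then have "d RG G + d R Z \<in> \<int>" by (metis Ints_of_int)
  then have "d RG G + d R Z = 1"
    by (rule int_in_unit_interval) (use \<open>0 \<le> d RG G\<close> G(2) assms(2,3) in auto)
  then show thesis using that[OF G(1)] by simp
qed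

text \<open>Let \<open>Z\<close> have least rank among the sets containing \<open>y\<close>. A
  gadget of rank \<open>1 - d R Z\<close> glued at \<open>y\<close> lowers sets through
  \<open>y\<close> by at most \<open>d R Z\<close>, so minimality keeps them nonnegative, while
  \<open>Z\<close> with the whole gadget reaches exactly 0.\<close>

lemma zero_attach:
  fixes A :: "nat set"
  assumes "coherent L \<alpha>" "K A R" "y \<in> A"
  obtains B R' Z where "K B R'" "A \<subseteq> B" "agree L A R R'" "Z \<subseteq> B" "y \<in> Z" "d R' Z = 0"
proof -
  let ?A = "{X. y \<in> X \<and> X \<subseteq> A}"
  have "finite ?A" using in_K_finite[OF assms(2)] by (intro finite_subset[of ?A "Pow A"]) auto
  moreover have "?A \<noteq> {}" using assms(3) by blast
  ultimately obtain Z where Z: "y \<in> Z" "Z \<subseteq> A" "\<And>X. y \<in> X \<Longrightarrow> X \<subseteq> A \<Longrightarrow> d R Z \<le> d R X"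
    using finite_min_ex[of ?A "d R"] by auto
  have Z0: "0 \<le> d R Z" using in_K_delta_nonneg[OF assms(2) Z(2)] .
  have Z1: "d R Z \<le> 1" using Z(3)[of "{y}"] assms(3) delta_singleton[OF in_K_str[OF assms(2)]] by simp
  show thesis
  proof (cases "d R Z = 0")
    case True
    show ?thesis by (rule that[of A R Z]) (use assms Z True in auto)
  next
    case False
    then obtain G :: "nat set" and RG x where G: "rooted G RG x" "d RG G = 1 - d R Z"
      using gadget_exact[OF assms(1), of R Z] Z0 Z1 by (metis less_eq_real_def)
    obtain H R' where H: "finite (A \<union> H)" "str (A \<union> H) R'" "A \<inter> H = {y}" "agree L A R R'" "card H = card G"
      "d R' H = d RG G" "\<And>X. X \<subseteq> H \<Longrightarrow> 0 \<le> d R' X" "\<And>X. X \<subseteq> H \<Longrightarrow> y \<in> X \<Longrightarrow> d RG G \<le> d R' X"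
      "\<And>X. X \<subseteq> A \<union> H \<Longrightarrow> d R' X = d R' (X \<inter> A) + d R' (X \<inter> H) - (if y \<in> X then 1 else 0)"
      using glue[OF assms(2,3) G(1)] by blast
    have dA: "d R' X = d R X" if "X \<subseteq> A" for X
      using delta_agree[OF agree_subset[OF H(4) that]] by simp
    have yH: "y \<in> H" using H(3) by blast
    have "0 \<le> d R' X" if X: "X \<subseteq> A \<union> H" for X
    proof (cases "y \<in> X")
      case True
      have "d R Z \<le> d R' (X \<inter> A)" unfolding dA[of "X \<inter> A", OF inf_le2]
        by (rule Z(3)) (use True assms(3) in auto)
      moreover have "1 - d R Z \<le> d R' (X \<inter> H)" using H(8)[of "X \<inter> H"] True yH G(2) by simp
      ultimately show ?thesis using H(9)[OF X] True by simp
    next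
      case False
      have "0 \<le> d R' (X \<inter> A)" unfolding dA[of "X \<inter> A", OF inf_le2]
        by (rule in_K_delta_nonneg[OF assms(2)]) simp
      then show ?thesis using H(9)[OF X] H(7)[of "X \<inter> H"] False by simp
    qed
    then have "K (A \<union> H) R'" unfolding in_K_alpha_def using H(1,2) by blast
    moreover have "d R' (Z \<union> H) = 0"
    proof -
      have "(Z \<union> H) \<inter> A = Z" using Z(1,2) H(3) by auto
      moreover have "(Z \<union> H) \<inter> H = H" by blast
      moreover have "Z \<union> H \<subseteq> A \<union> H" using Z(2) by blast
      ultimately show ?thesis using H(9)[of "Z \<union> H"] Z(1) dA[OF Z(2)] H(6) G(2) by simp
    qed
    ultimately show ?thesis using that[of "A \<union> H" R' "Z \<union> H"] H(4) Z(1,2) by blast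
  qed
qed

text \<open>The points of \<open>A\<close> are treated in turn; sets of rank 0 found earlier
  persist, and a union of rank 0 sets has rank 0 by submodularity. The structure is finally cut down
  to that union, since gadget points outside it may lie in no set of rank 0.\<close>

lemma zero_completion:
  fixes A :: "nat set"
  assumes "coherent L \<alpha>" "K A R"
  obtains C R' where "K C R'" "A \<subseteq> C" "agree L A R R'" "d R' C = 0"
proof -
  have "\<exists>B R'. K B R' \<and> A \<subseteq> B \<and> agree L A R R' \<and> (\<forall>y\<in>F. \<exists>Z\<subseteq>B. y \<in> Z \<and> d R' Z = 0)"
    if "finite F" "F \<subseteq> A" for F
    using that
  proof (induction F rule: finite_induct)
    case empty
    show ?case by (intro exI[of _ A] exI[of _ R]) (simp add: assms(2))
  next
    case (insert y F)
    then obtain B R1 where B: "K B R1" "A \<subseteq> B" "agree L A R R1" "\<forall>y\<in>F. \<exists>Z\<subseteq>B. y \<in> Z \<and> d R1 Z = 0"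
      by auto
    have "y \<in> B" using insert.prems B(2) by blast
    obtain B' R' Z where B': "K B' R'" "B \<subseteq> B'" "agree L B R1 R'" "Z \<subseteq> B'" "y \<in> Z" "d R' Z = 0"
      by (rule zero_attach[OF assms(1) B(1) \<open>y \<in> B\<close>])
    have "\<exists>Z\<subseteq>B'. z \<in> Z \<and> d R' Z = 0" if z: "z \<in> insert y F" for z
    proof (cases "z = y")
      case False
      then obtain Z where "Z \<subseteq> B" "z \<in> Z" "d R1 Z = 0" using z B(4) by blast
      then show ?thesis using delta_agree[OF agree_subset[OF B'(3)]] B'(2) by (metis order_trans)
    qed (use B' in blast)
    then show ?case using B'(1,2) B(2) agree_trans[OF B(3) agree_subset[OF B'(3) B(2)]] by (meson order_trans)
  qed
  from this[OF in_K_finite[OF assms(2)] order_refl]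
  obtain B R1 where B: "K B R1" "A \<subseteq> B" "agree L A R R1" "\<forall>y\<in>A. \<exists>Z\<subseteq>B. y \<in> Z \<and> d R1 Z = 0" by blast
  then obtain Z where Z: "\<And>y. y \<in> A \<Longrightarrow> Z y \<subseteq> B \<and> y \<in> Z y \<and> d R1 (Z y) = 0" by metis
  define C where "C = (\<Union>y\<in>A. Z y)"
  have C: "C \<subseteq> B" "A \<subseteq> C" using Z unfolding C_def by blast+
  have "d R1 C = 0" unfolding C_def
    by (rule delta_UN_zero[OF B(1) in_K_finite[OF assms(2)]]) (use Z in blast)
  moreover have "d R1 C = d (push id C R1) C" by (rule delta_agree[OF agree_push_id])
  moreover have "agree L A R (push id C R1)"
    by (rule agree_trans[OF B(3) agree_subset[OF agree_push_id C(2)]])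
  ultimately show thesis using that[of C "push id C R1"] in_K_subset[OF B(1) C(1)] C(2) by simp
qed

section \<open>Gadgets of rank just below 1\<close>

lemma incoherent_irrational:
  assumes "\<not> coherent L \<alpha>" obtains E where "E \<in> L" "\<alpha> E \<notin> \<rat>"
proof -
  have "\<exists>E\<in>L. \<alpha> E \<notin> \<rat>"
  proof (rule ccontr)
    assume "\<not> ?thesis"
    then have "(\<Sum>E\<in>L. real 1 * \<alpha> E) \<in> \<rat>" by (intro Rats_sum) simp
    then have "coherent L \<alpha>" unfolding coherent_def by (intro exI[of _ "\<lambda>_. 1"]) simp
    then show False using assms by contradiction
  qed
  then show thesis using that by blast
qed

text \<open>Multiples of the irrational weight \<open>\<alpha> E0\<close> are dense modulo 1, so a
  suitable number of \<open>E0\<close>-edges brings the fractional part of minus the total edge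
  weight close to 1. A rank in [0, 1) equals that fractional part.\<close>

lemma gadget_small:
  assumes "\<not> coherent L \<alpha>" "0 < \<epsilon>"
  obtains G :: "nat set" and RG x where "rooted G RG x" "1 - \<epsilon> < d RG G" "d RG G < 1"
proof -
  obtain E0 where E0: "E0 \<in> L" "\<alpha> E0 \<notin> \<rat>" using incoherent_irrational[OF assms(1)] by blast
  obtain l :: "'r \<Rightarrow> nat" where
    l: "\<And>c :: 'r \<Rightarrow> nat. \<exists>(G :: nat set) R x. rooted G R x \<and> d R G < 1 \<and> (\<forall>E\<in>L. NE R E G = l E + c E)"
    using rooted_counts by blast
  define \<beta> where "\<beta> = (\<Sum>E\<in>L. \<alpha> E * real (l E))"
  \<comment> \<open>With \<open>e \<le> 1\<close> the target \<open>x\<close> lies in (0, 1), so the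
    rank differs from it by less than 1, and the shifted difference lies in (0, 2).\<close>
  define e where "e = min 1 \<epsilon>"
  have e: "0 < e" "e \<le> 1" "e \<le> \<epsilon>" using assms(2) unfolding e_def by auto
  have irr: "- \<alpha> E0 \<notin> \<rat>" using E0(2) Rats_minus_iff by blast
  have e2: "0 < e / 2" using e by simp
  \<comment> \<open>The midpoint of the interval (1 - e, 1), shifted by the weight
    \<open>\<beta>\<close> of the unavoidable edges, with tolerance half its length.\<close>
  obtain h k :: int where hk: "k > 0" "\<bar>of_int k * (- \<alpha> E0) - of_int h - (\<beta> + 1 - e / 2)\<bar> < e / 2"
    using sequence_of_fractional_parts_is_dense[OF irr e2, of "\<beta> + 1 - e / 2"] by blast
  define n where "n = nat k"
  define x where "x = - real n * \<alpha> E0 - of_int h - \<beta>"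
  have rk: "real n = of_int k" unfolding n_def using hk(1) by simp
  have "x = of_int k * (- \<alpha> E0) - of_int h - \<beta>" unfolding x_def rk by simp
  then have x: "1 - e < x" "x < 1" using hk(2) unfolding abs_less_iff by linarith+
  obtain G :: "nat set" and RG y where G: "rooted G RG y" "d RG G < 1"
    "\<forall>E\<in>L. NE RG E G = l E + (if E = E0 then n else 0)"
    using l[of "\<lambda>E. if E = E0 then n else 0"] by blast
  have G0: "0 \<le> d RG G" using G(1) in_K_delta_nonneg unfolding rooted_def by blast
  have "(\<Sum>E\<in>L. \<alpha> E * real (NE RG E G)) = (\<Sum>E\<in>L. \<alpha> E * real (l E) + (if E = E0 then \<alpha> E0 * real n else 0))"
    using G(3) by (intro sum.cong) (auto simp: algebra_simps)
  also have "\<dots> = \<beta> + \<alpha> E0 * real n" unfolding sum.distrib \<beta>_def using finite_L E0(1) by simp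
  finally have dG: "d RG G = real (card G) - (\<beta> + \<alpha> E0 * real n)" unfolding delta_def by simp
  have "d RG G - x + 1 = of_int (int (card G) + h + 1)" unfolding dG x_def by (simp add: algebra_simps)
  then have "d RG G - x + 1 \<in> \<int>" by (metis Ints_of_int)
  then have "d RG G - x + 1 = 1"
    by (rule int_in_unit_interval) (use G(2) G0 x e in auto)
  then show thesis using that[OF G(1)] x e G(2) by simp
qed

section \<open>The Fraisse chain\<close>

lemma in_K_agree:
  assumes "K A R" "agree L A R R'" "str A R'" shows "K A R'"
proof -
  have "0 \<le> d R' X" if "X \<subseteq> A" for X
    using delta_agree[OF agree_subset[OF assms(2) that]] in_K_delta_nonneg[OF assms(1) that] by metis
  then show ?thesis using assms(3) in_K_finite[OF assms(1)] unfolding in_K_alpha_def by blast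
qed

lemma strong_agree:
  assumes "strong L \<alpha> A B R" "agree L B R R'" shows "strong L \<alpha> A B R'"
  unfolding strong_def
proof (intro conjI allI impI)
  show AB: "A \<subseteq> B" using assms(1) unfolding strong_def by blast
  fix X assume X: "A \<subseteq> X \<and> X \<subseteq> B"
  then have "d R A \<le> d R X" using assms(1) unfolding strong_def by blast
  then show "d R' A \<le> d R' X"
    using X delta_agree[OF agree_subset[OF assms(2)]] AB by (metis)
qed

text \<open>One link of the chain. The amalgamation is conditional, so the enumeration may contain
  tasks that are not extension problems for \<open>N\<close>; the passage to rank 0 takes place in
  either case.\<close>

lemma fraisse_step:
  fixes N B :: "nat set"
  assumes "coherent L \<alpha>" "K N RN"
  shows "\<exists>N' R'. K N' R' \<and> d R' N' = 0 \<and> N \<subseteq> N' \<and> agree L N RN R' \<and>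
    (K B RB \<and> strong L \<alpha> A B RB \<and> emb A RB N RN f \<longrightarrow> (\<exists>g. emb B RB N' R' g \<and> (\<forall>x\<in>A. g x = f x)))"
proof (cases "K B RB \<and> strong L \<alpha> A B RB \<and> emb A RB N RN f")
  case True
  then obtain N1 R1 g where N1: "K N1 R1" "N \<subseteq> N1" "agree L N RN R1" "emb B RB N1 R1 g" "\<And>x. x \<in> A \<Longrightarrow> g x = f x"
    using strong_amalgam[OF assms(2)] by blast
  obtain N' R' where N': "K N' R'" "N1 \<subseteq> N'" "agree L N1 R1 R'" "d R' N' = 0"
    by (rule zero_completion[OF assms(1) N1(1)])
  have "emb B RB N' R' g"
    by (rule embedding_mono[OF embedding_agree[OF N1(4) agree_refl N'(3)] N'(2)])
  moreover have "agree L N RN R'" by (rule agree_trans[OF N1(3) agree_subset[OF N'(3) N1(2)]])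
  ultimately show ?thesis using N' N1 by (metis order_trans)
next
  case False
  obtain N' R' where "K N' R'" "N \<subseteq> N'" "agree L N RN R'" "d R' N' = 0"
    by (rule zero_completion[OF assms])
  then show ?thesis using False by blast
qed

text \<open>The extension problems handled along the Fraisse chain; normalising RB outside L and f outside A
  makes them countable.\<close>
definition tasks :: "(nat set \<times> ('r \<Rightarrow> nat set set) \<times> nat set \<times> (nat \<Rightarrow> nat)) set" where
  "tasks = {B. finite B} \<times> (\<lambda>\<rho> E. if E \<in> L then \<rho> E else {}) ` (\<Pi>\<^sub>E E\<in>L. {F. finite F \<and> F \<subseteq> {S. finite S}})
     \<times> {A. finite A} \<times> (\<Union>A\<in>{A. finite A}. \<Pi>\<^sub>E x\<in>A. UNIV)"

lemma countable_tasks: "countable tasks"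
proof -
  have fin: "countable {B :: nat set. finite B}" by (rule countable_Collect_finite)
  moreover have "countable (\<Pi>\<^sub>E E\<in>L. {F :: nat set set. finite F \<and> F \<subseteq> {S. finite S}})"
    by (rule countable_PiE[OF finite_L]) (rule countable_Collect_finite_subset[OF fin])
  moreover have "countable (\<Union>A\<in>{A :: nat set. finite A}. \<Pi>\<^sub>E x\<in>A. (UNIV :: nat set))"
    by (rule countable_UN[OF fin]) (auto intro: countable_PiE)
  ultimately show ?thesis unfolding tasks_def by (intro countable_SIGMA countable_image)
qed

lemma task_in:
  assumes "finite B" "str B RB" "A \<subseteq> B"
  shows "(B, \<lambda>E. if E \<in> L then RB E else {}, A, restrict f A) \<in> tasks"
proof -
  have "finite (RB E)" "RB E \<subseteq> {S. finite S}" if E: "E \<in> L" for E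
  proof -
    have "RB E \<subseteq> Pow B" using assms(2) E unfolding sym_structure_def by blast
    then show "finite (RB E)" "RB E \<subseteq> {S. finite S}" using assms(1) by (auto intro: finite_subset)
  qed
  then have "restrict RB L \<in> (\<Pi>\<^sub>E E\<in>L. {F. finite F \<and> F \<subseteq> {S. finite S}})" by auto
  moreover have "(\<lambda>E. if E \<in> L then RB E else {}) = (\<lambda>E. if E \<in> L then restrict RB L E else {})" by (rule ext) simp
  ultimately have 1: "(\<lambda>E. if E \<in> L then RB E else {})
      \<in> (\<lambda>\<rho> E. if E \<in> L then \<rho> E else {}) ` (\<Pi>\<^sub>E E\<in>L. {F. finite F \<and> F \<subseteq> {S. finite S}})" by blast
  have finA: "finite A" using assms(1,3) by (rule rev_finite_subset)
  then have 2: "restrict f A \<in> (\<Union>A\<in>{A. finite A}. \<Pi>\<^sub>E x\<in>A. UNIV)"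
    by (intro UN_I[of A]) auto
  show ?thesis unfolding tasks_def using 1 2 finA assms(1) by (intro SigmaI) auto
qed

lemma zero_generic:
  assumes "coherent L \<alpha>"
  obtains M :: "nat set" and R where "model_S L ar \<alpha> M R"
    "\<And>X. finite X \<Longrightarrow> X \<subseteq> M \<Longrightarrow> \<exists>C. X \<subseteq> C \<and> C \<subseteq> M \<and> finite C \<and> d R C = 0"
proof -
  have ne: "tasks \<noteq> {}" using task_in[of "{}" "\<lambda>_. {}" "{}"] unfolding sym_structure_def by auto
  define T where "T i = from_nat_into tasks (fst (prod_decode i))" for i
  define P where "P t N RN N' R' \<longleftrightarrow> (case t of (B, RB, A, f) \<Rightarrow> K N' R' \<and> d R' N' = 0 \<and> N \<subseteq> N' \<and> agree L N RN R' \<and>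
    (K B RB \<and> strong L \<alpha> A B RB \<and> emb A RB N RN f \<longrightarrow> (\<exists>g. emb B RB N' R' g \<and> (\<forall>x\<in>A. g x = f x))))"
    for t :: "nat set \<times> ('r \<Rightarrow> nat set set) \<times> nat set \<times> (nat \<Rightarrow> nat)" and N :: "nat set" and RN N' R'
  define st where "st = rec_nat ({} :: nat set, \<lambda>_ :: 'r. {} :: nat set set)
    (\<lambda>i s. SOME s'. P (T i) (fst s) (snd s) (fst s') (snd s'))"
  have st0: "st 0 = ({}, \<lambda>_. {})" unfolding st_def by simp
  have stS: "st (Suc i) = (SOME s'. P (T i) (fst (st i)) (snd (st i)) (fst s') (snd s'))" for i
    unfolding st_def by simp
  have ex: "\<exists>s'. P t N RN (fst s') (snd s')" if "K N RN" for t N RN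
    using fraisse_step[OF assms that] unfolding P_def by (cases t) force
  have K0: "K (fst (st 0)) (snd (st 0)) \<and> d (snd (st 0)) (fst (st 0)) = 0"
    unfolding st0 in_K_alpha_def sym_structure_def delta_def NE_def by simp
  have PS: "P (T i) (fst (st i)) (snd (st i)) (fst (st (Suc i))) (snd (st (Suc i)))" if "K (fst (st i)) (snd (st i))" for i
    unfolding stS by (rule someI_ex[OF ex[OF that]])
  have Ki: "K (fst (st i)) (snd (st i)) \<and> d (snd (st i)) (fst (st i)) = 0" for i
  proof (induction i)
    case 0
    then show ?case by (rule K0)
  next
    case (Suc i)
    then show ?case using PS[of i] unfolding P_def by (auto split: prod.splits)
  qed
  note PS = PS[OF conjunct1[OF Ki]]
  define N where "N i = fst (st i)" for i
  define Rs where "Rs i = snd (st i)" for i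
  have KN: "K (N i) (Rs i)" "d (Rs i) (N i) = 0" for i using Ki[of i] unfolding N_def Rs_def by auto
  have step: "N i \<subseteq> N (Suc i) \<and> agree L (N i) (Rs i) (Rs (Suc i))" for i
    using PS[of i] unfolding P_def N_def Rs_def by (auto split: prod.splits)
  have mono: "N i \<subseteq> N j \<and> agree L (N i) (Rs i) (Rs j)" if "i \<le> j" for i j
    using that
  proof (induction j rule: dec_induct)
    case (step j)
    then show ?case using \<open>\<And>i. N i \<subseteq> N (Suc i) \<and> agree L (N i) (Rs i) (Rs (Suc i))\<close>[of j]
      by (meson agree_subset agree_trans order_trans)
  qed simp
  define M where "M = (\<Union>i. N i)"
  define R where "R E = (\<Union>i. Rs i E)" for E
  have sN: "S \<subseteq> N i" "card S = ar E" if "E \<in> L" "S \<in> Rs i E" for E S i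
    using in_K_str[OF KN(1)[of i]] that unfolding sym_structure_def by auto
  have agr: "agree L (N i) (Rs i) R" for i
    unfolding agree_def
  proof (intro ballI allI impI)
    fix E S assume E: "E \<in> L" and S: "S \<subseteq> N i"
    show "(S \<in> Rs i E) = (S \<in> R E)"
    proof
      assume "S \<in> R E"
      then obtain j where j: "S \<in> Rs j E" unfolding R_def by blast
      show "S \<in> Rs i E"
      proof (cases "i \<le> j")
        case True
        then show ?thesis using mono[OF True] E S j unfolding agree_def by simp
      next
        case False
        then show ?thesis using mono[of j i] E sN[OF E j] j unfolding agree_def by simp
      qed
    qed (auto simp: R_def)
  qed
  have NM: "N i \<subseteq> M" for i unfolding M_def by blast
  have finN: "\<exists>i. X \<subseteq> N i" if "finite X" "X \<subseteq> M" for X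
    using that
  proof (induction X rule: finite_induct)
    case (insert x X)
    then obtain i j where "X \<subseteq> N i" "x \<in> N j" unfolding M_def by blast
    then have "insert x X \<subseteq> N (max i j)" using mono[of i "max i j"] mono[of j "max i j"] by auto
    then show ?case by blast
  qed simp
  have dN: "d R X = d (Rs i) X" if "X \<subseteq> N i" for X i
    using delta_agree[OF agree_subset[OF agr that]] by simp
  have strM: "str M R" unfolding sym_structure_def
  proof (intro ballI)
    fix E S assume "E \<in> L" "S \<in> R E"
    then obtain i where "S \<in> Rs i E" unfolding R_def by blast
    then show "S \<subseteq> M \<and> card S = ar E" using sN[OF \<open>E \<in> L\<close>] NM by blast
  qed
  have extp: "\<exists>g. emb B RB M R g \<and> (\<forall>x\<in>A. g x = f x)"
    if B: "K B RB" "strong L \<alpha> A B RB" "emb A RB M R f" for B :: "nat set" and RB A f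
  proof -
    have AB: "A \<subseteq> B" using B(2) unfolding strong_def by blast
    have finA: "finite A" using AB in_K_finite[OF B(1)] by (rule finite_subset)
    have fA: "f ` A \<subseteq> M" using B(3) unfolding embedding_def by blast
    define RB' where "RB' = (\<lambda>E. if E \<in> L then RB E else {})"
    have aB: "agree L B RB RB'" unfolding RB'_def agree_def by simp
    have "str B RB'" using in_K_str[OF B(1)] unfolding RB'_def sym_structure_def by simp
    then have KB': "K B RB'" by (rule in_K_agree[OF B(1) aB])
    have sB': "strong L \<alpha> A B RB'" by (rule strong_agree[OF B(2) aB])
    let ?t = "(B, RB', A, restrict f A)"
    have tin: "?t \<in> tasks" unfolding RB'_def by (rule task_in[OF in_K_finite[OF B(1)] in_K_str[OF B(1)] AB])
    obtain i0 where i0: "f ` A \<subseteq> N i0" using finN[OF _ fA] finA by blast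
    \<comment> \<open>Every task recurs at arbitrarily late stages. Pairing its code with
      \<open>i0\<close> gives a stage \<open>i\<close> no earlier than \<open>i0\<close>, by which
      the image of \<open>f\<close> is already present.\<close>
    define i where "i = prod_encode (to_nat_on tasks ?t, i0)"
    have "i0 \<le> i" unfolding i_def by (rule le_prod_encode_2)
    then have fi: "f ` A \<subseteq> N i" using mono[of i0 i] i0 by blast
    have Ti: "T i = ?t" unfolding T_def i_def using tin countable_tasks by simp
    have "emb A RB' (N i) (Rs i) f"
    proof (rule embedding_mono[OF _ fi])
      show "emb A RB' (f ` A) (Rs i) f"
        by (rule embedding_agree[OF embedding_restrict[OF B(3)] agree_subset[OF aB AB]
              agree_subset[OF agree_sym[OF agr] fi]])
    qed
    then have "emb A RB' (N i) (Rs i) (restrict f A)" by (rule embedding_cong) simp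
    then obtain g where g: "emb B RB' (N (Suc i)) (Rs (Suc i)) g" "\<forall>x\<in>A. g x = restrict f A x"
      using PS[of i] KB' sB' unfolding P_def Ti N_def Rs_def by auto
    have "emb B RB M R g"
      by (rule embedding_mono[OF embedding_agree[OF g(1) agree_sym[OF aB] agr] NM])
    then show ?thesis using g(2) by auto
  qed
  have "M \<noteq> {}"
  proof -
    let ?Z = "\<lambda>_ :: 'r. {} :: nat set set"
    have "K {0 :: nat} ?Z" unfolding in_K_alpha_def sym_structure_def delta_def NE_def by simp
    moreover have "strong L \<alpha> {} {0 :: nat} ?Z" unfolding strong_def delta_def NE_def by simp
    moreover have "emb {} ?Z M R id" unfolding embedding_def
      using strM ar2 unfolding sym_structure_def by fastforce
    ultimately obtain g where "emb {0 :: nat} ?Z M R g" using extp by blast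
    then show ?thesis unfolding embedding_def by blast
  qed
  moreover have "0 \<le> d R X" if fX: "finite X" and XM: "X \<subseteq> M" for X
  proof -
    obtain i where "X \<subseteq> N i" using finN[OF fX XM] by blast
    then show ?thesis using in_K_delta_nonneg[OF KN(1)] dN by simp
  qed
  ultimately have "model_S L ar \<alpha> M R"
    unfolding model_S_def using strM extp by (intro conjI) auto
  moreover have "\<exists>C. X \<subseteq> C \<and> C \<subseteq> M \<and> finite C \<and> d R C = 0" if fX: "finite X" and XM: "X \<subseteq> M" for X
  proof -
    obtain i where "X \<subseteq> N i" using finN[OF fX XM] by blast
    then show ?thesis using NM[of i] dN[of "N i" i] KN[of i] in_K_finite by (intro exI[of _ "N i"]) auto
  qed
  ultimately show thesis using that by blast
qed

end

subsection \<open>Back-and-forth systems and diagrams\<close>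

lemma sat_cong: "(\<And>i. i \<in> fv \<phi> \<Longrightarrow> v i = w i) \<Longrightarrow> sat ar M R v \<phi> = sat ar M R w \<phi>"
proof (induction \<phi> arbitrary: v w)
  case (FRel E xs)
  then have "map v xs = map w xs" "v ` set xs = w ` set xs" by (auto intro: image_cong)
  then show ?case by (simp only: sat.simps)
next
  case (FNeg \<phi>)
  have "sat ar M R v \<phi> = sat ar M R w \<phi>" by (rule FNeg.IH) (use FNeg.prems in simp)
  then show ?case by simp
next
  case (FConj \<phi> \<psi>)
  have "sat ar M R v \<phi> = sat ar M R w \<phi>" by (rule FConj.IH(1)) (use FConj.prems in auto)
  moreover have "sat ar M R v \<psi> = sat ar M R w \<psi>" by (rule FConj.IH(2)) (use FConj.prems in auto)
  ultimately show ?case by simp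
next
  case (FEx x \<phi>)
  have "sat ar M R (v(x := a)) \<phi> = sat ar M R (w(x := a)) \<phi>" for a
    by (rule FEx.IH) (use FEx.prems in auto)
  then show ?case by simp
qed simp

lemma enumerate_extend:
  fixes v :: "nat \<Rightarrow> 'a"
  assumes "finite C" "v ` {..<n} \<subseteq> C"
  obtains N v' where "n \<le> N" "\<And>i. i < n \<Longrightarrow> v' i = v i" "v' ` {..<N} = C"
proof -
  have e: "bij_betw (from_nat_into C) {..<card C} C" by (rule bij_betw_from_nat_into_finite[OF assms(1)])
  define v' where "v' i = (if i < n then v i else from_nat_into C (i - n))" for i
  have "v' ` {..<n + card C} = C"
  proof (intro equalityI subsetI)
    fix x assume "x \<in> v' ` {..<n + card C}"
    then obtain i where i: "i < n + card C" "x = v' i" by blast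
    show "x \<in> C"
    proof (cases "i < n")
      case True
      then show ?thesis using i assms(2) unfolding v'_def by auto
    next
      case False
      then have "i - n \<in> {..<card C}" using i by auto
      then show ?thesis using i False bij_betwE[OF e] unfolding v'_def by simp
    qed
  next
    fix x assume "x \<in> C"
    then obtain j where "j < card C" "x = from_nat_into C j" using e unfolding bij_betw_def by auto
    then show "x \<in> v' ` {..<n + card C}" by (intro image_eqI[of _ _ "n + j"]) (auto simp: v'_def)
  qed
  then show thesis using that[of "n + card C" v'] unfolding v'_def by simp
qed

text \<open>The index measures the quality of a partial isomorphism: each quantifier costs the
  passage from \<open>k\<close> to the \<open>m\<close> of \<open>forth\<close>. Closure under
  inverses makes the forward half of the quantifier case enough.\<close>

lemma back_and_forth:
  fixes I :: "nat \<Rightarrow> 'a set \<Rightarrow> ('a \<Rightarrow> 'a) \<Rightarrow> bool"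
  assumes iso: "\<And>k C f. I k C f \<Longrightarrow> C \<subseteq> M \<and> embedding L C R M R f"
    and inv: "\<And>k C f. I k C f \<Longrightarrow> I k (f ` C) (inv_into C f)"
    and mono: "\<And>k m C f. I m C f \<Longrightarrow> k \<le> m \<Longrightarrow> I k C f"
    and forth: "\<And>k. \<exists>m. \<forall>C f c. I m C f \<longrightarrow> c \<in> M \<longrightarrow>
        (\<exists>D g. C \<subseteq> D \<and> c \<in> D \<and> I k D g \<and> (\<forall>x\<in>C. g x = f x))"
  shows "symbs \<phi> \<subseteq> L \<Longrightarrow> \<exists>m. \<forall>C f v. I m C f \<longrightarrow> v ` fv \<phi> \<subseteq> C \<longrightarrow>
      sat ar M R v \<phi> = sat ar M R (f \<circ> v) \<phi>"
proof (induction \<phi>)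
  case (FRel E xs)
  have "sat ar M R v (FRel E xs) = sat ar M R (f \<circ> v) (FRel E xs)"
    if I: "I 0 C f" and v: "v ` fv (FRel E xs) \<subseteq> C" for C f v
  proof -
    have vC: "v ` set xs \<subseteq> C" using v by simp
    have f: "inj_on f C" "v ` set xs \<in> R E \<longleftrightarrow> f ` v ` set xs \<in> R E"
      using iso[OF I] vC FRel.prems unfolding embedding_def by auto
    have "distinct (map (f \<circ> v) xs) = distinct (map v xs)"
    proof -
      have "map (f \<circ> v) xs = map f (map v xs)" by simp
      moreover have "inj_on f (set (map v xs))" using f(1) vC by (auto intro: inj_on_subset)
      ultimately show ?thesis by (simp only: distinct_map simp_thms)
    qed
    then show ?thesis using f(2) by (simp add: image_comp)
  qed
  then show ?case by blast
next
  case (FEq x y)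
  have "sat ar M R v (FEq x y) = sat ar M R (f \<circ> v) (FEq x y)"
    if I: "I 0 C f" and v: "v ` fv (FEq x y) \<subseteq> C" for C f v
  proof -
    have "inj_on f C" using iso[OF I] unfolding embedding_def by blast
    then show ?thesis using v by (simp add: inj_on_eq_iff)
  qed
  then show ?case by blast
next
  case (FNeg \<phi>)
  then show ?case by simp
next
  case (FConj \<phi> \<psi>)
  then have L: "symbs \<phi> \<subseteq> L" "symbs \<psi> \<subseteq> L" by auto
  obtain m1 where
    m1: "\<And>C f v. I m1 C f \<Longrightarrow> v ` fv \<phi> \<subseteq> C \<Longrightarrow> sat ar M R v \<phi> = sat ar M R (f \<circ> v) \<phi>"
    using FConj.IH(1)[OF L(1)] by blast
  obtain m2 where
    m2: "\<And>C f v. I m2 C f \<Longrightarrow> v ` fv \<psi> \<subseteq> C \<Longrightarrow> sat ar M R v \<psi> = sat ar M R (f \<circ> v) \<psi>"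
    using FConj.IH(2)[OF L(2)] by blast
  have "sat ar M R v (FConj \<phi> \<psi>) = sat ar M R (f \<circ> v) (FConj \<phi> \<psi>)"
    if I: "I (max m1 m2) C f" and v: "v ` fv (FConj \<phi> \<psi>) \<subseteq> C" for C f v
    using m1[OF mono[OF I], of v] m2[OF mono[OF I], of v] v by (simp add: image_Un)
  then show ?case by blast
next
  case (FEx x \<phi>)
  then have L: "symbs \<phi> \<subseteq> L" by simp
  obtain k where
    k: "\<And>C f v. I k C f \<Longrightarrow> v ` fv \<phi> \<subseteq> C \<Longrightarrow> sat ar M R v \<phi> = sat ar M R (f \<circ> v) \<phi>"
    using FEx.IH[OF L] by blast
  obtain m where m: "\<And>C f c. I m C f \<Longrightarrow> c \<in> M \<Longrightarrow>
        \<exists>D g. C \<subseteq> D \<and> c \<in> D \<and> I k D g \<and> (\<forall>x\<in>C. g x = f x)" using forth[of k] by blast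
  have half: "sat ar M R (f \<circ> v) (FEx x \<phi>)"
    if I: "I m C f" and v: "v ` (fv \<phi> - {x}) \<subseteq> C" and s: "sat ar M R v (FEx x \<phi>)" for C f v
  proof -
    obtain a where a: "a \<in> M" "sat ar M R (v(x := a)) \<phi>" using s by auto
    obtain D g where D: "C \<subseteq> D" "a \<in> D" "I k D g" "\<And>z. z \<in> C \<Longrightarrow> g z = f z" using m[OF I a(1)] by blast
    have "(v(x := a)) ` fv \<phi> \<subseteq> D" using v D(1,2) by auto
    then have "sat ar M R (g \<circ> v(x := a)) \<phi>" using k[OF D(3)] a(2) by simp
    moreover have "sat ar M R (g \<circ> v(x := a)) \<phi> = sat ar M R ((f \<circ> v)(x := g a)) \<phi>"
      by (rule sat_cong) (use v D(4) in auto)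
    moreover have "g a \<in> M" using iso[OF D(3)] D(2) unfolding embedding_def by auto
    ultimately show ?thesis by auto
  qed
  have "sat ar M R v (FEx x \<phi>) = sat ar M R (f \<circ> v) (FEx x \<phi>)"
    if I: "I m C f" and v: "v ` fv (FEx x \<phi>) \<subseteq> C" for C f v
  proof
    show "sat ar M R v (FEx x \<phi>) \<Longrightarrow> sat ar M R (f \<circ> v) (FEx x \<phi>)"
      by (rule half[OF I]) (use v in auto)
    assume s: "sat ar M R (f \<circ> v) (FEx x \<phi>)"
    have "(f \<circ> v) ` (fv \<phi> - {x}) \<subseteq> f ` C" using v by auto
    then have "sat ar M R (inv_into C f \<circ> (f \<circ> v)) (FEx x \<phi>)" by (rule half[OF inv[OF I] _ s])
    moreover have "sat ar M R (inv_into C f \<circ> (f \<circ> v)) (FEx x \<phi>) = sat ar M R v (FEx x \<phi>)"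
    proof (rule sat_cong)
      fix i assume "i \<in> fv (FEx x \<phi>)"
      then have "v i \<in> C" using v by auto
      moreover have "inj_on f C" using iso[OF I] unfolding embedding_def by blast
      ultimately show "(inv_into C f \<circ> (f \<circ> v)) i = v i" by simp
    qed
    ultimately show "sat ar M R v (FEx x \<phi>)" by simp
  qed
  then show ?case by blast
qed

section \<open>Diagram formulas\<close>

lemma literal_conjunction:
  assumes "finite \<Theta>" "\<And>\<theta>. \<theta> \<in> \<Theta> \<Longrightarrow> symbs \<theta> \<subseteq> L \<and> fv \<theta> \<subseteq> V"
  shows "\<exists>\<eta>. symbs \<eta> \<subseteq> L \<and> fv \<eta> \<subseteq> V \<and>
    (\<forall>w. sat ar M R w \<eta> \<longleftrightarrow> (\<forall>\<theta>\<in>\<Theta>. sat ar M R w \<theta> = sat ar M R v \<theta>))"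
  using assms
proof (induction \<Theta> rule: finite_induct)
  case empty
  \<comment> \<open>The empty conjunction: a true sentence without free variables, as
    \<open>fm\<close> has no constant for truth.\<close>
  show ?case by (rule exI[of _ "FNeg (FEx 0 (FNeg (FEq 0 0)))"]) simp
next
  case (insert \<theta> \<Theta>)
  then obtain \<eta> where \<eta>: "symbs \<eta> \<subseteq> L" "fv \<eta> \<subseteq> V"
    "\<And>w. sat ar M R w \<eta> \<longleftrightarrow> (\<forall>\<theta>\<in>\<Theta>. sat ar M R w \<theta> = sat ar M R v \<theta>)"
    by auto
  have \<theta>: "symbs \<theta> \<subseteq> L" "fv \<theta> \<subseteq> V" using insert.prems by auto
  show ?case
  proof (cases "sat ar M R v \<theta>")
    case True
    show ?thesis by (rule exI[of _ "FConj \<theta> \<eta>"]) (use \<eta> \<theta> True in auto)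
  next
    case False
    show ?thesis by (rule exI[of _ "FConj (FNeg \<theta>) \<eta>"]) (use \<eta> \<theta> False in auto)
  qed
qed

lemma existential_closure:
  "symbs \<eta> \<subseteq> L \<Longrightarrow> fv \<eta> \<subseteq> {..<n + k} \<Longrightarrow>
    \<exists>\<psi>. symbs \<psi> \<subseteq> L \<and> fv \<psi> \<subseteq> {..<n} \<and>
      (\<forall>w. sat ar M R w \<psi> \<longleftrightarrow> (\<exists>w'. (\<forall>i<n. w' i = w i) \<and> (\<forall>i. n \<le> i \<and> i < n + k \<longrightarrow> w' i \<in> M) \<and> sat ar M R w' \<eta>))"
proof (induction k arbitrary: \<eta>)
  case 0
  have "sat ar M R w \<eta> \<longleftrightarrow>
    (\<exists>w'. (\<forall>i<n. w' i = w i) \<and> (\<forall>i. n \<le> i \<and> i < n + 0 \<longrightarrow> w' i \<in> M) \<and> sat ar M R w' \<eta>)" for w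
  proof
    assume "\<exists>w'. (\<forall>i<n. w' i = w i) \<and> (\<forall>i. n \<le> i \<and> i < n + 0 \<longrightarrow> w' i \<in> M) \<and> sat ar M R w' \<eta>"
    then obtain w' where w': "\<forall>i<n. w' i = w i" "sat ar M R w' \<eta>" by blast
    have "sat ar M R w' \<eta> = sat ar M R w \<eta>" by (rule sat_cong) (use w' 0 in auto)
    then show "sat ar M R w \<eta>" using w' by simp
  qed auto
  moreover have "fv \<eta> \<subseteq> {..<n}" using 0(2) by simp
  ultimately show ?case using 0(1) by (intro exI[of _ \<eta>] conjI allI)
next
  case (Suc k)
  have "fv (FEx (n + k) \<eta>) \<subseteq> {..<n + k}" using Suc.prems(2) by (auto simp: less_Suc_eq)
  then obtain \<psi> where \<psi>: "symbs \<psi> \<subseteq> L" "fv \<psi> \<subseteq> {..<n}"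
    "\<And>w. sat ar M R w \<psi> \<longleftrightarrow> (\<exists>w'. (\<forall>i<n. w' i = w i) \<and> (\<forall>i. n \<le> i \<and> i < n + k \<longrightarrow> w' i \<in> M) \<and>
        sat ar M R w' (FEx (n + k) \<eta>))"
    using Suc.IH[of "FEx (n + k) \<eta>"] Suc.prems(1) by auto
  have "sat ar M R w \<psi> \<longleftrightarrow> (\<exists>w'. (\<forall>i<n. w' i = w i) \<and> (\<forall>i. n \<le> i \<and> i < n + Suc k \<longrightarrow> w' i \<in> M) \<and> sat ar M R w' \<eta>)"
    for w
  proof
    assume "sat ar M R w \<psi>"
    then obtain w' a where w': "\<forall>i<n. w' i = w i" "\<forall>i. n \<le> i \<and> i < n + k \<longrightarrow> w' i \<in> M"
      "a \<in> M" "sat ar M R (w'(n + k := a)) \<eta>" unfolding \<psi>(3) by auto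
    then show "\<exists>w'. (\<forall>i<n. w' i = w i) \<and> (\<forall>i. n \<le> i \<and> i < n + Suc k \<longrightarrow> w' i \<in> M) \<and> sat ar M R w' \<eta>"
      by (intro exI[of _ "w'(n + k := a)"]) auto
  next
    assume "\<exists>w'. (\<forall>i<n. w' i = w i) \<and> (\<forall>i. n \<le> i \<and> i < n + Suc k \<longrightarrow> w' i \<in> M) \<and> sat ar M R w' \<eta>"
    then obtain w' where w': "\<forall>i<n. w' i = w i" "\<forall>i. n \<le> i \<and> i < n + Suc k \<longrightarrow> w' i \<in> M" "sat ar M R w' \<eta>"
      by blast
    then have "w' (n + k) \<in> M" by simp
    then have "sat ar M R w' (FEx (n + k) \<eta>)" using w'(3) by (auto intro!: bexI[of _ "w' (n + k)"])
    then show "sat ar M R w \<psi>" unfolding \<psi>(3) using w' by (intro exI[of _ w']) auto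
  qed
  then show ?case using \<psi>(1,2) by blast
qed

lemma embedding_of_atoms:
  assumes str: "sym_structure L ar M R" and vM: "v ` {..<N} \<subseteq> M" and wM: "w ` {..<N} \<subseteq> M"
    and eq: "\<And>i j. i < N \<Longrightarrow> j < N \<Longrightarrow> v i = v j \<longleftrightarrow> w i = w j"
    and rel: "\<And>E xs. E \<in> L \<Longrightarrow> length xs = ar E \<Longrightarrow> set xs \<subseteq> {..<N} \<Longrightarrow>
      sat ar M R w (FRel E xs) = sat ar M R v (FRel E xs)"
  obtains f where "embedding L (v ` {..<N}) R M R f" "\<And>i. i < N \<Longrightarrow> f (v i) = w i"
proof -
  define f where "f y = w (SOME i. i < N \<and> v i = y)" for y
  have f: "f (v i) = w i" if "i < N" for i
  proof -
    have "(SOME j. j < N \<and> v j = v i) < N \<and> v (SOME j. j < N \<and> v j = v i) = v i"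
      by (rule someI[of "\<lambda>j. j < N \<and> v j = v i" i]) (use that in simp)
    then show ?thesis unfolding f_def using eq[OF _ that] by blast
  qed
  have inj: "inj_on f (v ` {..<N})" unfolding inj_on_def using f eq by auto
  have "S \<in> R E \<longleftrightarrow> f ` S \<in> R E" if E: "E \<in> L" and S: "S \<subseteq> v ` {..<N}" for E S
  proof (cases "card S = ar E")
    case True
    \<comment> \<open>\<open>v\<close> may repeat values, so \<open>S\<close> is listed along
      indices on which \<open>v\<close>, and then also \<open>w\<close>, is injective.\<close>
    obtain T where T: "T \<subseteq> {..<N}" "inj_on v T" "S = v ` T" using S subset_image_inj by metis
    have finT: "finite T" using T(1) by (rule finite_subset) simp
    define xs where "xs = sorted_list_of_set T"
    have xs: "set xs = T" "distinct xs" "length xs = ar E"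
      using finT True card_image[OF T(2)] unfolding xs_def T(3) by auto
    have fS: "f ` S = w ` T" unfolding T(3) image_image using f T(1) by (intro image_cong) auto
    have "inj_on w T"
    proof (rule inj_onI)
      fix i j assume "i \<in> T" "j \<in> T" "w i = w j"
      then have "v i = v j" using eq[of i j] T(1) by auto
      then show "i = j" using T(2) \<open>i \<in> T\<close> \<open>j \<in> T\<close> unfolding inj_on_def by blast
    qed
    then have "distinct (map w xs)" "distinct (map v xs)" using xs T(2) by (auto simp: distinct_map)
    then show ?thesis using rel[OF E xs(3)] xs T(1) unfolding fS by (simp add: T(3))
  next
    case False
    have "card (f ` S) = card S" by (rule card_image[OF inj_on_subset[OF inj S]])
    then show ?thesis using False str E unfolding sym_structure_def by metis
  qed
  moreover have "f ` v ` {..<N} \<subseteq> M" using f wM by auto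
  ultimately have "embedding L (v ` {..<N}) R M R f" using inj unfolding embedding_def by blast
  then show thesis using that f by blast
qed

text \<open>Finitely many atomic formulas in \<open>N\<close> variables describe the induced
  structure on the values of \<open>v\<close>; quantifying all but the first \<open>n\<close> of
  them leaves the assertion that a copy of the whole configuration lies over \<open>w\<close>. It
  serves both to isolate types and to separate them.\<close>

lemma diagram_formula:
  assumes L: "finite L" and str: "sym_structure L ar M R" and nN: "n \<le> N" and vM: "v ` {..<N} \<subseteq> M"
  obtains \<psi> where "symbs \<psi> \<subseteq> L" "fv \<psi> \<subseteq> {..<n}"
    "\<And>w. w ` {..<n} \<subseteq> M \<Longrightarrow> sat ar M R w \<psi> \<longleftrightarrow>
      (\<exists>f. embedding L (v ` {..<N}) R M R f \<and> (\<forall>i<n. f (v i) = w i))"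
proof -
  define \<Theta> where "\<Theta> = (\<lambda>(i, j). FEq i j) ` ({..<N} \<times> {..<N}) \<union>
    (\<Union>E\<in>L. FRel E ` {xs. set xs \<subseteq> {..<N} \<and> length xs = ar E})"
  have "finite \<Theta>" unfolding \<Theta>_def using L finite_lists_length_eq[of "{..<N}"] by auto
  moreover have "symbs \<theta> \<subseteq> L \<and> fv \<theta> \<subseteq> {..<N}" if "\<theta> \<in> \<Theta>" for \<theta> using that unfolding \<Theta>_def by auto
  ultimately obtain \<eta> where \<eta>: "symbs \<eta> \<subseteq> L" "fv \<eta> \<subseteq> {..<N}"
    "\<And>w. sat ar M R w \<eta> \<longleftrightarrow> (\<forall>\<theta>\<in>\<Theta>. sat ar M R w \<theta> = sat ar M R v \<theta>)"
    using literal_conjunction[of \<Theta> L "{..<N}" ar M R v] by blast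
  have eqT: "FEq i j \<in> \<Theta>" if "i < N" "j < N" for i j using that unfolding \<Theta>_def by auto
  have relT: "FRel E xs \<in> \<Theta>" if "E \<in> L" "length xs = ar E" "set xs \<subseteq> {..<N}" for E xs
    using that unfolding \<Theta>_def by blast
  have N: "n + (N - n) = N" using nN by simp
  obtain \<psi> where \<psi>: "symbs \<psi> \<subseteq> L" "fv \<psi> \<subseteq> {..<n}"
    "\<And>w. sat ar M R w \<psi> \<longleftrightarrow> (\<exists>w'. (\<forall>i<n. w' i = w i) \<and> (\<forall>i. n \<le> i \<and> i < N \<longrightarrow> w' i \<in> M) \<and> sat ar M R w' \<eta>)"
    using existential_closure[OF \<eta>(1), of n "N - n" ar M R] \<eta>(2) unfolding N by blast
  have "sat ar M R w \<psi> \<longleftrightarrow> (\<exists>f. embedding L (v ` {..<N}) R M R f \<and> (\<forall>i<n. f (v i) = w i))"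
    if wM: "w ` {..<n} \<subseteq> M" for w
  proof
    assume "sat ar M R w \<psi>"
    then obtain w' where w': "\<forall>i<n. w' i = w i" "\<forall>i. n \<le> i \<and> i < N \<longrightarrow> w' i \<in> M" "sat ar M R w' \<eta>"
      unfolding \<psi>(3) by blast
    have *: "sat ar M R w' \<theta> = sat ar M R v \<theta>" if "\<theta> \<in> \<Theta>" for \<theta> using w'(3) that unfolding \<eta>(3) by blast
    have "w' ` {..<N} \<subseteq> M"
    proof
      fix y assume "y \<in> w' ` {..<N}"
      then obtain i where "i < N" "y = w' i" by blast
      then show "y \<in> M" using w'(1,2) wM by (cases "i < n") auto
    qed
    moreover have "v i = v j \<longleftrightarrow> w' i = w' j" if "i < N" "j < N" for i j using *[OF eqT[OF that]] by auto
    ultimately obtain f where "embedding L (v ` {..<N}) R M R f" "\<And>i. i < N \<Longrightarrow> f (v i) = w' i"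
      using embedding_of_atoms[OF str vM, of w'] *[OF relT] by blast
    then show "\<exists>f. embedding L (v ` {..<N}) R M R f \<and> (\<forall>i<n. f (v i) = w i)" using w'(1) nN by auto
  next
    assume "\<exists>f. embedding L (v ` {..<N}) R M R f \<and> (\<forall>i<n. f (v i) = w i)"
    then obtain f where f: "embedding L (v ` {..<N}) R M R f" "\<forall>i<n. f (v i) = w i" by blast
    have inj: "inj_on f (v ` {..<N})" using f(1) unfolding embedding_def by blast
    have "sat ar M R (f \<circ> v) \<theta> = sat ar M R v \<theta>" if th: "\<theta> \<in> \<Theta>" for \<theta>
    proof -
      consider i j where "\<theta> = FEq i j" "i < N" "j < N"
        | E xs where "\<theta> = FRel E xs" "E \<in> L" "set xs \<subseteq> {..<N}" using th unfolding \<Theta>_def by auto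
      then show ?thesis
      proof cases
        case 1
        then show ?thesis using inj by (auto simp: inj_on_eq_iff)
      next
        case 2
        have vN: "v ` set xs \<subseteq> v ` {..<N}" using 2(3) by blast
        have "map (f \<circ> v) xs = map f (map v xs)" by simp
        moreover have "inj_on f (set (map v xs))" using inj vN by (auto intro: inj_on_subset)
        ultimately have "distinct (map (f \<circ> v) xs) = distinct (map v xs)" by (simp only: distinct_map simp_thms)
        moreover have "v ` set xs \<in> R E \<longleftrightarrow> f ` v ` set xs \<in> R E"
          using f(1) 2(2) vN unfolding embedding_def by simp
        ultimately show ?thesis unfolding 2(1) by (simp add: image_comp)
      qed
    qed
    then have "sat ar M R (f \<circ> v) \<eta>" unfolding \<eta>(3) by blast
    moreover have "f (v i) \<in> M" if "i < N" for i using f(1) that unfolding embedding_def by auto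
    ultimately show "sat ar M R w \<psi>" unfolding \<psi>(3) using f(2) by (intro exI[of _ "f \<circ> v"]) auto
  qed
  then show thesis using that \<psi>(1,2) by blast
qed

context rank
begin

section \<open>Atomicity of the model built from sets of rank zero\<close>

lemma model_str: "model_S L ar \<alpha> M R \<Longrightarrow> str M R"
  and model_nonneg: "model_S L ar \<alpha> M R \<Longrightarrow> finite X \<Longrightarrow> X \<subseteq> M \<Longrightarrow> 0 \<le> d R X"
  unfolding model_S_def by blast+

lemma model_extend:
  fixes B :: "nat set"
  assumes "model_S L ar \<alpha> M R" "K B RB" "strong L \<alpha> A B RB" "emb A RB M R f"
  obtains g where "emb B RB M R g" "\<And>x. x \<in> A \<Longrightarrow> g x = f x"
  using assms unfolding model_S_def by metis

text \<open>Embeddings of rank 0 sets form a back-and-forth system: such a set is strong in any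
  larger one, so the map extends to a rank 0 set with the required point. A tuple satisfying the
  diagram formula of a rank 0 set around \<open>v\<close> is the image of \<open>v\<close> under
  such an embedding.\<close>

lemma zero_generic_atomic:
  fixes M :: "nat set"
  assumes mod: "model_S L ar \<alpha> M R"
    and zero: "\<And>X. finite X \<Longrightarrow> X \<subseteq> M \<Longrightarrow> \<exists>C. X \<subseteq> C \<and> C \<subseteq> M \<and> finite C \<and> d R C = 0"
  shows "atomic_structure L ar M R"
proof -
  define I where "I k C f \<longleftrightarrow> C \<subseteq> M \<and> finite C \<and> d R C = 0 \<and> emb C R M R f"
    for k :: nat and C and f :: "nat \<Rightarrow> nat"
  have forth: "\<exists>D g. C \<subseteq> D \<and> c \<in> D \<and> I k D g \<and> (\<forall>x\<in>C. g x = f x)"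
    if I: "I m C f" and c: "c \<in> M" for m k C f c
  proof -
    have C: "C \<subseteq> M" "finite C" "d R C = 0" "emb C R M R f" using I unfolding I_def by auto
    have cC: "finite (insert c C)" "insert c C \<subseteq> M" using C c by auto
    obtain D where D: "insert c C \<subseteq> D" "D \<subseteq> M" "finite D" "d R D = 0" using zero[OF cC] by blast
    let ?RD = "push id D R"
    have a: "agree L D R ?RD" by (rule agree_push_id)
    have nn: "0 \<le> d R X" if "X \<subseteq> D" for X
      by (rule model_nonneg[OF mod]) (use that D(2,3) in \<open>auto intro: finite_subset\<close>)
    have "K D ?RD" using in_K_push[OF model_str[OF mod] D(3) inj_on_id nn] by simp
    moreover have "strong L \<alpha> C D R" unfolding strong_def using D(1) C(3) nn by auto
    then have "strong L \<alpha> C D ?RD" by (rule strong_agree[OF _ a])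
    moreover have "C \<subseteq> D" using D(1) by blast
    then have "emb C ?RD M R f" by (intro embedding_agree[OF C(4) agree_subset[OF a] agree_refl])
    ultimately obtain g where g: "emb D ?RD M R g" "\<And>x. x \<in> C \<Longrightarrow> g x = f x"
      using model_extend[OF mod] by blast
    have "emb D R M R g" by (rule embedding_agree[OF g(1) agree_sym[OF a] agree_refl])
    then have "I k D g" unfolding I_def using D by blast
    then show ?thesis using D(1) g(2) by blast
  qed
  have inv: "I k (f ` C) (inv_into C f)" if I: "I k C f" for k C f
  proof -
    have C: "C \<subseteq> M" "finite C" "d R C = 0" "emb C R M R f" using I unfolding I_def by auto
    have "f ` C \<subseteq> M" using C(4) unfolding embedding_def by blast
    moreover have "d R (f ` C) = 0" using delta_embedding[OF C(4) order_refl] C(3) by simp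
    ultimately show ?thesis
      unfolding I_def using C(2) embedding_mono[OF embedding_inv[OF C(4)] C(1)] by blast
  qed
  have bf: "\<exists>m. \<forall>C f v. I m C f \<longrightarrow> v ` fv \<psi> \<subseteq> C \<longrightarrow> sat ar M R v \<psi> = sat ar M R (f \<circ> v) \<psi>"
    if "symbs \<psi> \<subseteq> L" for \<psi>
  proof (rule back_and_forth[where I=I])
    show "C \<subseteq> M \<and> emb C R M R f" if "I k C f" for k C f using that unfolding I_def by blast
    show "I k (f ` C) (inv_into C f)" if "I k C f" for k C f by (rule inv[OF that])
    show "I k C f" if "I m C f" "k \<le> m" for k m C f using that unfolding I_def by blast
    show "\<exists>m. \<forall>C f c. I m C f \<longrightarrow> c \<in> M \<longrightarrow> (\<exists>D g. C \<subseteq> D \<and> c \<in> D \<and> I k D g \<and> (\<forall>x\<in>C. g x = f x))" for k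
      by (intro exI[of _ 0] allI impI forth)
    show "symbs \<psi> \<subseteq> L" by (rule that)
  qed
  show ?thesis unfolding atomic_structure_def
  proof (intro allI impI)
    fix n and v :: "nat \<Rightarrow> nat" assume v: "v ` {..<n} \<subseteq> M"
    obtain C where C: "v ` {..<n} \<subseteq> C" "C \<subseteq> M" "finite C" "d R C = 0" using zero[OF _ v] by auto
    obtain N v' where v': "n \<le> N" "\<And>i. i < n \<Longrightarrow> v' i = v i" "v' ` {..<N} = C"
      using enumerate_extend[OF C(3,1)] by blast
    have v'M: "v' ` {..<N} \<subseteq> M" using v'(3) C(2) by simp
    obtain \<phi> where \<phi>: "symbs \<phi> \<subseteq> L" "fv \<phi> \<subseteq> {..<n}"
      "\<And>w. w ` {..<n} \<subseteq> M \<Longrightarrow> sat ar M R w \<phi> \<longleftrightarrow>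
        (\<exists>f. emb C R M R f \<and> (\<forall>i<n. f (v' i) = w i))"
      using diagram_formula[OF finite_L model_str[OF mod] v'(1) v'M] unfolding v'(3) by blast
    have "emb C R M R id" by (rule embedding_id[OF agree_refl C(2)])
    then have s: "sat ar M R v \<phi>" unfolding \<phi>(3)[OF v] using v'(2) by (intro exI[of _ id]) simp
    have same: "sat ar M R w \<psi> = sat ar M R v \<psi>"
      if \<psi>: "symbs \<psi> \<subseteq> L" "fv \<psi> \<subseteq> {..<n}" and w: "w ` {..<n} \<subseteq> M" "sat ar M R w \<phi>" for \<psi> w
    proof -
      obtain f where f: "emb C R M R f" "\<forall>i<n. f (v' i) = w i" using w \<phi>(3)[OF w(1)] by blast
      obtain m where m: "\<And>C f v. I m C f \<Longrightarrow> v ` fv \<psi> \<subseteq> C \<Longrightarrow> sat ar M R v \<psi> = sat ar M R (f \<circ> v) \<psi>"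
        using bf[OF \<psi>(1)] by blast
      have "I m C f" unfolding I_def using C f(1) by blast
      moreover have "v ` fv \<psi> \<subseteq> C" using C(1) \<psi>(2) by blast
      ultimately have "sat ar M R v \<psi> = sat ar M R (f \<circ> v) \<psi>" by (rule m)
      also have "\<dots> = sat ar M R w \<psi>"
        by (rule sat_cong) (use \<psi>(2) f(2) v'(2) in auto)
      finally show ?thesis by simp
    qed
    show "isolated_type L ar M R n v" unfolding isolated_type_def
    proof (intro exI conjI allI impI)
      fix \<psi> :: "'r fm" assume "symbs \<psi> \<subseteq> L \<and> fv \<psi> \<subseteq> {..<n}"
      then show "(\<forall>w. w ` {..<n} \<subseteq> M \<and> sat ar M R w \<phi> \<longrightarrow> sat ar M R w \<psi>) \<or>
           (\<forall>w. w ` {..<n} \<subseteq> M \<and> sat ar M R w \<phi> \<longrightarrow> \<not> sat ar M R w \<psi>)"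
        using same[of \<psi>] by (cases "sat ar M R v \<psi>") simp_all
    qed (use \<phi>(1,2) s in auto)
  qed
qed

subsection \<open>Closed sets in the incoherent case\<close>

lemma delta_le_add_card:
  assumes "finite Y" "X \<subseteq> Y" shows "d R Y \<le> d R X + real (card (Y - X))"
proof -
  have "card Y = card X + card (Y - X)"
    using assms by (metis card_Diff_subset card_mono finite_subset le_add_diff_inverse)
  moreover have "(\<Sum>E\<in>L. \<alpha> E * real (NE R E X)) \<le> (\<Sum>E\<in>L. \<alpha> E * real (NE R E Y))"
    using \<alpha>_pos NE_mono[OF assms] by (intro sum_mono mult_left_mono of_nat_mono) (auto simp: less_imp_le)
  ultimately show ?thesis unfolding delta_def by simp
qed

text \<open>Strongness of \<open>C\<close> in \<open>M\<close>, tested only against supersets with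
  at most \<open>k\<close> new points.\<close>

definition closed_in :: "nat \<Rightarrow> 'a set \<Rightarrow> 'a set \<Rightarrow> ('r \<Rightarrow> 'a set set) \<Rightarrow> bool" where
  "closed_in k C M R \<longleftrightarrow> C \<subseteq> M \<and> finite C \<and>
     (\<forall>X. C \<subseteq> X \<and> X \<subseteq> M \<and> finite X \<and> card (X - C) \<le> k \<longrightarrow> d R C \<le> d R X)"

lemma closed_inD:
  "closed_in k C M R \<Longrightarrow> C \<subseteq> X \<Longrightarrow> X \<subseteq> M \<Longrightarrow> finite X \<Longrightarrow> card (X - C) \<le> k \<Longrightarrow> d R C \<le> d R X"
  unfolding closed_in_def by blast

lemma closed_in_le: "closed_in m C M R \<Longrightarrow> k \<le> m \<Longrightarrow> closed_in k C M R"
  unfolding closed_in_def by (meson order_trans)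

text \<open>A gadget whose rank is slightly below 1 lowers the rank of D a little; being a small
  decrease, it is invisible to sets with at most k new points.\<close>
lemma shrink_step:
  fixes D :: "nat set"
  assumes G: "rooted G RG x" and u: "u = 1 - d RG G" "0 < u" "u < gap k"
    and D: "K D R" "strong L \<alpha> A D R" "y \<in> D" "y \<notin> A"
    and low: "\<And>X. y \<in> X \<Longrightarrow> A \<subseteq> X \<Longrightarrow> X \<subseteq> D \<Longrightarrow> d R A + u \<le> d R X"
    and B: "y \<in> B" "closed_in k B D R"
  obtains D' R' where "K D' R'" "D \<subseteq> D'" "agree L D R R'" "strong L \<alpha> A D' R'" "closed_in k B D' R'"
    "d R' D' = d R D - u" "card D' \<le> card D + card G"
proof -
  have AD: "A \<subseteq> D" using D(2) unfolding strong_def by blast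
  have BD: "B \<subseteq> D" using B(2) unfolding closed_in_def by blast
  have finD: "finite D" using in_K_finite[OF D(1)] .
  obtain H R' where H: "finite (D \<union> H)" "str (D \<union> H) R'" "D \<inter> H = {y}" "agree L D R R'" "card H = card G"
    "d R' H = d RG G" "\<And>X. X \<subseteq> H \<Longrightarrow> 0 \<le> d R' X" "\<And>X. X \<subseteq> H \<Longrightarrow> y \<in> X \<Longrightarrow> d RG G \<le> d R' X"
    "\<And>X. X \<subseteq> D \<union> H \<Longrightarrow> d R' X = d R' (X \<inter> D) + d R' (X \<inter> H) - (if y \<in> X then 1 else 0)"
    using glue[OF D(1,3) G] by blast
  have dD: "d R' X = d R X" if "X \<subseteq> D" for X
    using delta_agree[OF agree_subset[OF H(4) that]] by simp
  have yH: "y \<in> H" using H(3) by blast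
  have in_y: "d R (X \<inter> D) - u \<le> d R' X" if X: "X \<subseteq> D \<union> H" "y \<in> X" for X
    using H(9)[OF X(1)] X(2) H(8)[of "X \<inter> H"] yH dD[of "X \<inter> D"] u(1) by simp
  have out_y: "d R (X \<inter> D) \<le> d R' X" if X: "X \<subseteq> D \<union> H" "y \<notin> X" for X
    using H(9)[OF X(1)] X(2) H(7)[of "X \<inter> H"] dD[of "X \<inter> D"] by simp
  \<comment> \<open>By \<open>low\<close>, sets through \<open>y\<close> have a surplus of at least
    \<open>u\<close> over their trace on \<open>A\<close>; this pays for the loss of at most
    \<open>u\<close> caused by the gadget.\<close>
  have rel: "d R (X \<inter> A) + (if y \<in> X then u else 0) \<le> d R X" if X: "X \<subseteq> D" for X
  proof -
    have "d R (X \<union> A) + d R (X \<inter> A) \<le> d R X + d R A"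
      using submodular[of X A R] X AD finD by (meson finite_subset)
    moreover have "d R A + (if y \<in> X then u else 0) \<le> d R (X \<union> A)"
    proof (cases "y \<in> X")
      case True
      then show ?thesis using low[of "X \<union> A"] X AD by simp
    next
      case False
      then show ?thesis using D(2) X AD unfolding strong_def by simp
    qed
    ultimately show ?thesis by linarith
  qed
  have ge: "d R (X \<inter> A) \<le> d R' X" if X: "X \<subseteq> D \<union> H" for X
  proof -
    have "X \<inter> D \<inter> A = X \<inter> A" using AD by blast
    then show ?thesis using rel[of "X \<inter> D"] in_y[OF X] out_y[OF X] D(3) by (cases "y \<in> X") auto
  qed
  have "0 \<le> d R' X" if X: "X \<subseteq> D \<union> H" for X
    using ge[OF X] in_K_delta_nonneg[OF D(1), of "X \<inter> A"] AD by (meson inf.coboundedI2 order_trans)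
  then have "K (D \<union> H) R'" unfolding in_K_alpha_def using H(1,2) by blast
  moreover have "strong L \<alpha> A (D \<union> H) R'" unfolding strong_def
  proof (intro conjI allI impI)
    fix X assume X: "A \<subseteq> X \<and> X \<subseteq> D \<union> H"
    then have "X \<inter> A = A" by blast
    then show "d R' A \<le> d R' X" using ge[of X] X dD[OF AD] by simp
  qed (use AD in blast)
  moreover have "closed_in k B (D \<union> H) R'" unfolding closed_in_def
  proof (intro conjI allI impI)
    fix X assume "B \<subseteq> X \<and> X \<subseteq> D \<union> H \<and> finite X \<and> card (X - B) \<le> k"
    then have X: "B \<subseteq> X" "X \<subseteq> D \<union> H" "finite X" "card (X - B) \<le> k" by auto
    have yX: "y \<in> X" using X(1) B(1) by blast
    have "X \<inter> D - B \<subseteq> X - B" by blast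
    then have "card (X \<inter> D - B) \<le> k" using card_mono[of "X - B" "X \<inter> D - B"] X(3,4) by simp
    then have "d R B \<le> d R (X \<inter> D)"
      by (intro closed_inD[OF B(2)]) (use X(1,3) BD in auto)
    \<comment> \<open>The gadget part of \<open>X\<close> adds at most \<open>k\<close> points to
      \<open>y\<close>, whose rank is 1. A drop would therefore be at least \<open>gap k\<close>,
      but the gadget allows at most \<open>u\<close>.\<close>
    moreover have "1 \<le> d R' (X \<inter> H)"
    proof (rule ccontr)
      assume n: "\<not> 1 \<le> d R' (X \<inter> H)"
      have y1: "d R' {y} = 1" by (rule delta_singleton[OF H(2)])
      have "X \<inter> H - {y} \<subseteq> X - B" using H(3) BD by blast
      then have "card (X \<inter> H - {y}) \<le> k" using card_mono[of "X - B" "X \<inter> H - {y}"] X(3,4) by simp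
      then have "d R' (X \<inter> H) \<le> d R' {y} - gap k"
        by (intro gap) (use X(3) yX yH y1 n in auto)
      moreover have "d RG G \<le> d R' (X \<inter> H)" by (rule H(8)) (use yX yH in auto)
      ultimately show False using u y1 by linarith
    qed
    ultimately show "d R' B \<le> d R' X"
      using H(9)[OF X(2)] yX dD[of "X \<inter> D"] dD[OF BD] by simp
  qed (use BD finD in \<open>auto intro: finite_subset\<close>)
  moreover have "d R' (D \<union> H) = d R D - u"
  proof -
    have "(D \<union> H) \<inter> D = D" "(D \<union> H) \<inter> H = H" by (simp_all add: Int_absorb1)
    then show ?thesis using H(9)[of "D \<union> H"] D(3) dD[of D] H(6) u(1) by simp
  qed
  moreover have "card (D \<union> H) \<le> card D + card G" using card_Un_le[of D H] H(5) by simp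
  ultimately show thesis using that[of "D \<union> H" R'] H(4) by blast
qed

text \<open>A shrink step is possible as long as some point of \<open>B - A\<close> lies only in
  sets at least \<open>u\<close> above \<open>A\<close>. Each step takes \<open>u\<close> from the
  rank of \<open>D\<close>, which cannot fall below that of \<open>A\<close>, so \<open>j\<close>
  bounds the number of steps and the size of \<open>D'\<close>.\<close>

lemma shrink_iter:
  fixes D :: "nat set"
  assumes G: "rooted G RG x" and u: "u = 1 - d RG G" "0 < u" "u < gap k"
  shows "K D R \<Longrightarrow> strong L \<alpha> A D R \<Longrightarrow> closed_in k B D R \<Longrightarrow> d R D \<le> d R A + real j * u \<Longrightarrow>
    \<exists>D' R'. K D' R' \<and> D \<subseteq> D' \<and> agree L D R R' \<and> strong L \<alpha> A D' R' \<and> closed_in k B D' R' \<and>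
      card D' \<le> card D + j * card G \<and>
      (\<forall>y\<in>B - A. \<exists>X. y \<in> X \<and> A \<subseteq> X \<and> X \<subseteq> D' \<and> d R' X < d R' A + u)"
proof (induction j arbitrary: D R)
  case (0 D R)
  have BD: "B \<subseteq> D" and AD: "A \<subseteq> D" using 0 unfolding closed_in_def strong_def by auto
  have "\<exists>X. y \<in> X \<and> A \<subseteq> X \<and> X \<subseteq> D \<and> d R X < d R A + u" if "y \<in> B - A" for y
    by (rule exI[of _ D]) (use that BD AD 0(4) u(2) in auto)
  then show ?case using 0(1-3) by (intro exI[of _ D] exI[of _ R] conjI) auto
next
  case (Suc j D R)
  have BD: "B \<subseteq> D" and AD: "A \<subseteq> D" using Suc.prems(2,3) unfolding closed_in_def strong_def by auto
  show ?case
  proof (cases "\<forall>y\<in>B - A. \<exists>X. y \<in> X \<and> A \<subseteq> X \<and> X \<subseteq> D \<and> d R X < d R A + u")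
    case True
    then show ?thesis using Suc.prems(1-3) by (intro exI[of _ D] exI[of _ R] conjI) auto
  next
    case False
    then obtain y where y: "y \<in> B" "y \<notin> A"
      and low: "\<And>X. y \<in> X \<Longrightarrow> A \<subseteq> X \<Longrightarrow> X \<subseteq> D \<Longrightarrow> d R A + u \<le> d R X" by fastforce
    have yD: "y \<in> D" using y(1) BD by blast
    obtain D1 R1 where D1: "K D1 R1" "D \<subseteq> D1" "agree L D R R1" "strong L \<alpha> A D1 R1" "closed_in k B D1 R1"
      "d R1 D1 = d R D - u" "card D1 \<le> card D + card G"
      using shrink_step[OF G u Suc.prems(1,2) yD y(2) low y(1) Suc.prems(3)] by blast
    have "d R1 A = d R A" using delta_agree[OF agree_subset[OF D1(3) AD]] by simp
    then have "d R1 D1 \<le> d R1 A + real j * u" using D1(6) Suc.prems(4) by (simp add: algebra_simps)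
    then obtain D' R' where D': "K D' R'" "D1 \<subseteq> D'" "agree L D1 R1 R'" "strong L \<alpha> A D' R'" "closed_in k B D' R'"
      "card D' \<le> card D1 + j * card G"
      "\<forall>y\<in>B - A. \<exists>X. y \<in> X \<and> A \<subseteq> X \<and> X \<subseteq> D' \<and> d R' X < d R' A + u"
      using Suc.IH[OF D1(1,4,5)] by blast
    have "agree L D R R'" by (rule agree_trans[OF D1(3) agree_subset[OF D'(3) D1(2)]])
    moreover have "D \<subseteq> D'" using D1(2) D'(2) by blast
    moreover have "card D' \<le> card D + Suc j * card G" using D1(7) D'(6) by simp
    ultimately show ?thesis using D' by (intro exI[of _ D'] exI[of _ R'] conjI)
  qed
qed

text \<open>The excess over \<open>A\<close> is subadditive: the intersections in the submodular
  inequality contain \<open>A\<close>, so by strongness they have at least its rank.\<close>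

lemma delta_UN_le:
  assumes D: "K D R" "strong L \<alpha> A D R" and "finite F"
    and Z: "\<And>y. y \<in> F \<Longrightarrow> A \<subseteq> Z y \<and> Z y \<subseteq> D \<and> d R (Z y) < d R A + u"
  shows "d R (A \<union> (\<Union>y\<in>F. Z y)) \<le> d R A + real (card F) * u"
  using assms(3) Z
proof (induction F rule: finite_induct)
  case (insert a F)
  let ?W = "A \<union> (\<Union>y\<in>F. Z y)"
  have AD: "A \<subseteq> D" using D(2) unfolding strong_def by blast
  have W: "?W \<subseteq> D" using AD insert.prems by (simp add: UN_subset_iff)
  have Za: "A \<subseteq> Z a" "Z a \<subseteq> D" "d R (Z a) < d R A + u" using insert.prems by auto
  have "d R (?W \<union> Z a) + d R (?W \<inter> Z a) \<le> d R ?W + d R (Z a)"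
    by (rule submodular) (use W Za(2) in_K_finite[OF D(1)] in \<open>auto intro: finite_subset\<close>)
  moreover have "d R A \<le> d R (?W \<inter> Z a)"
  proof -
    have "A \<subseteq> ?W \<inter> Z a" "?W \<inter> Z a \<subseteq> D" using Za(1,2) by auto
    then show ?thesis using D(2) unfolding strong_def by simp
  qed
  moreover have "d R ?W \<le> d R A + real (card F) * u" by (rule insert.IH) (use insert.prems in auto)
  moreover have "A \<union> (\<Union>y\<in>insert a F. Z y) = ?W \<union> Z a" by auto
  ultimately show ?case using Za(3) insert.hyps by (simp add: algebra_simps)
qed simp

text \<open>The extension axiom alone gives no closed image. So \<open>B\<close> is first enlarged
  to \<open>D\<close>, where it lies in a set \<open>W\<close> whose rank is within
  \<open>gap k\<close> of that of \<open>A\<close>. A superset \<open>F\<close> of the image of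
  \<open>B\<close> violating \<open>k\<close>-closedness would drop by at least
  \<open>gap k\<close>; its union with the image of \<open>W\<close> would then fall below the image
  of \<open>A\<close>, which is \<open>m\<close>-closed.\<close>

lemma model_extend_closed:
  assumes mod: "model_S L ar \<alpha> M R" and inc: "\<not> coherent L \<alpha>"
  shows "\<exists>m. \<forall>(B :: nat set) RB A f. K B RB \<longrightarrow> strong L \<alpha> A B RB \<longrightarrow> emb A RB M R f \<longrightarrow>
    closed_in m (f ` A) M R \<longrightarrow> card (B - A) \<le> n \<longrightarrow>
    (\<exists>g. emb B RB M R g \<and> (\<forall>x\<in>A. g x = f x) \<and> closed_in k (g ` B) M R)"
proof -
  \<comment> \<open>\<open>W\<close> is a union of at most \<open>n\<close> sets with excess below
    \<open>u\<close>, which needs \<open>n * u\<close> below \<open>gap k\<close>; a single shrink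
    step needs \<open>u\<close> itself below it.\<close>
  have "0 < gap k / (real n + 1)" using gap_pos by simp
  then obtain G :: "nat set" and RG x where G: "rooted G RG x" "1 - gap k / (real n + 1) < d RG G" "d RG G < 1"
    using gadget_small[OF inc] by metis
  define u where "u = 1 - d RG G"
  have u: "0 < u" "(real n + 1) * u < gap k" using G(2,3) unfolding u_def by (auto simp: field_simps)
  have "0 \<le> real n * u" using u(1) by simp
  moreover have "(real n + 1) * u = real n * u + u" by (simp add: algebra_simps)
  ultimately have nu: "real n * u < gap k" and uk: "u < gap k" using u by linarith+
  \<comment> \<open>At most \<open>n\<close> points raise the rank by at most \<open>n\<close>, so
    \<open>J\<close> steps of size \<open>u\<close> exhaust the excess of \<open>B\<close> over
    \<open>A\<close>.\<close>
  obtain J :: nat where "real n / u \<le> real J" using real_arch_simple by blast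
  then have J: "real n \<le> real J * u" using u(1) by (simp add: field_simps)
  \<comment> \<open>\<open>n + J * card G\<close> bounds the points of \<open>D - A\<close>, and
    \<open>k\<close> those of the violating set outside the image of \<open>B\<close>.\<close>
  define m where "m = n + J * card G + k"
  show ?thesis
  proof (intro exI[of _ m] allI impI)
    fix B :: "nat set" and RB A f
    assume KB: "K B RB" and AB: "strong L \<alpha> A B RB" and f: "emb A RB M R f"
      and cl: "closed_in m (f ` A) M R" and n: "card (B - A) \<le> n"
    have AsB: "A \<subseteq> B" using AB unfolding strong_def by blast
    have finB: "finite B" using in_K_finite[OF KB] .
    have BB: "closed_in k B B RB" unfolding closed_in_def using finB by auto
    have dB: "d RB B \<le> d RB A + real J * u" using delta_le_add_card[OF finB AsB, of RB] n J by linarith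
    obtain D RD where D: "K D RD" "B \<subseteq> D" "agree L B RB RD" "strong L \<alpha> A D RD" "closed_in k B D RD"
      "card D \<le> card B + J * card G"
      "\<forall>y\<in>B - A. \<exists>X. y \<in> X \<and> A \<subseteq> X \<and> X \<subseteq> D \<and> d RD X < d RD A + u"
      using shrink_iter[OF G(1) u_def u(1) uk KB AB BB dB] by blast
    obtain Z where Z: "\<And>y. y \<in> B - A \<Longrightarrow> y \<in> Z y \<and> A \<subseteq> Z y \<and> Z y \<subseteq> D \<and> d RD (Z y) < d RD A + u"
      using D(7) by metis
    define W where "W = A \<union> (\<Union>y\<in>B - A. Z y)"
    have AD: "A \<subseteq> D" using AsB D(2) by blast
    have finD: "finite D" using in_K_finite[OF D(1)] .
    have WD: "W \<subseteq> D" unfolding W_def using Z AD by (simp add: UN_subset_iff)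
    have BW: "B \<subseteq> W" unfolding W_def using Z by auto
    have dW: "d RD W < d RD A + gap k"
    proof -
      have "d RD W \<le> d RD A + real (card (B - A)) * u"
        unfolding W_def by (rule delta_UN_le[OF D(1,4)]) (use finB Z in auto)
      moreover have "real (card (B - A)) * u \<le> real n * u" using n u(1) by (intro mult_right_mono) auto
      ultimately show ?thesis using nu by linarith
    qed
    have fD: "emb A RD M R f" by (rule embedding_agree[OF f agree_subset[OF D(3) AsB] agree_refl])
    obtain g where g: "emb D RD M R g" "\<And>x. x \<in> A \<Longrightarrow> g x = f x" using model_extend[OF mod D(1,4) fD] by metis
    have inj: "inj_on g D" using g(1) unfolding embedding_def by blast
    have gM: "g ` D \<subseteq> M" using g(1) unfolding embedding_def by blast
    have gB: "emb B RB M R g"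
      by (rule embedding_agree[OF embedding_subset[OF g(1) D(2)] agree_sym[OF D(3)] agree_refl])
    have fA: "f ` A = g ` A" using g(2) by auto
    have dg: "d R (g ` X) = d RD X" if "X \<subseteq> D" for X by (rule delta_embedding[OF g(1) that])
    let ?P = "g ` W" and ?Q = "g ` B"
    have "closed_in k ?Q M R" unfolding closed_in_def
    proof (intro conjI allI impI)
      fix F assume "?Q \<subseteq> F \<and> F \<subseteq> M \<and> finite F \<and> card (F - ?Q) \<le> k"
      then have F: "?Q \<subseteq> F" "F \<subseteq> M" "finite F" "card (F - ?Q) \<le> k" by auto
      show "d R ?Q \<le> d R F"
      proof (rule ccontr)
        assume "\<not> ?thesis"
        then have "d R F < d R ?Q" by simp
        then have gapF: "d R F \<le> d R ?Q - gap k" by (rule gap[OF F(3,1,4)])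
        obtain Y where Y: "Y \<subseteq> W" "F \<inter> ?P = g ` Y" by (metis inf_le2 subset_imageE)
        have YD: "Y \<subseteq> D" using Y(1) WD by blast
        have "?Q \<subseteq> g ` Y" using F(1) BW Y(2) by blast
        then have BY: "B \<subseteq> Y" using inj_on_image_subset_iff[OF inj D(2) YD] by simp
        have "g ` (Y - B) = g ` Y - ?Q" by (rule inj_on_image_set_diff[OF inj]) (use YD D(2) in auto)
        also have "\<dots> \<subseteq> F - ?Q" using Y(2) by blast
        finally have "card (g ` (Y - B)) \<le> card (F - ?Q)" using F(3) by (intro card_mono) auto
        moreover have "card (g ` (Y - B)) = card (Y - B)"
          by (rule card_image[OF inj_on_subset[OF inj]]) (use YD in blast)
        ultimately have "card (Y - B) \<le> k" using F(4) by simp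
        then have "d RD B \<le> d RD Y" by (rule closed_inD[OF D(5) BY YD finite_subset[OF YD finD]])
        then have "d R ?Q \<le> d R (F \<inter> ?P)" unfolding Y(2) dg[OF YD] dg[OF D(2)] .
        moreover have "d R (F \<union> ?P) + d R (F \<inter> ?P) \<le> d R F + d R ?P"
          by (rule submodular) (use F(3) WD finD in \<open>auto intro: finite_subset\<close>)
        moreover have "d R ?P < d R (f ` A) + gap k" unfolding fA dg[OF WD] dg[OF AD] by (rule dW)
        ultimately have lt: "d R (F \<union> ?P) < d R (f ` A)" using gapF by linarith
        have "F \<union> ?P - f ` A \<subseteq> g ` (D - A) \<union> (F - ?Q)"
        proof
          fix z assume z: "z \<in> F \<union> ?P - f ` A"
          show "z \<in> g ` (D - A) \<union> (F - ?Q)"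
          proof (cases "z \<in> g ` D")
            case True
            then show ?thesis using z unfolding fA by blast
          next
            case False
            then show ?thesis using z WD D(2) by blast
          qed
        qed
        then have "card (F \<union> ?P - f ` A) \<le> card (g ` (D - A) \<union> (F - ?Q))"
          using finD F(3) by (intro card_mono) auto
        also have "\<dots> \<le> card (D - A) + k"
          using card_Un_le[of "g ` (D - A)" "F - ?Q"] card_image_le[of "D - A" g] finD F(4) by simp
        also have "card (D - A) \<le> n + J * card G"
        proof -
          have "card (D - A) = card D - card A" "card (B - A) = card B - card A" "card A \<le> card B"
            using AD AsB finD finB by (auto intro: card_Diff_subset card_mono finite_subset)
          then show ?thesis using D(6) n by linarith
        qed
        finally have "card (F \<union> ?P - f ` A) \<le> m" unfolding m_def by simp
        moreover have "f ` A \<subseteq> F \<union> ?P" unfolding fA using AsB BW by blast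
        moreover have "F \<union> ?P \<subseteq> M" using F(2) gM WD by blast
        moreover have "finite (F \<union> ?P)" using F(3) WD finD by (auto intro: finite_subset)
        ultimately have "d R (f ` A) \<le> d R (F \<union> ?P)" by (intro closed_inD[OF cl])
        then show False using lt by linarith
      qed
    qed (use gM D(2) finB in auto)
    then show "\<exists>g. emb B RB M R g \<and> (\<forall>x\<in>A. g x = f x) \<and> closed_in k (g ` B) M R"
      using gB g(2) by blast
  qed
qed

text \<open>Greedy closure: a failure of closedness supplies at most \<open>k\<close> points that
  lower the rank by at least \<open>gap k\<close>. A lower bound on ranks then excludes
  \<open>j = J\<close> for large \<open>J\<close>, which leaves a closed set of bounded
  size.\<close>

lemma closure_chain:
  assumes "finite X0" "X0 \<subseteq> M"
  shows "\<exists>X j. X0 \<subseteq> X \<and> X \<subseteq> M \<and> finite X \<and> card (X - X0) \<le> k * j \<and> d R X \<le> d R X0 - gap k * real j \<and>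
    j \<le> J \<and> (j = J \<or> closed_in k X M R)"
proof (induction J)
  case 0
  show ?case by (rule exI[of _ X0], rule exI[of _ 0]) (use assms in auto)
next
  case (Suc J)
  then obtain X j where X: "X0 \<subseteq> X" "X \<subseteq> M" "finite X" "card (X - X0) \<le> k * j"
    "d R X \<le> d R X0 - gap k * real j" "j \<le> J" "j = J \<or> closed_in k X M R" by blast
  show ?case
  proof (cases "closed_in k X M R")
    case True
    show ?thesis by (rule exI[of _ X], rule exI[of _ j]) (use X True in auto)
  next
    case False
    then obtain Y where Y: "X \<subseteq> Y" "Y \<subseteq> M" "finite Y" "card (Y - X) \<le> k" "d R Y < d R X"
      using X(2,3) unfolding closed_in_def by (auto simp: not_le)
    have "d R Y \<le> d R X - gap k" by (rule gap[OF Y(3,1,4,5)])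
    then have "d R Y \<le> d R X0 - gap k * real (Suc j)" using X(5) by (simp add: algebra_simps)
    moreover have "card (Y - X0) \<le> k * Suc j"
    proof -
      have "card (Y - X0) \<le> card ((Y - X) \<union> (X - X0))" using Y(3) X(3) by (intro card_mono) auto
      also have "\<dots> \<le> card (Y - X) + card (X - X0)" by (rule card_Un_le)
      finally show ?thesis using X(4) Y(4) by simp
    qed
    moreover have "Suc j = Suc J" using X(7) False by simp
    ultimately show ?thesis using X(1) Y(1-3) by (intro exI[of _ Y] exI[of _ "Suc j"]) auto
  qed
qed

text \<open>Adding \<open>c\<close> raises the rank of \<open>C\<close> by at most 1, and
  \<open>n\<close>-closedness keeps the closure from falling below \<open>C\<close>. So fewer than
  \<open>J\<close> drops of size \<open>gap k\<close> occur, the closure \<open>X\<close> adds at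
  most \<open>n = 1 + k * J\<close> points, and \<open>C\<close> is strong in it.\<close>

lemma closed_forth:
  fixes M :: "'a set"
  assumes mod: "model_S L ar \<alpha> M R" and inc: "\<not> coherent L \<alpha>"
  shows "\<exists>m. \<forall>C f c. emb C R M R f \<longrightarrow> closed_in m C M R \<longrightarrow> closed_in m (f ` C) M R \<longrightarrow> c \<in> M \<longrightarrow>
    (\<exists>D g. C \<subseteq> D \<and> c \<in> D \<and> emb D R M R g \<and> closed_in k D M R \<and> closed_in k (g ` D) M R \<and> (\<forall>x\<in>C. g x = f x))"
proof -
  obtain J :: nat where "1 / gap k < real J" using reals_Archimedean2 by blast
  then have J: "1 < gap k * real J" using gap_pos[of k] by (simp add: field_simps)
  define n where "n = 1 + k * J"
  obtain m0 where m0: "\<And>(B :: nat set) RB A f. K B RB \<Longrightarrow> strong L \<alpha> A B RB \<Longrightarrow> emb A RB M R f \<Longrightarrow>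
    closed_in m0 (f ` A) M R \<Longrightarrow> card (B - A) \<le> n \<Longrightarrow>
    \<exists>g. emb B RB M R g \<and> (\<forall>x\<in>A. g x = f x) \<and> closed_in k (g ` B) M R"
    using model_extend_closed[OF mod inc, of n k] by blast
  show ?thesis
  proof (intro exI[of _ "max m0 n"] allI impI)
    fix C f c
    assume f: "emb C R M R f" and cl: "closed_in (max m0 n) C M R" "closed_in (max m0 n) (f ` C) M R" and c: "c \<in> M"
    have C: "C \<subseteq> M" "finite C" using cl(1) unfolding closed_in_def by auto
    have cln: "closed_in n C M R" by (rule closed_in_le[OF cl(1)]) simp
    have cC: "finite (insert c C)" "insert c C \<subseteq> M" using C c by auto
    obtain X j where X: "insert c C \<subseteq> X" "X \<subseteq> M" "finite X" "card (X - insert c C) \<le> k * j"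
      "d R X \<le> d R (insert c C) - gap k * real j" "j \<le> J" "j = J \<or> closed_in k X M R"
      using closure_chain[OF cC, of k R J] by blast
    have CX: "C \<subseteq> X" using X(1) by blast
    have card1: "card (insert c C - C) \<le> 1" using card_mono[of "{c}" "insert c C - C"] by auto
    have "card (X - C) \<le> card ((insert c C - C) \<union> (X - insert c C))" using X(3) C(2) by (intro card_mono) auto
    also have "\<dots> \<le> card (insert c C - C) + card (X - insert c C)" by (rule card_Un_le)
    also have "\<dots> \<le> 1 + k * J" using card1 X(4,6) by (meson add_mono le_trans mult_le_mono2)
    finally have XC: "card (X - C) \<le> n" unfolding n_def .
    have st: "strong L \<alpha> C X R" unfolding strong_def
    proof (intro conjI allI impI)
      fix Y assume Y: "C \<subseteq> Y \<and> Y \<subseteq> X"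
      then have "card (Y - C) \<le> card (X - C)" using X(3) by (intro card_mono) auto
      then show "d R C \<le> d R Y"
        by (intro closed_inD[OF cln]) (use Y XC X(2,3) in \<open>auto intro: finite_subset\<close>)
    qed (rule CX)
    have "d R C \<le> d R X" using st CX unfolding strong_def by blast
    moreover have "d R (insert c C) \<le> d R C + 1"
      using delta_le_add_card[OF cC(1) subset_insertI, of R] card1 by linarith
    ultimately have "gap k * real j \<le> 1" using X(5) by linarith
    then have "j \<noteq> J" using J by auto
    then have clX: "closed_in k X M R" using X(7) by blast
    \<comment> \<open>Extension axioms speak of structures on naturals, so \<open>X\<close> is
      copied there and the resulting map is composed back.\<close>
    define h where "h = to_nat_on X"
    have inj: "inj_on h X" unfolding h_def using X(3) by (intro inj_on_to_nat_on countable_finite)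
    let ?B = "h ` X" and ?A = "h ` C" and ?RB = "push h X R"
    have hX: "emb X R ?B ?RB h" by (rule embedding_push[OF inj])
    have KB: "K ?B ?RB"
      by (rule in_K_push[OF model_str[OF mod] X(3) inj])
        (rule model_nonneg[OF mod], use X(2,3) in \<open>auto intro: finite_subset\<close>)
    have sB: "strong L \<alpha> ?A ?B ?RB" unfolding strong_def
    proof (intro conjI allI impI)
      fix Y assume Y: "?A \<subseteq> Y \<and> Y \<subseteq> ?B"
      then obtain Y' where Y': "Y' \<subseteq> X" "Y = h ` Y'" by (metis subset_imageE)
      then have "C \<subseteq> Y'" using Y inj_on_image_subset_iff[OF inj CX Y'(1)] by simp
      then have "d R C \<le> d R Y'" using st Y'(1) unfolding strong_def by blast
      then show "d ?RB ?A \<le> d ?RB Y" unfolding Y'(2) delta_embedding[OF hX CX] delta_embedding[OF hX Y'(1)] .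
    qed (use CX in blast)
    define i where "i = inv_into X h"
    have ih: "i (h z) = z" if "z \<in> X" for z unfolding i_def using inj that by simp
    have "emb ?B ?RB X R i" unfolding i_def by (rule embedding_inv[OF hX])
    then have "emb ?A ?RB X R i" by (rule embedding_subset) (use CX in blast)
    then have "emb ?A ?RB (i ` ?A) R i" by (rule embedding_restrict)
    moreover have iA: "i ` ?A = C" using ih CX by (force simp: image_iff)
    ultimately have "emb ?A ?RB C R i" by simp
    then have fi: "emb ?A ?RB M R (f \<circ> i)" by (rule embedding_comp[OF _ f])
    have "(f \<circ> i) ` ?A = f ` C" unfolding image_comp[symmetric] iA ..
    then have clA: "closed_in m0 ((f \<circ> i) ` ?A) M R" using closed_in_le[OF cl(2)] by simp
    have "?B - ?A = h ` (X - C)" using inj_on_image_set_diff[OF inj, of X C] CX by auto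
    then have "card (?B - ?A) \<le> n" using card_image_le[of "X - C" h] X(3) XC by simp
    then obtain g where g: "emb ?B ?RB M R g" "\<forall>x\<in>?A. g x = (f \<circ> i) x" "closed_in k (g ` ?B) M R"
      using m0[OF KB sB fi clA] by blast
    have "emb X R M R (g \<circ> h)" by (rule embedding_comp[OF hX g(1)])
    moreover have "closed_in k ((g \<circ> h) ` X) M R" using g(3) unfolding image_comp .
    moreover have "(g \<circ> h) x = f x" if "x \<in> C" for x using g(2) that ih CX by auto
    ultimately show "\<exists>D g. C \<subseteq> D \<and> c \<in> D \<and> emb D R M R g \<and> closed_in k D M R \<and> closed_in k (g ` D) M R \<and>
        (\<forall>x\<in>C. g x = f x)"
      using CX X(1) clX by (intro exI[of _ X] exI[of _ "g \<circ> h"]) auto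
  qed
qed

lemma closed_preserves:
  fixes M :: "'a set"
  assumes mod: "model_S L ar \<alpha> M R" and inc: "\<not> coherent L \<alpha>" and "symbs \<phi> \<subseteq> L"
  shows "\<exists>m. \<forall>C f v. emb C R M R f \<longrightarrow> closed_in m C M R \<longrightarrow> closed_in m (f ` C) M R \<longrightarrow> v ` fv \<phi> \<subseteq> C \<longrightarrow>
    sat ar M R v \<phi> = sat ar M R (f \<circ> v) \<phi>"
proof -
  define I where "I m C f \<longleftrightarrow> emb C R M R f \<and> closed_in m C M R \<and> closed_in m (f ` C) M R"
    for m C and f :: "'a \<Rightarrow> 'a"
  have "\<exists>m. \<forall>C f v. I m C f \<longrightarrow> v ` fv \<phi> \<subseteq> C \<longrightarrow> sat ar M R v \<phi> = sat ar M R (f \<circ> v) \<phi>"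
  proof (rule back_and_forth[where I=I])
    show "C \<subseteq> M \<and> emb C R M R f" if "I k C f" for k C f using that unfolding I_def closed_in_def by blast
    show "I k C f" if "I m C f" "k \<le> m" for k m C f using that closed_in_le unfolding I_def by blast
    show "\<exists>m. \<forall>C f c. I m C f \<longrightarrow> c \<in> M \<longrightarrow> (\<exists>D g. C \<subseteq> D \<and> c \<in> D \<and> I k D g \<and> (\<forall>x\<in>C. g x = f x))" for k
    proof -
      obtain m where m: "\<And>C f c. emb C R M R f \<Longrightarrow> closed_in m C M R \<Longrightarrow> closed_in m (f ` C) M R \<Longrightarrow> c \<in> M \<Longrightarrow>
        \<exists>D g. C \<subseteq> D \<and> c \<in> D \<and> emb D R M R g \<and> closed_in k D M R \<and> closed_in k (g ` D) M R \<and> (\<forall>x\<in>C. g x = f x)"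
        using closed_forth[OF mod inc, of k] by blast
      show ?thesis
      proof (intro exI[of _ m] allI impI)
        fix C f c assume "I m C f" "c \<in> M"
        then obtain D g where "C \<subseteq> D" "c \<in> D" "emb D R M R g" "closed_in k D M R" "closed_in k (g ` D) M R"
          "\<forall>x\<in>C. g x = f x" using m[of C f c] unfolding I_def by blast
        then show "\<exists>D g. C \<subseteq> D \<and> c \<in> D \<and> I k D g \<and> (\<forall>x\<in>C. g x = f x)"
          unfolding I_def by (intro exI[of _ D] exI[of _ g]) simp
      qed
    qed
    show "I k (f ` C) (inv_into C f)" if I: "I k C f" for k C f
    proof -
      have C: "emb C R M R f" "closed_in k C M R" "closed_in k (f ` C) M R" using I unfolding I_def by auto
      have "C \<subseteq> M" using C(2) unfolding closed_in_def by blast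
      then have "emb (f ` C) R M R (inv_into C f)" by (rule embedding_mono[OF embedding_inv[OF C(1)]])
      moreover have "inv_into C f ` f ` C = C" using C(1) unfolding embedding_def by simp
      ultimately show ?thesis unfolding I_def using C(2,3) by simp
    qed
    show "symbs \<phi> \<subseteq> L" by (rule assms(3))
  qed
  then show ?thesis unfolding I_def by blast
qed

text \<open>A finite A in M that contains edges of every symbol has an m-closed hull C of positive rank.
  Gluing a small gadget to C gives D, and C itself and D both have copies in M whose C-parts are
  m-closed; only the second one realises D over A.\<close>
lemma atomic_coherent:
  fixes M :: "'a set"
  assumes mod: "model_S L ar \<alpha> M R" and atom: "atomic_structure L ar M R"
  shows "coherent L \<alpha>"
proof (rule ccontr)
  assume inc: "\<not> coherent L \<alpha>"
  note strM = model_str[OF mod] and nnM = model_nonneg[OF mod]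
  have empty_emb: "emb {} RB M R f" if "str B RB" for B :: "nat set" and RB f
  proof -
    have "{} \<notin> RB E" "{} \<notin> R E" if "E \<in> L" for E
      using \<open>str B RB\<close> strM ar2[OF that] that unfolding sym_structure_def by fastforce+
    then show ?thesis unfolding embedding_def by auto
  qed
  have empty_closed: "closed_in k {} M R" for k
    unfolding closed_in_def using delta_empty[OF strM] nnM by simp
  have empty_strong: "strong L \<alpha> {} B RB" if B: "K B RB" for B :: "nat set" and RB
    unfolding strong_def using delta_empty[OF in_K_str[OF B]] in_K_delta_nonneg[OF B] by simp
  obtain l :: "'r \<Rightarrow> nat" where
    l: "\<And>c :: 'r \<Rightarrow> nat. \<exists>(G :: nat set) R x. rooted G R x \<and> d R G < 1 \<and> (\<forall>E\<in>L. NE R E G = l E + c E)"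
    using rooted_counts by blast
  \<comment> \<open>Asking for one edge beyond \<open>l E\<close> makes every symbol occur in
    \<open>A\<close>; otherwise a rank 0 hull would give a relation with vanishing
    coefficients.\<close>
  obtain Z :: "nat set" and RZ z where Z: "rooted Z RZ z" "\<forall>E\<in>L. NE RZ E Z = l E + 1"
    using l[of "\<lambda>_. 1"] by blast
  have KZ: "K Z RZ" using Z(1) unfolding rooted_def by blast
  obtain e where e: "emb Z RZ M R e"
    using model_extend[OF mod KZ empty_strong[OF KZ] empty_emb[OF in_K_str[OF KZ]]] by metis
  define A where "A = e ` Z"
  have A: "finite A" "A \<subseteq> M" using in_K_finite[OF KZ] e unfolding A_def embedding_def by auto
  have NEA: "0 < NE R E A" if "E \<in> L" for E
    unfolding A_def using NE_embedding[OF e order_refl that] Z(2) that by simp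
  define n where "n = card A"
  define v where "v = from_nat_into A"
  have "bij_betw v {..<n} A" unfolding n_def v_def by (rule bij_betw_from_nat_into_finite[OF A(1)])
  then have vA: "v ` {..<n} = A" unfolding bij_betw_def by blast
  then have "isolated_type L ar M R n v" using atom A(2) unfolding atomic_structure_def by blast
  then obtain \<phi> where \<phi>: "symbs \<phi> \<subseteq> L" "fv \<phi> \<subseteq> {..<n}" "sat ar M R v \<phi>"
    and decides: "\<forall>\<psi>. symbs \<psi> \<subseteq> L \<and> fv \<psi> \<subseteq> {..<n} \<longrightarrow>
       (\<forall>w. w ` {..<n} \<subseteq> M \<and> sat ar M R w \<phi> \<longrightarrow> sat ar M R w \<psi>) \<or>
       (\<forall>w. w ` {..<n} \<subseteq> M \<and> sat ar M R w \<phi> \<longrightarrow> \<not> sat ar M R w \<psi>)"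
    unfolding isolated_type_def by (elim exE conjE)
  obtain m where m: "\<And>C f v. emb C R M R f \<Longrightarrow> closed_in m C M R \<Longrightarrow> closed_in m (f ` C) M R \<Longrightarrow>
    v ` fv \<phi> \<subseteq> C \<Longrightarrow> sat ar M R v \<phi> = sat ar M R (f \<circ> v) \<phi>"
    using closed_preserves[OF mod inc \<phi>(1)] by blast
  obtain J :: nat where "d R A / gap m < real J" using reals_Archimedean2 by blast
  then have J: "d R A < gap m * real J" using gap_pos[of m] by (simp add: field_simps)
  obtain X j where X: "A \<subseteq> X" "X \<subseteq> M" "finite X" "d R X \<le> d R A - gap m * real j" "j = J \<or> closed_in m X M R"
    using closure_chain[OF A, of m R J] by blast
  have "j \<noteq> J" using X(4) J nnM[OF X(3,2)] by auto
  then have clX: "closed_in m X M R" using X(5) by blast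
  \<comment> \<open>Passing from the closed set \<open>X\<close> to a set of least rank between
    \<open>A\<close> and \<open>X\<close> keeps closedness by submodularity. Minimality over
    \<open>A\<close> is essential at the end, where the copy of \<open>D\<close> is known to contain
    only the image of \<open>A\<close>, not that of \<open>C\<close>.\<close>
  let ?S = "{Y. A \<subseteq> Y \<and> Y \<subseteq> X}"
  have "finite ?S" using X(3) by (intro finite_subset[of ?S "Pow X"]) auto
  moreover have "?S \<noteq> {}" using X(1) by blast
  ultimately obtain C where C: "A \<subseteq> C" "C \<subseteq> X" and Cmin: "\<And>Y. A \<subseteq> Y \<Longrightarrow> Y \<subseteq> X \<Longrightarrow> d R C \<le> d R Y"
    using finite_min_ex[of ?S "d R"] by auto
  have finC: "finite C" using C(2) X(3) by (rule finite_subset)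
  have CM: "C \<subseteq> M" using C(2) X(2) by blast
  have clC: "closed_in m C M R" unfolding closed_in_def
  proof (intro conjI allI impI)
    fix F assume "C \<subseteq> F \<and> F \<subseteq> M \<and> finite F \<and> card (F - C) \<le> m"
    then have F: "C \<subseteq> F" "F \<subseteq> M" "finite F" "card (F - C) \<le> m" by auto
    have "card (F \<union> X - X) \<le> card (F - C)" using F(3) C(2) by (intro card_mono) auto
    then have "d R X \<le> d R (F \<union> X)"
      by (intro closed_inD[OF clX]) (use F X in auto)
    moreover have "d R (F \<union> X) + d R (F \<inter> X) \<le> d R F + d R X" by (rule submodular[OF F(3) X(3)])
    moreover have "d R C \<le> d R (F \<inter> X)" by (rule Cmin) (use C F(1) in auto)
    ultimately show "d R C \<le> d R F" by linarith
  qed (rule CM finC)+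
  have dC: "0 < d R C"
  proof -
    have "d R C \<noteq> 0"
    proof
      assume "d R C = 0"
      then have "(\<Sum>E\<in>L. real (NE R E C) * \<alpha> E) = real (card C)" unfolding delta_def by (simp add: mult.commute)
      then have "(\<Sum>E\<in>L. real (NE R E C) * \<alpha> E) \<in> \<rat>" by simp
      moreover have "0 < NE R E C" if "E \<in> L" for E
        using NEA[OF that] NE_mono[OF finC C(1), of R E] by linarith
      ultimately have "coherent L \<alpha>" unfolding coherent_def
        by (intro exI[of _ "\<lambda>E. NE R E C"] conjI ballI)
      then show False using inc by contradiction
    qed
    then show ?thesis using nnM[OF finC CM] by simp
  qed
  define h where "h = to_nat_on C"
  have inj: "inj_on h C" unfolding h_def using finC by (intro inj_on_to_nat_on countable_finite)
  define CN where "CN = h ` C"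
  define RC where "RC = push h C R"
  have hC: "emb C R CN RC h" unfolding CN_def RC_def by (rule embedding_push[OF inj])
  have KC: "K CN RC" unfolding CN_def RC_def
    by (rule in_K_push[OF strM finC inj]) (rule nnM, use CM finC in \<open>auto intro: finite_subset\<close>)
  have dCN: "d RC CN = d R C" unfolding CN_def by (rule delta_embedding[OF hC order_refl])
  \<comment> \<open>If every point lay in a set of rank 0, the union \<open>CN\<close> of these sets
    would have rank 0. The gadget must be attached at a point with rank to spare.\<close>
  have "\<exists>y\<in>CN. \<forall>X. y \<in> X \<and> X \<subseteq> CN \<longrightarrow> 0 < d RC X"
  proof (rule ccontr)
    assume "\<not> ?thesis"
    then have "\<forall>y\<in>CN. \<exists>X. y \<in> X \<and> X \<subseteq> CN \<and> d RC X = 0"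
      using in_K_delta_nonneg[OF KC] by (metis less_eq_real_def)
    then obtain Z where Z: "\<And>y. y \<in> CN \<Longrightarrow> y \<in> Z y \<and> Z y \<subseteq> CN \<and> d RC (Z y) = 0" by metis
    have "d RC (\<Union>y\<in>CN. Z y) = 0" by (rule delta_UN_zero[OF KC in_K_finite[OF KC]]) (use Z in blast)
    moreover have "(\<Union>y\<in>CN. Z y) = CN" using Z by blast
    ultimately show False using dC dCN by simp
  qed
  then obtain y where y: "y \<in> CN" "\<And>X. y \<in> X \<Longrightarrow> X \<subseteq> CN \<Longrightarrow> 0 < d RC X" by blast
  let ?T = "{X. y \<in> X \<and> X \<subseteq> CN}"
  have "finite ?T" using in_K_finite[OF KC] by (intro finite_subset[of ?T "Pow CN"]) auto
  moreover have "?T \<noteq> {}" using y(1) by blast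
  ultimately obtain Y0 where Y0: "y \<in> Y0" "Y0 \<subseteq> CN" "\<And>X. y \<in> X \<Longrightarrow> X \<subseteq> CN \<Longrightarrow> d RC Y0 \<le> d RC X"
    using finite_min_ex[of ?T "d RC"] by auto
  \<comment> \<open>A deficit below the least rank around \<open>y\<close> keeps the glued structure
    in the class; one below \<open>gap m\<close> keeps \<open>CN\<close> \<open>m\<close>-closed in
    it.\<close>
  have "0 < min (d RC Y0) (gap m)" using y(2)[OF Y0(1,2)] gap_pos by simp
  then obtain G :: "nat set" and RG x where G: "rooted G RG x" "1 - min (d RC Y0) (gap m) < d RG G" "d RG G < 1"
    using gadget_small[OF inc] by metis
  define u where "u = 1 - d RG G"
  have u: "0 < u" "u < gap m" "u < d RC Y0" using G(2,3) unfolding u_def by auto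
  have yn: "y \<notin> {}" by simp
  have CNCN: "closed_in m CN CN RC" unfolding closed_in_def using in_K_finite[OF KC] by auto
  obtain D RD where D: "K D RD" "CN \<subseteq> D" "agree L CN RC RD" "closed_in m CN D RD" "d RD D = d RC CN - u"
  proof (rule shrink_step[OF G(1) u_def u(1,2) KC empty_strong[OF KC] y(1) yn _ y(1) CNCN])
    show "d RC {} + u \<le> d RC X" if "y \<in> X" "X \<subseteq> CN" for X
      using Y0(3)[OF that] u(3) delta_empty[OF in_K_str[OF KC]] by simp
  qed
  have finD: "finite D" using in_K_finite[OF D(1)] .
  \<comment> \<open>\<open>m\<close> lets the first copy of \<open>C\<close> preserve
    \<open>\<phi>\<close>; \<open>card D\<close> makes it closed against any copy of
    \<open>D\<close>.\<close>
  define k where "k = max m (card D)"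
  obtain g1 where g1: "emb CN RC M R g1" "closed_in k (g1 ` CN) M R"
    using model_extend_closed[OF mod inc, of "card CN" k] KC empty_strong[OF KC]
      empty_emb[OF in_K_str[OF KC]] empty_closed by (metis Diff_empty image_empty order_refl)
  obtain g2 where g2: "emb D RD M R g2" "closed_in m (g2 ` D) M R"
    using model_extend_closed[OF mod inc, of "card D" m] D(1) empty_strong[OF D(1)]
      empty_emb[OF in_K_str[OF D(1)]] empty_closed by (metis Diff_empty image_empty order_refl)
  have g2M: "g2 ` D \<subseteq> M" using g2(1) unfolding embedding_def by blast
  have inj2: "inj_on g2 D" using g2(1) unfolding embedding_def by blast
  \<comment> \<open>Closedness is transitive by submodularity: the union of \<open>F\<close> with
    the image of \<open>D\<close> is controlled by closedness of that image in \<open>M\<close>, the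
    intersection by closedness of \<open>CN\<close> in \<open>D\<close>.\<close>
  have g2C: "closed_in m (g2 ` CN) M R" unfolding closed_in_def
  proof (intro conjI allI impI)
    fix F assume "g2 ` CN \<subseteq> F \<and> F \<subseteq> M \<and> finite F \<and> card (F - g2 ` CN) \<le> m"
    then have F: "g2 ` CN \<subseteq> F" "F \<subseteq> M" "finite F" "card (F - g2 ` CN) \<le> m" by auto
    have sub: "d R (F \<union> g2 ` D) + d R (F \<inter> g2 ` D) \<le> d R F + d R (g2 ` D)"
      by (rule submodular) (use F(3) finD in auto)
    have "card (F \<union> g2 ` D - g2 ` D) \<le> card (F - g2 ` CN)" using F(3) D(2) by (intro card_mono) auto
    then have up: "d R (g2 ` D) \<le> d R (F \<union> g2 ` D)"
      by (intro closed_inD[OF g2(2)]) (use F g2M finD in auto)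
    obtain Y where Y: "Y \<subseteq> D" "F \<inter> g2 ` D = g2 ` Y" by (metis inf_le2 subset_imageE)
    have "g2 ` CN \<subseteq> g2 ` Y" using F(1) D(2) Y(2) by blast
    then have CY: "CN \<subseteq> Y" using inj_on_image_subset_iff[OF inj2 D(2) Y(1)] by simp
    have "g2 ` (Y - CN) = g2 ` Y - g2 ` CN" by (rule inj_on_image_set_diff[OF inj2]) (use Y D(2) in auto)
    also have "\<dots> \<subseteq> F - g2 ` CN" using Y(2) by blast
    finally have "card (g2 ` (Y - CN)) \<le> card (F - g2 ` CN)" using F(3) by (intro card_mono) auto
    moreover have "card (g2 ` (Y - CN)) = card (Y - CN)"
      by (rule card_image[OF inj_on_subset[OF inj2]]) (use Y in blast)
    ultimately have "card (Y - CN) \<le> m" using F(4) by simp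
    then have "d RD CN \<le> d RD Y" by (rule closed_inD[OF D(4) CY Y(1) finite_subset[OF Y(1) finD]])
    then have "d R (g2 ` CN) \<le> d R (F \<inter> g2 ` D)"
      unfolding Y(2) delta_embedding[OF g2(1) Y(1)] delta_embedding[OF g2(1) D(2)] .
    then show "d R (g2 ` CN) \<le> d R F" using sub up by linarith
  qed (use g2M D(2) in_K_finite[OF KC] in auto)
  have g2CN: "emb CN RC M R g2"
    by (rule embedding_agree[OF embedding_subset[OF g2(1) D(2)] agree_sym[OF D(3)] agree_refl])
  have vfv: "v ` fv \<phi> \<subseteq> C" using \<phi>(2) vA C(1) by blast
  define f1 where "f1 = g1 \<circ> h"
  define f2 where "f2 = g2 \<circ> h"
  have f1: "emb C R M R f1" unfolding f1_def by (rule embedding_comp[OF hC g1(1)])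
  have f2: "emb C R M R f2" unfolding f2_def by (rule embedding_comp[OF hC g2CN])
  have f1C: "f1 ` C = g1 ` CN" unfolding f1_def CN_def image_comp ..
  have f2C: "f2 ` C = g2 ` CN" unfolding f2_def CN_def image_comp ..
  have s1: "sat ar M R (f1 \<circ> v) \<phi>"
    using m[OF f1 clC _ vfv] closed_in_le[OF g1(2), of m] \<phi>(3) unfolding f1C k_def by simp
  have s2: "sat ar M R (f2 \<circ> v) \<phi>"
    using m[OF f2 clC _ vfv] g2C \<phi>(3) unfolding f2C by simp
  have w1: "(f1 \<circ> v) ` {..<n} = f1 ` A" unfolding image_comp[symmetric] vA ..
  have w2: "(f2 \<circ> v) ` {..<n} = f2 ` A" unfolding image_comp[symmetric] vA ..
  have w2D: "(f2 \<circ> v) ` {..<n} \<subseteq> g2 ` D" unfolding w2 using C(1) f2C D(2) by blast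
  obtain N v' where v': "n \<le> N" "\<And>i. i < n \<Longrightarrow> v' i = (f2 \<circ> v) i" "v' ` {..<N} = g2 ` D"
    using enumerate_extend[OF finite_imageI[OF finD] w2D] by metis
  have v'M: "v' ` {..<N} \<subseteq> M" using v'(3) g2M by simp
  \<comment> \<open>\<open>\<psi>\<close> asserts a copy of \<open>D\<close> over the tuple. The
    second realisation of \<open>\<phi>\<close> satisfies it, so by isolation the first one must as
    well.\<close>
  obtain \<psi> where \<psi>: "symbs \<psi> \<subseteq> L" "fv \<psi> \<subseteq> {..<n}"
    "\<And>w. w ` {..<n} \<subseteq> M \<Longrightarrow> sat ar M R w \<psi> \<longleftrightarrow>
      (\<exists>f. emb (g2 ` D) R M R f \<and> (\<forall>i<n. f (v' i) = w i))"
    using diagram_formula[OF finite_L strM v'(1) v'M] unfolding v'(3) by blast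
  have w1M: "(f1 \<circ> v) ` {..<n} \<subseteq> M" unfolding w1 using f1 C(1) unfolding embedding_def by blast
  have w2M: "(f2 \<circ> v) ` {..<n} \<subseteq> M" unfolding w2 using f2 C(1) unfolding embedding_def by blast
  have "emb (g2 ` D) R M R id" by (rule embedding_id[OF agree_refl g2M])
  then have "sat ar M R (f2 \<circ> v) \<psi>" unfolding \<psi>(3)[OF w2M] using v'(2) by (intro exI[of _ id]) simp
  then have "sat ar M R (f1 \<circ> v) \<psi>" using decides[THEN spec, THEN mp, OF conjI[OF \<psi>(1,2)]] s1 s2 w1M w2M by blast
  then obtain f where f: "emb (g2 ` D) R M R f" "\<forall>i<n. f (v' i) = (f1 \<circ> v) i" using \<psi>(3)[OF w1M] by blast
  define P where "P = f ` g2 ` D"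
  have P: "finite P" "P \<subseteq> M" "card P \<le> card D" "d R P = d R C - u"
  proof -
    show "finite P" unfolding P_def using finD by simp
    show "P \<subseteq> M" unfolding P_def using f(1) unfolding embedding_def by blast
    show "card P \<le> card D" unfolding P_def image_comp using finD by (rule card_image_le)
    show "d R P = d R C - u"
      unfolding P_def delta_embedding[OF f(1) order_refl] delta_embedding[OF g2(1) order_refl] D(5) dCN ..
  qed
  have AP: "f1 ` A \<subseteq> P"
  proof
    fix z assume "z \<in> f1 ` A"
    then obtain i where i: "i < n" "z = (f1 \<circ> v) i" using w1 by blast
    then have "z = f (v' i)" using f(2) by simp
    moreover have "v' i \<in> g2 ` D" using v'(1,3) i(1) by auto
    ultimately show "z \<in> P" unfolding P_def by blast
  qed
  have clf1: "closed_in k (f1 ` C) M R" unfolding f1C by (rule g1(2))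
  have f1CM: "f1 ` C \<subseteq> M" using f1 unfolding embedding_def by blast
  have "card (P \<union> f1 ` C - f1 ` C) \<le> card P" using P(1) by (intro card_mono) auto
  then have "card (P \<union> f1 ` C - f1 ` C) \<le> k" using P(3) unfolding k_def by linarith
  \<comment> \<open>The image of \<open>C\<close> is closed against \<open>P\<close>, so
    submodularity forces the deficit \<open>u\<close> of \<open>P\<close> onto their intersection.
    That intersection contains the image of \<open>A\<close>, and pulling it back contradicts the
    minimality of \<open>C\<close>.\<close>
  then have "d R (f1 ` C) \<le> d R (P \<union> f1 ` C)"
    by (intro closed_inD[OF clf1]) (use P(1,2) f1CM finC in auto)
  moreover have "d R (P \<union> f1 ` C) + d R (P \<inter> f1 ` C) \<le> d R P + d R (f1 ` C)"
    by (rule submodular) (use P(1) finC in auto)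
  ultimately have small: "d R (P \<inter> f1 ` C) \<le> d R C - u" using P(4) by linarith
  obtain Y where Y: "Y \<subseteq> C" "P \<inter> f1 ` C = f1 ` Y" by (metis inf_le2 subset_imageE)
  have "f1 ` A \<subseteq> f1 ` Y" using AP C(1) Y(2) by blast
  moreover have "inj_on f1 C" using f1 unfolding embedding_def by blast
  ultimately have "A \<subseteq> Y" using inj_on_image_subset_iff[OF _ C(1) Y(1)] by metis
  then have "d R C \<le> d R Y" by (rule Cmin) (use Y(1) C(2) in blast)
  then show False using small delta_embedding[OF f1 Y(1), of \<alpha>] u(1) unfolding Y(2) by linarith
qed

end

text \<open>The chain is countable, so existence can be stated on the naturals. A type cannot be
  quantified inside the statement; the free type in the second conjunct covers atomic models on
  arbitrary universes.\<close>

theorem theorem5p17: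
  fixes L :: "'r set" and ar :: "'r \<Rightarrow> nat" and \<alpha> :: "'r \<Rightarrow> real"
  assumes "finite L"
    and "\<forall>E\<in>L. 2 \<le> ar E"
    and "\<forall>E\<in>L. 0 < \<alpha> E \<and> \<alpha> E \<le> 1"
    and "\<not> (\<forall>E\<in>L. ar E = 2 \<and> \<alpha> E = 1)"
  shows "((\<exists>(M::nat set) R. atomic_model_S L ar \<alpha> M R) \<longleftrightarrow> coherent L \<alpha>) \<and>
         (\<forall>(M::'a set) R. atomic_model_S L ar \<alpha> M R \<longrightarrow> coherent L \<alpha>)"
proof -
  \<comment> \<open>Over an empty \<open>L\<close> the excluded binary case would hold vacuously, so
    its exclusion gives \<open>L \<noteq> {}\<close>.\<close>
  interpret rank L ar \<alpha> by unfold_locales (use assms in auto)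
  have "coherent L \<alpha>" if "atomic_model_S L ar \<alpha> M R" for M :: "nat set" and R
    using that atomic_coherent unfolding atomic_model_S_def by blast
  moreover have "coherent L \<alpha>" if "atomic_model_S L ar \<alpha> M R" for M :: "'a set" and R
    using that atomic_coherent unfolding atomic_model_S_def by blast
  moreover have "\<exists>(M::nat set) R. atomic_model_S L ar \<alpha> M R" if c: "coherent L \<alpha>"
  proof -
    obtain M :: "nat set" and R where M: "model_S L ar \<alpha> M R"
      "\<And>X. finite X \<Longrightarrow> X \<subseteq> M \<Longrightarrow> \<exists>C. X \<subseteq> C \<and> C \<subseteq> M \<and> finite C \<and> d R C = 0"
      using zero_generic[OF c] by blast
    then have "atomic_structure L ar M R" by (rule zero_generic_atomic)
    with M(1) show ?thesis unfolding atomic_model_S_def by blast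
  qed
  ultimately show ?thesis by blast
qed

end
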